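(* Let $\Pi$ be a prior probability distribution on $\Omega(\mathcal T)$ and $\omega_0=(\rho_0,\pi_0)$ any point in the support of $\Pi$. Suppose that for some constants $c_0,c_1,c_2,c_3>0$ the following hold for every $\omega=(\rho,\pi)$ in the support of $\Pi$: 1. $\min_{u\in\mathcal V}\rho(u)_v\ge c_0$ for all $v\in[V]$, and $\pi(\varphi)\ge c_1$ for all $\varphi\in\Phi(\mathcal T)$; 2. all component polytopes $\mathcal S_i$ of $\omega$ satisfy the non-obtuse corner property (with a fixed $\delta>0$); and moreover 3. for any small $\epsilon>0$, $$\Pi\big(\|\rho(u)-\rho_0(u)\|\le\epsilon\ \ \forall u\in\mathcal V\big)\ge c_2\,\epsilon^{K(V-1)},\qquad \Pi\big(|\pi(\varphi)-\pi_0(\varphi)|\le\epsilon\ \ \forall\varphi\in\Phi(\mathcal T)\big)\ge c_3\,\epsilon^{I-1},$$ and the two events in this display are independent under $\Pi$. Let $X^1_{[n]},\dots,X^m_{[n]}$ be i.i.d. from $P_{n,\omega_0}$. Then, for some suitably large constant $C>0$, as $m,n\to\infty$ such that $\log n=o(m)$, $$\Pi\Big(d_{\mathcal{UH}}(\rho,\rho_0)>C\,\epsilon_{m,n}\ \Big|\ X^1_{[n]},\dots,X^m_{[n]}\Big)\to0\quad\text{in }P^\infty_{n,\omega_0}\text{-probability},$$ where $$\epsilon_{m,n}=\Big[\log(m\vee n)\Big(\frac1m+\frac1n\Big)\Big]^{\frac{1}{2[(1\vee\alpha_0)J-1]}}.$$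
   Context: Fix a vocabulary $[V]=\{1,\dots,V\}$; $\Delta^{d-1}$ is the probability simplex in $\mathbb R^d$. A directed rooted tree (DRT) $\mathcal T=(\mathcal V,\mathcal E,v_0)$ is a finite directed graph whose underlying undirected graph is a tree and which has a unique node $v_0$ (root) of in-degree $0$. A (maximal) path is a tuple of nodes starting at the root, following directed edges, and ending at a leaf; its length is its number of nodes; $\Phi(\mathcal T)$ is the set of such paths. Standing setting: $\mathcal T$ is a fixed known DRT with $K=|\mathcal V|$ nodes and $I=|\Phi(\mathcal T)|$ leaves, all of whose maximal paths have the same length $J$ (the depth of $\mathcal T$); $\alpha_0>0$ is fixed and known. $\Omega(\mathcal T)$ is the set of pairs $\omega=(\rho,\pi)$ with $\rho:\mathcal V\to\Delta^{V-1}$ injective (a topic map) and $\pi:\Phi(\mathcal T)\to[0,1]$ with $\sum_\varphi\pi(\varphi)=1$. Fix an enumeration $\varphi_1,\dots,\varphi_I$ of $\Phi(\mathcal T)$; $\pi_i=\pi(\varphi_i)$; $\theta_{i,1},\dots,\theta_{i,J}$ are the images under $\rho$ of the nodes of $\varphi_i$; $\mathcal S_i=\operatorname{conv}\{\theta_{i,1},\dots,\theta_{i,J}\}$ is the $i$-th component polytope. $P_{n,\omega}$ is the distribution on $[V]^n$ of a document $X_{[n]}=(X_1,\dots,X_n)$, with probability mass function $$p_{n,\omega}(x_1,\dots,x_n)=\sum_{i=1}^I\pi_i\int_{\Delta^{J-1}}\prod_{v\in[V]}\Big(\sum_{k=1}^{J}\beta_k(\theta_{i,k})_v\Big)^{m_v}\mathrm{Dir}_{J,\alpha_0}(d\beta),\quad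 m_v=\#\{j:x_j=v\},$$ with $\mathrm{Dir}_{J,\alpha_0}$ the symmetric Dirichlet distribution on $\Delta^{J-1}$. Union Hausdorff metric: for topic maps $\rho,\rho'$ on $\mathcal T$ with component polytopes $\mathcal S_i$, $\mathcal S'_i$, $d_{\mathcal{UH}}(\rho,\rho')=d_{\mathcal H}(\bigcup_{i}\mathcal S_i,\bigcup_i\mathcal S'_i)$, with $d_{\mathcal H}$ the Hausdorff metric (Euclidean distance). Non-obtuse corner property: for a fixed number $\delta>0$, a convex polytope $\mathcal S$ has it if at each vertex of $\mathcal S$ there is a supporting hyperplane whose angle formed with any edge adjacent to that vertex is bounded from below by $\delta$. $\|\cdot\|$ is the Euclidean norm; $a\vee b=\max(a,b)$; $\Pi(\cdot\mid X^1_{[n]},\dots,X^m_{[n]})$ is the posterior distribution of $\omega$.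
   Formalization: The depth J is assumed to be at least 2; for the one-node tree (J=1) the exponent of the rate is undefined when α₀≤1, and the claim is false when 1<α₀<3/2 (take m=n). *)

theory Defs
  imports
    "HOL-Probability.Probability"
    "HOL-Library.Landau_Symbols"
    "Graph_Theory.Digraph_Component"
    "Graph_Theory.Vertex_Walk"
begin

text \<open>
  The locale \<open>pair_digraph\<close> provides finiteness and the absence of loops and parallel arcs.
  The predicate \<open>tree\<close> of Graph\_Theory only excludes directed cycles and is therefore not used:
  acyclicity is required of the underlying undirected graph, in which a pair of antiparallel
  arcs would be a double edge, i.e. a cycle of length 2.
\<close>

definition undirected_acyclic :: "'u pair_pre_digraph \<Rightarrow> bool" where
  "undirected_acyclic G \<longleftrightarrow>
     (\<forall>u v. (u, v) \<in> parcs G \<longrightarrow> (v, u) \<notin> parcs G) \<and>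
     \<not> (\<exists>p. vpath p (mk_symmetric G) \<and> 3 \<le> length p \<and> (last p, hd p) \<in> parcs (mk_symmetric G))"

definition directed_rooted_tree :: "'u pair_pre_digraph \<Rightarrow> 'u \<Rightarrow> bool" where
  "directed_rooted_tree G r \<longleftrightarrow>
     pair_digraph G \<and> Digraph_Component.connected G \<and> undirected_acyclic G \<and>
     {v \<in> pverts G. in_degree G v = 0} = {r}"

definition maximal_paths :: "'u pair_pre_digraph \<Rightarrow> 'u \<Rightarrow> 'u list set" where
  "maximal_paths G r = {p. vwalk p G \<and> hd p = r \<and> out_degree G (last p) = 0}"

definition prob_simplex :: "(real ^ 'v) set" where
  "prob_simplex = {x. (\<forall>v. 0 \<le> x $ v) \<and> (\<Sum>v\<in>UNIV. x $ v) = 1}"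

text \<open>
  The vocabulary is the finite type \<open>'v\<close>. Maps defined on the nodes or on the maximal paths are
  represented by extensional functions.
\<close>

type_synonym ('u, 'v) param = "('u \<Rightarrow> real ^ 'v) \<times> ('u list \<Rightarrow> real)"

definition param_space :: "'u pair_pre_digraph \<Rightarrow> 'u \<Rightarrow> ('u, 'v::finite) param set" where
  "param_space G r = {(\<rho>, \<pi>).
     \<rho> \<in> pverts G \<rightarrow>\<^sub>E prob_simplex \<and> inj_on \<rho> (pverts G) \<and>
     \<pi> \<in> maximal_paths G r \<rightarrow>\<^sub>E {0..1} \<and> (\<Sum>\<phi>\<in>maximal_paths G r. \<pi> \<phi>) = 1}"

definition param_topology :: "'u pair_pre_digraph \<Rightarrow> 'u \<Rightarrow> ('u, 'v::finite) param topology" where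
  "param_topology G r =
     subtopology
       (prod_topology (product_topology (\<lambda>_. euclidean) (pverts G))
                      (product_topology (\<lambda>_. euclidean) (maximal_paths G r)))
       (param_space G r)"

text \<open>The Borel sets of the (second countable) topology above:\<close>

definition param_measurable_space :: "'u pair_pre_digraph \<Rightarrow> 'u \<Rightarrow> ('u, 'v::finite) param measure" where
  "param_measurable_space G r =
     restrict_space
       ((\<Pi>\<^sub>M u\<in>pverts G. borel) \<Otimes>\<^sub>M (\<Pi>\<^sub>M \<phi>\<in>maximal_paths G r. borel))
       (param_space G r)"

definition measure_support :: "'a topology \<Rightarrow> 'a measure \<Rightarrow> 'a set" where
  "measure_support T M = {x \<in> topspace T. \<forall>U. openin T U \<and> x \<in> U \<longrightarrow> 0 < emeasure M U}"

text \<open>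
  The symmetric Dirichlet distribution on the simplex of vectors indexed by \<open>0, \<dots>, J - 1\<close>,
  given by its Lebesgue density in the first \<open>J - 1\<close> coordinates; for \<open>J = 1\<close> this is
  the point mass at the vector with single entry 1.
\<close>

definition sym_dirichlet_density :: "nat \<Rightarrow> real \<Rightarrow> (nat \<Rightarrow> real) \<Rightarrow> real" where
  "sym_dirichlet_density J \<alpha> x =
     (if (\<forall>k<J - 1. 0 < x k) \<and> (\<Sum>k<J - 1. x k) < 1
      then Gamma (real J * \<alpha>) / Gamma \<alpha> ^ J *
           (\<Prod>k<J - 1. x k powr (\<alpha> - 1)) * (1 - (\<Sum>k<J - 1. x k)) powr (\<alpha> - 1)
      else 0)"

definition sym_dirichlet :: "nat \<Rightarrow> real \<Rightarrow> (nat \<Rightarrow> real) measure" where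
  "sym_dirichlet J \<alpha> =
     distr (density (\<Pi>\<^sub>M k\<in>{..<J - 1}. lborel) (\<lambda>x. ennreal (sym_dirichlet_density J \<alpha> x)))
       (\<Pi>\<^sub>M k\<in>{..<J}. borel)
       (\<lambda>x. \<lambda>k\<in>{..<J}. if k < J - 1 then x k else 1 - (\<Sum>l<J - 1. x l))"

definition doc_pmf ::
  "'u pair_pre_digraph \<Rightarrow> 'u \<Rightarrow> nat \<Rightarrow> real \<Rightarrow> ('u, 'v::finite) param \<Rightarrow> 'v list \<Rightarrow> real" where
  "doc_pmf G r J \<alpha> \<omega> xs =
     (\<Sum>\<phi>\<in>maximal_paths G r. snd \<omega> \<phi> *
       (\<integral>\<beta>. (\<Prod>v\<in>UNIV. (\<Sum>k<J. \<beta> k * (fst \<omega> (\<phi> ! k) $ v)) ^ count_list xs v) \<partial>sym_dirichlet J \<alpha>))"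

definition doc_measure ::
  "'u pair_pre_digraph \<Rightarrow> 'u \<Rightarrow> nat \<Rightarrow> real \<Rightarrow> nat \<Rightarrow> ('u, 'v::finite) param \<Rightarrow> 'v list measure" where
  "doc_measure G r J \<alpha> n \<omega> =
     point_measure {xs. length xs = n} (\<lambda>xs. ennreal (doc_pmf G r J \<alpha> \<omega> xs))"

text \<open>
  Posterior given the first \<open>m\<close> documents of \<open>X\<close>, by Bayes' formula: the model is dominated
  by the counting measure on documents.
\<close>

definition likelihood ::
  "'u pair_pre_digraph \<Rightarrow> 'u \<Rightarrow> nat \<Rightarrow> real \<Rightarrow> nat \<Rightarrow> (nat \<Rightarrow> 'v list) \<Rightarrow> ('u, 'v::finite) param \<Rightarrow> real" where
  "likelihood G r J \<alpha> m X \<omega> = (\<Prod>j<m. doc_pmf G r J \<alpha> \<omega> (X j))"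

definition posterior ::
  "'u pair_pre_digraph \<Rightarrow> 'u \<Rightarrow> nat \<Rightarrow> real \<Rightarrow> ('u, 'v::finite) param measure \<Rightarrow>
     nat \<Rightarrow> (nat \<Rightarrow> 'v list) \<Rightarrow> ('u, 'v) param measure" where
  "posterior G r J \<alpha> prior m X =
     density prior (\<lambda>\<omega>. ennreal (likelihood G r J \<alpha> m X \<omega>) /
                        (\<integral>\<^sup>+\<omega>'. ennreal (likelihood G r J \<alpha> m X \<omega>') \<partial>prior))"

definition component_polytope :: "('u \<Rightarrow> real ^ 'v::finite) \<Rightarrow> 'u list \<Rightarrow> (real ^ 'v) set" where
  "component_polytope \<rho> \<phi> = convex hull (\<rho> ` set \<phi>)"

definition hausdorff_dist :: "'a::metric_space set \<Rightarrow> 'a set \<Rightarrow> real" where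
  "hausdorff_dist A B = max (SUP a\<in>A. infdist a B) (SUP b\<in>B. infdist b A)"

definition union_hausdorff ::
  "'u pair_pre_digraph \<Rightarrow> 'u \<Rightarrow> ('u \<Rightarrow> real ^ 'v::finite) \<Rightarrow> ('u \<Rightarrow> real ^ 'v) \<Rightarrow> real" where
  "union_hausdorff G r \<rho> \<rho>' =
     hausdorff_dist (\<Union>\<phi>\<in>maximal_paths G r. component_polytope \<rho> \<phi>)
                    (\<Union>\<phi>\<in>maximal_paths G r. component_polytope \<rho>' \<phi>)"

text \<open>Angle, in \<open>[0, \<pi>/2]\<close>, between the direction \<open>w\<close> and a hyperplane with normal vector \<open>a\<close>:\<close>

definition hyperplane_angle :: "'a::real_inner \<Rightarrow> 'a \<Rightarrow> real" where
  "hyperplane_angle a w = arcsin (\<bar>a \<bullet> w\<bar> / (norm a * norm w))"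

definition non_obtuse_corner :: "real \<Rightarrow> 'a::euclidean_space set \<Rightarrow> bool" where
  "non_obtuse_corner \<delta> S \<longleftrightarrow>
     (\<forall>x. x extreme_point_of S \<longrightarrow>
        (\<exists>a. a \<noteq> 0 \<and> S \<subseteq> {y. a \<bullet> x \<le> a \<bullet> y} \<and>
             (\<forall>e y. e edge_of S \<and> x \<in> e \<and> y \<in> e \<and> y \<noteq> x \<longrightarrow> \<delta> \<le> hyperplane_angle a (y - x))))"

definition contraction_rate :: "nat \<Rightarrow> real \<Rightarrow> nat \<Rightarrow> nat \<Rightarrow> real" where
  "contraction_rate J \<alpha> m n =
     (ln (real (max m n)) * (1 / real m + 1 / real n)) powr (1 / (2 * (max 1 \<alpha> * real J - 1)))"

end

theory Submission
  imports Defs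
begin

text \<open>
  The likelihood ratio of \<open>m\<close> documents of length \<open>n\<close> is bounded below by \<open>1/4\<close>, for every data set, as
  soon as the parameters agree with the truth up to a small multiple of \<open>1 / (m n)\<close>; so the marginal
  likelihood is at least a fixed power of \<open>1 / (m n)\<close> times the likelihood of the truth. It then suffices
  to find an event of data sets that is typical under the truth and whose probability under every
  far parameter is smaller than a given power of \<open>max m n\<close>. By Hoeffding's inequality the empirical
  distribution of each document stays within order \<open>sqrt (ln (max m n) / n)\<close> of the union of the
  component polytopes, while a ball of radius \<open>\<epsilon>\<close> around a point of a component polytope receives a document
  with probability of order at least \<open>\<epsilon> powr (max 1 \<alpha> * J - 1)\<close>, by a lower bound on the Dirichlet mass of small balls.
  The rate is the radius for which \<open>m\<close> documents then hit each ball up to an error smaller than any power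
  of \<open>max m n\<close>, and this is where \<open>ln n = o(m)\<close> enters.
\<close>

section \<open>The symmetric Dirichlet distribution\<close>

text \<open>The typical data sets are chosen from the truth alone, so a sum over them can be
  exchanged with the prior integral, and a bound uniform in the far parameters is enough. Two scales
  then have to meet. Put \<open>b = max 1 \<alpha> * J - 1\<close>, \<open>l = max m n\<close> and
  \<open>y = ln l * (1/m + 1/n)\<close>; the rate is
  \<open>\<epsilon> = y powr (1 / (2 * b))\<close>. To hit a ball of radius \<epsilon> with an error
  below any power of \<open>l\<close>, \<open>m * \<epsilon> powr b = m * sqrt y\<close> must exceed
  a large multiple of \<open>ln l\<close>. Since \<open>m * sqrt y\<close> is at least
  \<open>sqrt (m * ln l)\<close>, it suffices that \<open>ln l\<close> is a small multiple of
  \<open>m\<close>; for the part \<open>ln m\<close> this is automatic. Reading a mixture off the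
  word frequencies costs about \<open>sqrt (ln l / n)\<close>, hence at most \<open>sqrt y\<close>,
  and for \<open>y \<le> 1\<close> this is at most \<epsilon> because \<open>b \<ge> 1\<close> when
  \<open>J \<ge> 2\<close>. For \<open>y > 1\<close> the claim is trivial, the topic simplex being
  bounded.\<close>

lemma Beta_real_pos: "0 < a \<Longrightarrow> 0 < b \<Longrightarrow> 0 < Beta a (b :: real)"
  by (simp add: Beta_def)

text \<open>The substitution \<open>y = s * t\<close> reduces this to the Beta integral. It is the
  inner integral that arises when the coordinates of the simplex are integrated out one at a time,
  \<open>s\<close> being the mass left by the others.\<close>

lemma nn_integral_Beta_scaled:
  fixes a b s :: real
  assumes "0 < a" "0 < b" "0 < s"
  shows "(\<integral>\<^sup>+y. ennreal (if 0 < y \<and> y < s then y powr (a - 1) * (s - y) powr (b - 1) else 0) \<partial>lborel)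
     = ennreal (s powr (a + b - 1) * Beta a b)" (is "?L = _")
proof -
  have "?L = ennreal \<bar>s\<bar> * (\<integral>\<^sup>+t. ennreal (if 0 < 0 + s * t \<and> 0 + s * t < s
        then (0 + s * t) powr (a - 1) * (s - (0 + s * t)) powr (b - 1) else 0) \<partial>lborel)"
    by (rule nn_integral_real_affine) (use assms in auto)
  also have "(\<integral>\<^sup>+t. ennreal (if 0 < 0 + s * t \<and> 0 + s * t < s
        then (0 + s * t) powr (a - 1) * (s - (0 + s * t)) powr (b - 1) else 0) \<partial>lborel)
      = (\<integral>\<^sup>+t. ennreal (s powr (a + b - 2)) *
          ennreal (indicator {0..1} t * (t powr (a - 1) * (1 - t) powr (b - 1))) \<partial>lborel)"
  proof (rule nn_integral_cong)
    fix t :: real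
    show "ennreal (if 0 < 0 + s * t \<and> 0 + s * t < s
        then (0 + s * t) powr (a - 1) * (s - (0 + s * t)) powr (b - 1) else 0) =
       ennreal (s powr (a + b - 2)) * ennreal (indicator {0..1} t * (t powr (a - 1) * (1 - t) powr (b - 1)))"
    proof (cases "0 < t \<and> t < 1")
      case True
      have "(s * t) powr (a - 1) * (s - s * t) powr (b - 1)
          = (s * t) powr (a - 1) * (s * (1 - t)) powr (b - 1)" by (simp add: algebra_simps)
      also have "\<dots> = (s powr (a - 1) * s powr (b - 1)) * (t powr (a - 1) * (1 - t) powr (b - 1))"
        using True assms by (simp add: powr_mult)
      also have "s powr (a - 1) * s powr (b - 1) = s powr (a + b - 2)"
        by (simp add: powr_add [symmetric] algebra_simps)
      finally show ?thesis using True assms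
        by (simp add: ennreal_mult')
    next
      case False
      then show ?thesis using assms
        by (auto simp: zero_less_mult_iff indicator_def not_less le_less)
    qed
  qed
  also have "\<dots> = ennreal (s powr (a + b - 2)) *
      (\<integral>\<^sup>+t. ennreal (indicator {0..1} t * (t powr (a - 1) * (1 - t) powr (b - 1))) \<partial>lborel)"
    by (rule nn_integral_cmult) auto
  also have "(\<integral>\<^sup>+t. ennreal (indicator {0..1} t * (t powr (a - 1) * (1 - t) powr (b - 1))) \<partial>lborel)
     = ennreal (Beta a b)"
    by (rule nn_integral_has_integral_lebesgue) (use has_integral_Beta_real[OF assms(1,2)] in auto)
  also have "ennreal \<bar>s\<bar> * (ennreal (s powr (a + b - 2)) * ennreal (Beta a b))
      = ennreal (s * s powr (a + b - 2) * Beta a b)"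
    using assms by (simp add: ennreal_mult' ennreal_mult'' mult.assoc)
  also have "s * s powr (a + b - 2) = s powr (a + b - 1)"
    using assms powr_add[of s 1 "a + b - 2"] by simp
  finally show ?thesis .
qed

text \<open>The unnormalised density in the \<open>d\<close> free coordinates. The exponent \<gamma>
  of the completing coordinate is kept apart from \<alpha>, because integrating out one coordinate
  turns it into \<alpha> + \<gamma>; with equal exponents the induction on \<open>d\<close> would
  not close.\<close>

definition dirichlet_kernel :: "nat \<Rightarrow> real \<Rightarrow> real \<Rightarrow> (nat \<Rightarrow> real) \<Rightarrow> real" where
  "dirichlet_kernel d \<alpha> \<gamma> x =
     (if (\<forall>k<d. 0 < x k) \<and> (\<Sum>k<d. x k) < 1
      then (\<Prod>k<d. x k powr (\<alpha> - 1)) * (1 - (\<Sum>k<d. x k)) powr (\<gamma> - 1) else 0)"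

lemma measurable_dirichlet_kernel [measurable]:
  "dirichlet_kernel d \<alpha> \<gamma> \<in> borel_measurable (\<Pi>\<^sub>M k\<in>{..<d}. lborel)"
proof -
  have [measurable]: "(\<lambda>x. x k) \<in> borel_measurable (\<Pi>\<^sub>M k\<in>{..<d}. lborel)" if "k < d" for k
    using measurable_component_singleton[of k "{..<d}" "\<lambda>_. lborel"] that by auto
  have "dirichlet_kernel d \<alpha> \<gamma> = (\<lambda>x. if (\<forall>k\<in>{..<d}. 0 < x k) \<and> (\<Sum>k<d. x k) < 1
      then (\<Prod>k<d. x k powr (\<alpha> - 1)) * (1 - (\<Sum>k<d. x k)) powr (\<gamma> - 1) else 0)"
    by (auto simp: dirichlet_kernel_def fun_eq_iff)
  also have "\<dots> \<in> borel_measurable (\<Pi>\<^sub>M k\<in>{..<d}. lborel)"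
    by measurable
  finally show ?thesis .
qed

lemma dirichlet_kernel_fun_upd:
  assumes "0 < \<alpha>" "0 < \<gamma>"
  shows "(\<integral>\<^sup>+y. ennreal (dirichlet_kernel (Suc d) \<alpha> \<gamma> (x(d := y))) \<partial>lborel)
     = ennreal (Beta \<alpha> \<gamma>) * ennreal (dirichlet_kernel d \<alpha> (\<alpha> + \<gamma>) x)"
proof (cases "(\<forall>k<d. 0 < x k) \<and> (\<Sum>k<d. x k) < 1")
  case True
  define P where "P = (\<Prod>k<d. x k powr (\<alpha> - 1))"
  define s where "s = 1 - (\<Sum>k<d. x k)"
  have P: "0 \<le> P" unfolding P_def by (simp add: prod_nonneg)
  have s: "0 < s" using True by (simp add: s_def)
  have [simp]: "(\<Sum>k<d. (x(d := y)) k) = (\<Sum>k<d. x k)"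
    "(\<Prod>k<d. (x(d := y)) k powr (\<alpha> - 1)) = P" for y
    by (auto simp: P_def intro!: sum.cong prod.cong)
  have "dirichlet_kernel (Suc d) \<alpha> \<gamma> (x(d := y)) =
      P * (if 0 < y \<and> y < s then y powr (\<alpha> - 1) * (s - y) powr (\<gamma> - 1) else 0)" for y
    using True unfolding dirichlet_kernel_def
    by (auto simp: s_def P_def less_Suc_eq algebra_simps intro!: prod.cong)
  then have "(\<integral>\<^sup>+y. ennreal (dirichlet_kernel (Suc d) \<alpha> \<gamma> (x(d := y))) \<partial>lborel)
     = (\<integral>\<^sup>+y. ennreal P * ennreal (if 0 < y \<and> y < s then y powr (\<alpha> - 1) * (s - y) powr (\<gamma> - 1) else 0) \<partial>lborel)"
    using P by (simp add: ennreal_mult')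
  also have "\<dots> = ennreal P * ennreal (s powr (\<alpha> + \<gamma> - 1) * Beta \<alpha> \<gamma>)"
    by (subst nn_integral_cmult) (auto simp: nn_integral_Beta_scaled[OF assms s])
  also have "\<dots> = ennreal (Beta \<alpha> \<gamma>) * ennreal (dirichlet_kernel d \<alpha> (\<alpha> + \<gamma>) x)"
    using True P Beta_real_pos[OF assms]
    by (simp add: dirichlet_kernel_def P_def s_def ennreal_mult'[symmetric] mult_ac flip: ennreal_mult'')
  finally show ?thesis .
next
  case False
  have [simp]: "(\<Sum>k<d. (x(d := y)) k) = (\<Sum>k<d. x k)" for y
    by (auto intro!: sum.cong)
  \<comment> \<open>If the first \<open>d\<close> coordinates already violate the constraints, no
    new one repairs this: a positive one only increases the sum.\<close>
  have "dirichlet_kernel (Suc d) \<alpha> \<gamma> (x(d := y)) = 0" for y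
    using False unfolding dirichlet_kernel_def by (force simp: less_Suc_eq)
  moreover have "dirichlet_kernel d \<alpha> (\<alpha> + \<gamma>) x = 0"
    using False unfolding dirichlet_kernel_def by auto
  ultimately show ?thesis by simp
qed

text \<open>Each coordinate integrated out contributes a Beta factor whose second argument grows by
  \<alpha>, and the resulting Gamma quotients telescope.\<close>

lemma nn_integral_dirichlet_kernel:
  assumes "0 < \<alpha>" "0 < \<gamma>"
  shows "(\<integral>\<^sup>+x. ennreal (dirichlet_kernel d \<alpha> \<gamma> x) \<partial>(\<Pi>\<^sub>M k\<in>{..<d}. lborel))
     = ennreal (Gamma \<alpha> ^ d * Gamma \<gamma> / Gamma (real d * \<alpha> + \<gamma>))"
  using assms(2)
proof (induction d arbitrary: \<gamma>)
  case 0
  then have "Gamma \<gamma> \<noteq> 0" using Gamma_real_pos[of \<gamma>] by linarith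
  then show ?case
    by (simp add: PiM_empty nn_integral_count_space_finite dirichlet_kernel_def)
next
  case (Suc d)
  interpret product_sigma_finite "\<lambda>_. lborel :: real measure" by standard
  have "(\<integral>\<^sup>+x. ennreal (dirichlet_kernel (Suc d) \<alpha> \<gamma> x) \<partial>(\<Pi>\<^sub>M k\<in>{..<Suc d}. lborel))
      = (\<integral>\<^sup>+x. ennreal (dirichlet_kernel (Suc d) \<alpha> \<gamma> x) \<partial>(\<Pi>\<^sub>M k\<in>insert d {..<d}. lborel))"
    by (simp add: lessThan_Suc)
  also have "\<dots> = (\<integral>\<^sup>+x. \<integral>\<^sup>+y. ennreal (dirichlet_kernel (Suc d) \<alpha> \<gamma> (x(d := y))) \<partial>lborel \<partial>(\<Pi>\<^sub>M k\<in>{..<d}. lborel))"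
    by (rule product_nn_integral_insert) (use measurable_dirichlet_kernel[of "Suc d" \<alpha> \<gamma>] in \<open>auto simp: lessThan_Suc\<close>)
  also have "\<dots> = (\<integral>\<^sup>+x. ennreal (Beta \<alpha> \<gamma>) * ennreal (dirichlet_kernel d \<alpha> (\<alpha> + \<gamma>) x) \<partial>(\<Pi>\<^sub>M k\<in>{..<d}. lborel))"
    by (simp add: dirichlet_kernel_fun_upd[OF assms(1) Suc.prems])
  also have "\<dots> = ennreal (Beta \<alpha> \<gamma>) * ennreal (Gamma \<alpha> ^ d * Gamma (\<alpha> + \<gamma>) / Gamma (real d * \<alpha> + (\<alpha> + \<gamma>)))"
    by (subst nn_integral_cmult) (use Suc assms(1) in auto)
  also have "\<dots> = ennreal (Gamma \<alpha> ^ Suc d * Gamma \<gamma> / Gamma (real (Suc d) * \<alpha> + \<gamma>))"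
  proof -
    have g: "Gamma (\<alpha> + \<gamma>) > 0" "Gamma \<alpha> > 0" "Gamma \<gamma> > 0" "Gamma (real d * \<alpha> + (\<alpha> + \<gamma>)) > 0"
      using assms(1) Suc.prems by (auto intro!: Gamma_real_pos add_nonneg_pos)
    have "Beta \<alpha> \<gamma> * (Gamma \<alpha> ^ d * Gamma (\<alpha> + \<gamma>) / Gamma (real d * \<alpha> + (\<alpha> + \<gamma>)))
       = Gamma \<alpha> ^ Suc d * Gamma \<gamma> / Gamma (real (Suc d) * \<alpha> + \<gamma>)"
      using g by (simp add: Beta_def field_simps)
    then show ?thesis using Beta_real_pos[OF assms(1) Suc.prems]
      by (simp add: ennreal_mult'[symmetric])
  qed
  finally show ?case .
qed

section \<open>Total mass and support of the Dirichlet distribution\<close>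

lemma sym_dirichlet_density_conv_kernel:
  assumes "1 \<le> J"
  shows "sym_dirichlet_density J \<alpha> x = Gamma (real J * \<alpha>) / Gamma \<alpha> ^ J * dirichlet_kernel (J - 1) \<alpha> \<alpha> x"
  unfolding sym_dirichlet_density_def dirichlet_kernel_def by (auto simp: mult.assoc)

lemma nn_integral_sym_dirichlet_density:
  assumes "1 \<le> J" "0 < \<alpha>"
  shows "(\<integral>\<^sup>+x. ennreal (sym_dirichlet_density J \<alpha> x) \<partial>(\<Pi>\<^sub>M k\<in>{..<J - 1}. lborel)) = 1"
proof -
  obtain d where J: "J = Suc d" using assms by (cases J) auto
  have pos: "Gamma (real J * \<alpha>) > 0" "Gamma \<alpha> > 0" using assms by auto
  have "(\<integral>\<^sup>+x. ennreal (sym_dirichlet_density J \<alpha> x) \<partial>(\<Pi>\<^sub>M k\<in>{..<J - 1}. lborel))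
     = (\<integral>\<^sup>+x. ennreal (Gamma (real J * \<alpha>) / Gamma \<alpha> ^ J) * ennreal (dirichlet_kernel (J - 1) \<alpha> \<alpha> x) \<partial>(\<Pi>\<^sub>M k\<in>{..<J - 1}. lborel))"
    using pos by (intro nn_integral_cong) (simp add: sym_dirichlet_density_conv_kernel[OF assms(1)] flip: ennreal_mult')
  also have "\<dots> = ennreal (Gamma (real J * \<alpha>) / Gamma \<alpha> ^ J) * ennreal (Gamma \<alpha> ^ (J - 1) * Gamma \<alpha> / Gamma (real (J - 1) * \<alpha> + \<alpha>))"
    by (subst nn_integral_cmult) (auto simp: nn_integral_dirichlet_kernel assms)
  also have "\<dots> = ennreal (Gamma (real J * \<alpha>) / Gamma \<alpha> ^ J * (Gamma \<alpha> ^ (J - 1) * Gamma \<alpha> / Gamma (real (J - 1) * \<alpha> + \<alpha>)))"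
    using pos by (subst ennreal_mult') auto
  also have "Gamma (real J * \<alpha>) / Gamma \<alpha> ^ J * (Gamma \<alpha> ^ (J - 1) * Gamma \<alpha> / Gamma (real (J - 1) * \<alpha> + \<alpha>)) = 1"
    using pos unfolding J by (simp add: field_simps)
  finally show ?thesis by simp
qed

lemma measurable_sym_dirichlet_density [measurable]:
  assumes "1 \<le> J"
  shows "sym_dirichlet_density J \<alpha> \<in> borel_measurable (\<Pi>\<^sub>M k\<in>{..<J - 1}. lborel)"
  unfolding sym_dirichlet_density_conv_kernel[OF assms, abs_def] by measurable

lemma measurable_complete_simplex [measurable]:
  "(\<lambda>x. \<lambda>k\<in>{..<J}. if k < J - 1 then x k else 1 - (\<Sum>l<J - 1. x l))
     \<in> (\<Pi>\<^sub>M k\<in>{..<J - 1}. lborel) \<rightarrow>\<^sub>M (\<Pi>\<^sub>M k\<in>{..<J}. (borel :: real measure))"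
proof (rule measurable_restrict)
  fix k assume "k \<in> {..<J}"
  have [measurable]: "(\<lambda>x. x l) \<in> borel_measurable (\<Pi>\<^sub>M k\<in>{..<J - 1}. lborel)" if "l < J - 1" for l
    using measurable_component_singleton[of l "{..<J - 1}" "\<lambda>_. lborel"] that by auto
  show "(\<lambda>x. if k < J - 1 then x k else 1 - (\<Sum>l<J - 1. x l)) \<in> borel_measurable (\<Pi>\<^sub>M k\<in>{..<J - 1}. lborel)"
    by (cases "k < J - 1") (auto intro!: borel_measurable_diff borel_measurable_sum)
qed

lemma sets_sym_dirichlet [simp, measurable_cong]:
  "sets (sym_dirichlet J \<alpha>) = sets (\<Pi>\<^sub>M k\<in>{..<J}. borel)"
  by (simp add: sym_dirichlet_def)

lemma space_sym_dirichlet [simp]: "space (sym_dirichlet J \<alpha>) = {..<J} \<rightarrow>\<^sub>E UNIV"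
  by (simp add: sym_dirichlet_def space_PiM)

lemma prob_space_sym_dirichlet:
  assumes "1 \<le> J" "0 < \<alpha>"
  shows "prob_space (sym_dirichlet J \<alpha>)"
  unfolding sym_dirichlet_def
proof (rule prob_space.prob_space_distr)
  note [measurable] = measurable_sym_dirichlet_density[OF assms(1)]
  show "prob_space (density (\<Pi>\<^sub>M k\<in>{..<J - 1}. lborel) (\<lambda>x. ennreal (sym_dirichlet_density J \<alpha> x)))"
  proof (rule prob_spaceI)
    have "emeasure (density (\<Pi>\<^sub>M k\<in>{..<J - 1}. lborel) (\<lambda>x. ennreal (sym_dirichlet_density J \<alpha> x)))
        (space (\<Pi>\<^sub>M k\<in>{..<J - 1}. lborel))
      = (\<integral>\<^sup>+x. ennreal (sym_dirichlet_density J \<alpha> x) \<partial>(\<Pi>\<^sub>M k\<in>{..<J - 1}. lborel))"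
      by (subst emeasure_density) (auto simp del: One_nat_def intro!: nn_integral_cong)
    then show "emeasure (density (\<Pi>\<^sub>M k\<in>{..<J - 1}. lborel) (\<lambda>x. ennreal (sym_dirichlet_density J \<alpha> x)))
        (space (density (\<Pi>\<^sub>M k\<in>{..<J - 1}. lborel) (\<lambda>x. ennreal (sym_dirichlet_density J \<alpha> x)))) = 1"
      by (simp add: nn_integral_sym_dirichlet_density[OF assms, simplified])
  qed
  show "(\<lambda>x. \<lambda>k\<in>{..<J}. if k < J - 1 then x k else 1 - (\<Sum>l<J - 1. x l))
     \<in> density (\<Pi>\<^sub>M k\<in>{..<J - 1}. lborel) (\<lambda>x. ennreal (sym_dirichlet_density J \<alpha> x)) \<rightarrow>\<^sub>M (\<Pi>\<^sub>M k\<in>{..<J}. borel)"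
    using measurable_complete_simplex by (simp del: One_nat_def)
qed

text \<open>Values at indices from \<open>J\<close> on are left free, so that unit vectors and
  pointwise convex combinations are members without being made extensional.\<close>

definition simplex_coeffs :: "nat \<Rightarrow> (nat \<Rightarrow> real) set" where
  "simplex_coeffs J = {\<beta>. (\<forall>k<J. 0 \<le> \<beta> k) \<and> (\<Sum>k<J. \<beta> k) = 1}"

lemma pred_simplex_coeffs [measurable]:
  "Measurable.pred (\<Pi>\<^sub>M k\<in>{..<J}. (borel :: real measure)) (\<lambda>\<beta>. \<beta> \<in> simplex_coeffs J)"
proof -
  have "(\<lambda>\<beta>. \<beta> \<in> simplex_coeffs J) = (\<lambda>\<beta>. (\<forall>k\<in>{..<J}. 0 \<le> \<beta> k) \<and> (\<Sum>k<J. \<beta> k) = 1)"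
    by (auto simp: simplex_coeffs_def)
  then show ?thesis by simp
qed

lemma complete_simplex_sum:
  fixes x :: "nat \<Rightarrow> real"
  assumes "1 \<le> J"
  shows "(\<Sum>k<J. (\<lambda>k\<in>{..<J}. if k < J - 1 then x k else 1 - (\<Sum>l<J - 1. x l)) k) = 1"
proof -
  obtain d where J: "J = Suc d" using assms by (cases J) auto
  show ?thesis by (simp add: J)
qed

lemma AE_sym_dirichlet:
  assumes "1 \<le> J"
  shows "AE \<beta> in sym_dirichlet J \<alpha>. \<beta> \<in> simplex_coeffs J"
proof -
  note [measurable] = measurable_sym_dirichlet_density[OF assms(1)]
  have "AE x in density (\<Pi>\<^sub>M k\<in>{..<J - 1}. lborel) (\<lambda>x. ennreal (sym_dirichlet_density J \<alpha> x)).
    (\<lambda>k\<in>{..<J}. if k < J - 1 then x k else 1 - (\<Sum>l<J - 1. x l)) \<in> simplex_coeffs J"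
  proof (subst AE_density, measurable, rule AE_I2, rule impI)
    fix x :: "nat \<Rightarrow> real" assume "0 < ennreal (sym_dirichlet_density J \<alpha> x)"
    then have "(\<forall>k<J - 1. 0 < x k) \<and> (\<Sum>k<J - 1. x k) < 1"
      by (auto simp: sym_dirichlet_density_def split: if_splits)
    then show "(\<lambda>k\<in>{..<J}. if k < J - 1 then x k else 1 - (\<Sum>l<J - 1. x l)) \<in> simplex_coeffs J"
      unfolding simplex_coeffs_def using complete_simplex_sum[OF assms, of x] by (auto intro: less_imp_le)
  qed
  then show ?thesis
    unfolding sym_dirichlet_def
    by (subst AE_distr_iff) (simp_all del: One_nat_def add: predE)
qed

section \<open>Dirichlet mass of small balls\<close>

lemma powr_ge_of_ge:
  fixes w x \<alpha> :: real
  assumes "0 < w" "w \<le> x" "x \<le> 1"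
  shows "w powr (max 1 \<alpha> - 1) \<le> x powr (\<alpha> - 1)"
proof (cases "1 \<le> \<alpha>")
  case True
  then show ?thesis using assms by (simp add: powr_mono2)
next
  case False
  \<comment> \<open>For \<alpha> < 1 the power is decreasing, so on (0, 1] it is at least its value
    1 at the right end; the left-hand side equals 1 too, its exponent being 0.\<close>
  then have "1 \<le> x powr (\<alpha> - 1)" using assms powr_mono2'[of "\<alpha> - 1" x 1] by simp
  then show ?thesis using False assms by simp
qed

text \<open>All \<open>J\<close> factors, that of the completing coordinate included, are bounded
  separately. For \<alpha> \<ge> 1 the density may vanish at the boundary and the bound decays with
  \<open>w\<close>; for \<alpha> < 1 it is constant in \<open>w\<close>.\<close>

lemma sym_dirichlet_density_ge:
  assumes "1 \<le> J" "0 < \<alpha>" and w: "0 < w"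
    and x: "\<And>k. k < J - 1 \<Longrightarrow> w \<le> x k" "w \<le> 1 - (\<Sum>k<J - 1. x k)"
  shows "Gamma (real J * \<alpha>) / Gamma \<alpha> ^ J * (w powr (max 1 \<alpha> - 1)) ^ J \<le> sym_dirichlet_density J \<alpha> x"
proof -
  obtain d where J: "J = Suc d" using assms by (cases J) auto
  have x0: "0 \<le> x k" if "k < d" for k using x(1)[of k] that w J by auto
  have x1: "x k \<le> 1" if "k < d" for k
  proof -
    have "x k \<le> (\<Sum>k<d. x k)" using that x0 by (intro member_le_sum) auto
    then show ?thesis using x(2) w J by auto
  qed
  have "(w powr (max 1 \<alpha> - 1)) ^ J = (\<Prod>k<d. w powr (max 1 \<alpha> - 1)) * w powr (max 1 \<alpha> - 1)"
    by (simp add: J)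
  also have "\<dots> \<le> (\<Prod>k<d. x k powr (\<alpha> - 1)) * (1 - (\<Sum>k<d. x k)) powr (\<alpha> - 1)"
  proof (intro mult_mono prod_mono conjI)
    show "w powr (max 1 \<alpha> - 1) \<le> x k powr (\<alpha> - 1)" if "k \<in> {..<d}" for k
      using that x1 x(1)[of k] w by (intro powr_ge_of_ge) (auto simp: J)
    show "w powr (max 1 \<alpha> - 1) \<le> (1 - (\<Sum>k<d. x k)) powr (\<alpha> - 1)"
      using x(2) w by (intro powr_ge_of_ge) (auto simp: J intro!: sum_nonneg x0)
  qed (auto intro!: prod_nonneg)
  finally have *: "(w powr (max 1 \<alpha> - 1)) ^ J \<le> \<dots>" .
  have "0 \<le> Gamma (real J * \<alpha>) / Gamma \<alpha> ^ J" using assms by (intro divide_nonneg_nonneg) (auto intro!: less_imp_le)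
  from mult_left_mono[OF * this] show ?thesis
    using x w unfolding sym_dirichlet_density_def by (force simp: J mult.assoc)
qed

text \<open>The box is centred at a point moved towards the barycentre, so that all coordinates on it are of
  order \<open>\<epsilon>\<close>. This is where the exponent of the contraction rate comes from.\<close>

lemma sym_dirichlet_small_ball:
  assumes J: "1 \<le> J" and \<alpha>: "0 < \<alpha>"
  obtains c where "0 < c"
    "\<And>\<beta>\<^sub>0 \<epsilon>. \<beta>\<^sub>0 \<in> simplex_coeffs J \<Longrightarrow> 0 < \<epsilon> \<Longrightarrow> \<epsilon> \<le> 1 \<Longrightarrow>
       c * \<epsilon> powr (max 1 \<alpha> * real J - 1) \<le>
       measure (sym_dirichlet J \<alpha>) {\<beta> \<in> space (sym_dirichlet J \<alpha>). (\<Sum>k<J. \<bar>\<beta> k - \<beta>\<^sub>0 k\<bar>) \<le> \<epsilon>}"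
proof -
  obtain d where d: "J = Suc d" using assms by (cases J) auto
  define a where "a = max 1 \<alpha>"
  define G where "G = Gamma (real J * \<alpha>) / Gamma \<alpha> ^ J"
  define c where "c = G * ((1 / (8 * real J)) powr (a - 1)) ^ J * (1 / (4 * (real J)\<^sup>2)) ^ d"
  have "0 < Gamma \<alpha>" "0 < Gamma (real J * \<alpha>)" using J \<alpha> by (auto intro!: Gamma_real_pos)
  then have G: "0 < G" unfolding G_def by simp
  have c: "0 < c" unfolding c_def using G J by simp
  show thesis
  proof (rule that[OF c])
    fix \<beta>\<^sub>0 :: "nat \<Rightarrow> real" and \<epsilon> :: real
    assume \<beta>\<^sub>0: "\<beta>\<^sub>0 \<in> simplex_coeffs J" and \<epsilon>: "0 < \<epsilon>" "\<epsilon> \<le> 1"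
    interpret D: prob_space "sym_dirichlet J \<alpha>" by (rule prob_space_sym_dirichlet) fact+
    interpret L: product_sigma_finite "\<lambda>_. lborel :: real measure" by standard
    define N where "N = (\<Pi>\<^sub>M k\<in>{..<J - 1}. (lborel :: real measure))"
    note [measurable] = measurable_sym_dirichlet_density[OF J]
    define g where "g = (\<lambda>x :: nat \<Rightarrow> real. \<lambda>k\<in>{..<J}. if k < J - 1 then x k else 1 - (\<Sum>l<J - 1. x l))"
    \<comment> \<open>The l1 budget is \<epsilon> = 4 * \<open>e\<close>: moving the centre towards
      the barycentre costs at most 2 * \<open>e\<close>, the box at most \<open>e\<close>. The moved
      centre \<open>b\<close> has all coordinates at least 2 * \<open>w\<close>, and
      \<open>h\<close> is so small that \<open>J * h = w\<close>; hence the completing coordinate,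
      which collects the deviations of all the others, also stays above \<open>w\<close>.\<close>
    define e where "e = \<epsilon> / 4"
    define h where "h = e / (2 * (real J)\<^sup>2)"
    define w where "w = e / (2 * real J)"
    define b where "b k = (1 - e) * \<beta>\<^sub>0 k + e / real J" for k
    define Q where "Q = (\<Pi>\<^sub>E k\<in>{..<J - 1}. {b k - h..b k + h})"
    define B where "B = {\<beta> \<in> space (sym_dirichlet J \<alpha>). (\<Sum>k<J. \<bar>\<beta> k - \<beta>\<^sub>0 k\<bar>) \<le> \<epsilon>}"
    have e: "0 < e" "e \<le> 1 / 4" using \<epsilon> by (auto simp: e_def)
    have h: "0 < h" "real d * h \<le> e / 2" "real d * h \<le> w"
    proof -
      show "0 < h" using e J by (simp add: h_def)
      have "real d * h \<le> real J * h" using \<open>0 < h\<close> by (simp add: d)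
      also have "real J * h = w" using J by (simp add: h_def w_def power2_eq_square)
      finally show "real d * h \<le> w" .
      also have "w \<le> e / 2" using J e by (simp add: w_def field_simps)
      finally show "real d * h \<le> e / 2" .
    qed
    have w: "0 < w" "w + w = e / real J" "h \<le> w" using J e
      by (auto simp: w_def h_def field_simps power2_eq_square)
    have bs: "(\<Sum>k<J. b k) = 1" 
      using \<beta>\<^sub>0 J by (simp add: b_def sum.distrib sum_distrib_left[symmetric] simplex_coeffs_def)
    have b_ge: "w + w \<le> b k" if "k < J" for k
    proof -
      have "0 \<le> (1 - e) * \<beta>\<^sub>0 k" using e \<beta>\<^sub>0 that by (auto simp: simplex_coeffs_def)
      then show ?thesis by (simp add: b_def w(2))
    qed
    have b_dist: "(\<Sum>k<J. \<bar>b k - \<beta>\<^sub>0 k\<bar>) \<le> 2 * e"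
    proof -
      have "(\<Sum>k<J. \<bar>b k - \<beta>\<^sub>0 k\<bar>) \<le> (\<Sum>k<J. e * \<beta>\<^sub>0 k + e / real J)"
      proof (rule sum_mono)
        fix k assume k: "k \<in> {..<J}"
        have "b k - \<beta>\<^sub>0 k = e / real J - e * \<beta>\<^sub>0 k" by (simp add: b_def algebra_simps)
        moreover have "0 \<le> e * \<beta>\<^sub>0 k" "0 \<le> e / real J" using e \<beta>\<^sub>0 k by (auto simp: simplex_coeffs_def)
        ultimately show "\<bar>b k - \<beta>\<^sub>0 k\<bar> \<le> e * \<beta>\<^sub>0 k + e / real J" by linarith
      qed
      also have "\<dots> = 2 * e" using \<beta>\<^sub>0 J by (simp add: sum.distrib sum_distrib_left[symmetric] simplex_coeffs_def)
      finally show ?thesis .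
    qed
    have Qd: "\<bar>x k - b k\<bar> \<le> h" if "x \<in> Q" "k < d" for x k
    proof -
      have "x k \<in> {b k - h..b k + h}" using that by (auto simp: Q_def d PiE_iff)
      then show ?thesis by (auto simp: abs_le_iff)
    qed
    have Qs: "\<bar>(\<Sum>k<d. x k) - (\<Sum>k<d. b k)\<bar> \<le> real d * h" if "x \<in> Q" for x
    proof -
      have "\<bar>(\<Sum>k<d. x k) - (\<Sum>k<d. b k)\<bar> \<le> (\<Sum>k<d. \<bar>x k - b k\<bar>)"
        by (simp add: sum_subtractf[symmetric] sum_abs)
      also have "\<dots> \<le> (\<Sum>k<d. h)" by (rule sum_mono) (use Qd[OF that] in auto)
      finally show ?thesis by simp
    qed
    have bd: "b d = 1 - (\<Sum>k<d. b k)" using bs by (simp add: d)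
    have Q_dens: "G * (w powr (a - 1)) ^ J \<le> sym_dirichlet_density J \<alpha> x" if x: "x \<in> Q" for x
      unfolding G_def a_def
    proof (rule sym_dirichlet_density_ge[OF J \<alpha> w(1)])
      show "w \<le> x k" if "k < J - 1" for k
        using Qd[OF x, of k] b_ge[of k] w that by (simp add: d)
      show "w \<le> 1 - (\<Sum>k<J - 1. x k)"
        using Qs[OF x] b_ge[of d] bd h(3) by (simp add: d)
    qed
    have Q_ball: "g x \<in> B" if x: "x \<in> Q" for x
    proof -
      have "(\<Sum>k<J. \<bar>g x k - b k\<bar>) = (\<Sum>k<d. \<bar>x k - b k\<bar>) + \<bar>(\<Sum>k<d. b k) - (\<Sum>k<d. x k)\<bar>"
        by (simp add: d g_def bd)
      also have "\<dots> \<le> (\<Sum>k<d. h) + real d * h"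
        using Qd[OF x] Qs[OF x] by (intro add_mono sum_mono) (auto simp: abs_minus_commute)
      also have "\<dots> \<le> e" using h(2) by (simp add: mult_ac)
      finally have 1: "(\<Sum>k<J. \<bar>g x k - b k\<bar>) \<le> e" .
      have "(\<Sum>k<J. \<bar>g x k - \<beta>\<^sub>0 k\<bar>) \<le> (\<Sum>k<J. \<bar>g x k - b k\<bar> + \<bar>b k - \<beta>\<^sub>0 k\<bar>)"
        by (intro sum_mono) auto
      also have "\<dots> \<le> \<epsilon>" using 1 b_dist e by (simp add: sum.distrib e_def)
      finally show ?thesis by (simp add: B_def g_def)
    qed
    have B_meas: "B \<in> sets (\<Pi>\<^sub>M k\<in>{..<J}. borel)"
      unfolding B_def sym_dirichlet_def space_distr by measurable
    have Q_meas: "Q \<in> sets N"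
      unfolding Q_def N_def by (intro sets_PiM_I_finite) auto
    have Q_em: "emeasure N Q = ennreal ((2 * h) ^ d)"
      unfolding Q_def N_def using h(1)
      by (subst L.emeasure_PiM) (auto simp: d prod_ennreal ennreal_power)
    have "emeasure (sym_dirichlet J \<alpha>) B
       = emeasure (density N (\<lambda>x. ennreal (sym_dirichlet_density J \<alpha> x))) (g -` B \<inter> space N)"
      unfolding sym_dirichlet_def N_def g_def
      by (subst emeasure_distr) (use B_meas in \<open>auto simp del: One_nat_def\<close>)
    also have "\<dots> = (\<integral>\<^sup>+x. ennreal (sym_dirichlet_density J \<alpha> x) * indicator (g -` B \<inter> space N) x \<partial>N)"
      unfolding N_def g_def
      by (subst emeasure_density) (use measurable_sets[OF measurable_complete_simplex B_meas] in \<open>auto simp del: One_nat_def\<close>)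
    also have "\<dots> \<ge> (\<integral>\<^sup>+x. ennreal (G * (w powr (a - 1)) ^ J) * indicator Q x \<partial>N)"
    proof (rule nn_integral_mono)
      fix x assume "x \<in> space N"
      then show "ennreal (G * (w powr (a - 1)) ^ J) * indicator Q x
         \<le> ennreal (sym_dirichlet_density J \<alpha> x) * indicator (g -` B \<inter> space N) x"
        using Q_dens[of x] Q_ball[of x] by (auto simp: indicator_def intro!: ennreal_leI)
    qed
    also have "(\<integral>\<^sup>+x. ennreal (G * (w powr (a - 1)) ^ J) * indicator Q x \<partial>N)
       = ennreal (G * (w powr (a - 1)) ^ J * (2 * h) ^ d)"
      using Q_meas G h(1) by (subst nn_integral_cmult_indicator) (auto simp: Q_em ennreal_mult)
    finally have le: "G * (w powr (a - 1)) ^ J * (2 * h) ^ d \<le> measure (sym_dirichlet J \<alpha>) B"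
      by (simp add: D.emeasure_eq_measure)
    \<comment> \<open>The \<open>J\<close> density factors contribute the exponent
      \<open>(a - 1) * J\<close>, the volume of a box in dimension \<open>J - 1\<close> contributes
      \<open>J - 1\<close>.\<close>
    have "G * (w powr (a - 1)) ^ J * (2 * h) ^ d = c * \<epsilon> powr (a * real J - 1)"
    proof -
      have "w = 1 / (8 * real J) * \<epsilon>" by (simp add: w_def e_def)
      then have 1: "w powr (a - 1) = (1 / (8 * real J)) powr (a - 1) * \<epsilon> powr (a - 1)"
        by (simp only: powr_mult)
      have "2 * h = 1 / (4 * (real J)\<^sup>2) * \<epsilon>" by (simp add: h_def e_def)
      then have 2: "(2 * h) ^ d = (1 / (4 * (real J)\<^sup>2)) ^ d * \<epsilon> ^ d"
        by (simp only: power_mult_distrib)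
      have 3: "\<epsilon> powr (a * real J - 1) = (\<epsilon> powr (a - 1)) ^ J * \<epsilon> ^ d"
      proof -
        have "(\<epsilon> powr (a - 1)) ^ J = \<epsilon> powr ((a - 1) * real J)"
          using \<epsilon> powr_realpow[of "\<epsilon> powr (a - 1)" J] by (simp add: powr_powr)
        moreover have "\<epsilon> ^ d = \<epsilon> powr real d"
          using \<epsilon> powr_realpow[of \<epsilon> d] by simp
        moreover have "(a - 1) * real J + real d = a * real J - 1" by (simp add: d algebra_simps)
        ultimately show ?thesis by (metis powr_add)
      qed
      show ?thesis unfolding 1 2 3 c_def by (simp only: power_mult_distrib mult_ac)
    qed
    with le show "c * \<epsilon> powr (max 1 \<alpha> * real J - 1) \<le>
       measure (sym_dirichlet J \<alpha>) {\<beta> \<in> space (sym_dirichlet J \<alpha>). (\<Sum>k<J. \<bar>\<beta> k - \<beta>\<^sub>0 k\<bar>) \<le> \<epsilon>}"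
      by (simp add: a_def B_def)
  qed
qed

section \<open>Empirical distributions of documents\<close>

lemma sum_UN_le:
  fixes f :: "'a \<Rightarrow> real"
  assumes "finite I" "\<And>i. i \<in> I \<Longrightarrow> finite (A i)" "\<And>x. 0 \<le> f x"
  shows "sum f (\<Union>i\<in>I. A i) \<le> (\<Sum>i\<in>I. sum f (A i))"
  using assms(1,2)
proof (induction I rule: finite_induct)
  case (insert i I)
  have "sum f (A i \<union> (\<Union>i\<in>I. A i)) \<le> sum f (A i) + sum f (\<Union>i\<in>I. A i)"
    using insert by (simp add: sum_Un sum_nonneg assms(3))
  then show ?case using insert by simp
qed simp

text \<open>The probability of the ordered sequence \<open>xs\<close> under independent draws from
  \<eta>; since the order is retained, there is no multinomial coefficient.\<close>

definition doc_weight :: "real ^ 'v::finite \<Rightarrow> 'v list \<Rightarrow> real" where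
  "doc_weight \<eta> xs = (\<Prod>v\<in>UNIV. (\<eta> $ v) ^ count_list xs v)"

definition doc_freq :: "'v::finite list \<Rightarrow> real ^ 'v" where
  "doc_freq xs = (\<chi> v. real (count_list xs v) / real (length xs))"

lemma finite_docs [simp]: "finite {xs :: 'v::finite list. length xs = n}"
  using finite_lists_length_eq[of "UNIV :: 'v set" n] by simp

lemma finite_docs' [simp]: "finite {xs :: 'v::finite list. length xs = n \<and> P xs}"
  by (rule finite_subset[OF _ finite_docs[of n]]) auto

text \<open>Expanding the power gives one monomial per ordered document. The weights
  \<open>f\<close> are arbitrary because the moment generating function of a word count is obtained
  with exponentially tilted, unnormalised weights.\<close>

lemma sum_docs_prod_count:
  fixes f :: "'v::finite \<Rightarrow> real"
  shows "(\<Sum>xs | length xs = n. \<Prod>v\<in>UNIV. f v ^ count_list xs v) = (\<Sum>v\<in>UNIV. f v) ^ n"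
proof (induction n)
  case 0
  have "{xs :: 'v list. length xs = 0} = {[]}" by auto
  then show ?case by simp
next
  case (Suc n)
  have *: "{xs :: 'v list. length xs = Suc n} = (\<lambda>(x, xs). x # xs) ` (UNIV \<times> {xs. length xs = n})"
    by (auto simp: length_Suc_conv image_iff)
  have step: "(\<Prod>v\<in>UNIV. f v ^ count_list (x # xs) v) = f x * (\<Prod>v\<in>UNIV. f v ^ count_list xs v)" for x xs
  proof -
    have "(\<Prod>v\<in>UNIV. f v ^ count_list (x # xs) v)
      = (\<Prod>v\<in>UNIV. (if x = v then f v else 1) * f v ^ count_list xs v)"
      by (intro prod.cong) auto
    then show ?thesis by (simp add: prod.distrib)
  qed
  have "(\<Sum>xs | length xs = Suc n. \<Prod>v\<in>UNIV. f v ^ count_list xs v)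
     = (\<Sum>(x, xs)\<in>UNIV \<times> {xs. length xs = n}. f x * (\<Prod>v\<in>UNIV. f v ^ count_list xs v))"
    unfolding * by (subst sum.reindex) (auto simp: inj_on_def step simp del: count_list.simps intro!: sum.cong)
  also have "\<dots> = (\<Sum>v\<in>UNIV. f v) * (\<Sum>xs | length xs = n. \<Prod>v\<in>UNIV. f v ^ count_list xs v)"
    by (simp add: sum.cartesian_product[symmetric] sum_product)
  finally show ?case by (simp add: Suc.IH)
qed

lemma sum_docs_doc_weight:
  "\<eta> \<in> prob_simplex \<Longrightarrow> (\<Sum>xs | length xs = n. doc_weight \<eta> xs) = 1"
  using sum_docs_prod_count[where f = "\<lambda>v. \<eta> $ v" and n = n] by (simp add: doc_weight_def prob_simplex_def)

lemma doc_weight_nonneg: "\<eta> \<in> prob_simplex \<Longrightarrow> 0 \<le> doc_weight \<eta> xs"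
  by (auto simp: doc_weight_def prob_simplex_def intro!: prod_nonneg)

lemma prob_simplex_le_1: "\<eta> \<in> prob_simplex \<Longrightarrow> \<eta> $ v \<le> 1"
  using member_le_sum[of v UNIV "\<lambda>v. \<eta> $ v"] by (auto simp: prob_simplex_def)

lemma norm_prob_simplex_le_1: "x \<in> prob_simplex \<Longrightarrow> norm (x :: real ^ 'v::finite) \<le> 1"
  using norm_le_l1_cart[of x] by (simp add: prob_simplex_def)

lemma doc_weight_le_1: "\<eta> \<in> prob_simplex \<Longrightarrow> doc_weight \<eta> xs \<le> 1"
  using prob_simplex_le_1[of \<eta>]
  by (auto simp: doc_weight_def prob_simplex_def intro!: prod_le_1 power_le_one)

text \<open>Hoeffding's lemma for a Bernoulli variable. A negative \<open>h\<close> is reduced to a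
  positive one by exchanging the two outcomes, which replaces \<open>p\<close> by
  \<open>1 - p\<close> and costs a factor \<open>exp h\<close>.\<close>

lemma bernoulli_mgf_le:
  fixes p h :: real
  assumes "0 \<le> p" "p \<le> 1"
  shows "1 - p + p * exp h \<le> exp (h * p + h\<^sup>2 / 8)"
proof -
  have *: "1 - p + p * exp h \<le> exp (h * p + h\<^sup>2 / 8)" if "0 \<le> h" "0 \<le> p" "p \<le> 1" for p h :: real
  proof -
    have pos: "0 < 1 + p * (exp h - 1)"
      using that by (intro add_pos_nonneg mult_nonneg_nonneg) auto
    have "ln (1 + p * (exp h - 1)) \<le> h * p + h\<^sup>2 / 8"
      using Hoeffdings_lemma_aux[of h p] that by simp
    then have "1 + p * (exp h - 1) \<le> exp (h * p + h\<^sup>2 / 8)"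
      using pos by (metis exp_le_cancel_iff exp_ln)
    then show ?thesis by (simp add: algebra_simps)
  qed
  show ?thesis
  proof (cases "0 \<le> h")
    case False
    have "1 - p + p * exp h = exp h * (1 - (1 - p) + (1 - p) * exp (- h))"
      by (simp add: algebra_simps exp_minus)
    also have "\<dots> \<le> exp h * exp (- h * (1 - p) + (- h)\<^sup>2 / 8)"
      using *[of "- h" "1 - p"] False assms by (intro mult_left_mono) auto
    also have "\<dots> = exp (h * p + h\<^sup>2 / 8)"
      by (simp add: exp_add[symmetric] algebra_simps)
    finally show ?thesis .
  qed (use * assms in auto)
qed

text \<open>Chernoff's method: an exponential that is at least 1 on the event is inserted and the
  event is dropped. Only the weight of the word \<open>v\<close> gets tilted, so the remaining sum
  is the n-th power of a Bernoulli moment generating function. The sign \<sigma> treats both tails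
  at once.\<close>

lemma doc_count_tail:
  fixes \<eta> :: "real ^ 'v::finite" and \<sigma> s :: real
  assumes \<eta>: "\<eta> \<in> prob_simplex" and s: "0 \<le> s" and \<sigma>: "\<sigma> = 1 \<or> \<sigma> = - 1"
  shows "(\<Sum>xs | length xs = n \<and> real n * s \<le> \<sigma> * (real (count_list xs v) - real n * \<eta> $ v). doc_weight \<eta> xs)
     \<le> exp (- 2 * real n * s\<^sup>2)"
proof -
  \<comment> \<open>In absolute value \<open>4 * s\<close> minimises the exponent
    \<open>h\<^sup>2 / 8 - h * s\<close> per word, with minimum
    \<open>- 2 * s\<^sup>2\<close>.\<close>
  define h where "h = 4 * s * \<sigma>"
  define p where "p = \<eta> $ v"
  have p: "0 \<le> p" "p \<le> 1" using \<eta> prob_simplex_le_1[OF \<eta>] by (auto simp: p_def prob_simplex_def)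
  have "(\<Sum>xs | length xs = n \<and> real n * s \<le> \<sigma> * (real (count_list xs v) - real n * \<eta> $ v). doc_weight \<eta> xs)
     \<le> (\<Sum>xs | length xs = n \<and> real n * s \<le> \<sigma> * (real (count_list xs v) - real n * \<eta> $ v).
         exp (- h * real n * p - 4 * s * real n * s) * (doc_weight \<eta> xs * exp (h * real (count_list xs v))))"
  proof (rule sum_mono)
    fix xs :: "'v list"
    assume "xs \<in> {xs. length xs = n \<and> real n * s \<le> \<sigma> * (real (count_list xs v) - real n * \<eta> $ v)}"
    then have "0 \<le> 4 * s * (\<sigma> * (real (count_list xs v) - real n * p) - real n * s)"
      using s by (auto simp: p_def)
    also have "\<dots> = (- h * real n * p - 4 * s * real n * s) + h * real (count_list xs v)"
      by (simp add: h_def algebra_simps)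
    finally have "1 \<le> exp (- h * real n * p - 4 * s * real n * s) * exp (h * real (count_list xs v))"
      by (simp add: exp_add[symmetric])
    from mult_left_mono[OF this doc_weight_nonneg[OF \<eta>, of xs]]
    show "doc_weight \<eta> xs \<le> exp (- h * real n * p - 4 * s * real n * s) * (doc_weight \<eta> xs * exp (h * real (count_list xs v)))"
      by (simp add: mult_ac)
  qed
  also have "\<dots> \<le> (\<Sum>xs | length xs = n.
         exp (- h * real n * p - 4 * s * real n * s) * (doc_weight \<eta> xs * exp (h * real (count_list xs v))))"
    by (intro sum_mono2) (auto intro!: mult_nonneg_nonneg doc_weight_nonneg \<eta>)
  also have "\<dots> = exp (- h * real n * p - 4 * s * real n * s) *
      (\<Sum>xs | length xs = n. \<Prod>u\<in>UNIV. (\<eta> $ u * (if u = v then exp h else 1)) ^ count_list xs u)"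
    unfolding sum_distrib_left[symmetric]
  proof (intro arg_cong[where f = "\<lambda>x. _ * x"] sum.cong refl)
    fix xs :: "'v list"
    have "(\<Prod>u\<in>UNIV. (\<eta> $ u * (if u = v then exp h else 1)) ^ count_list xs u)
       = doc_weight \<eta> xs * (\<Prod>u\<in>UNIV. if u = v then exp h ^ count_list xs u else 1)"
      unfolding doc_weight_def prod.distrib[symmetric]
      by (intro prod.cong) (auto simp: power_mult_distrib)
    also have "(\<Prod>u\<in>UNIV. if u = v then exp h ^ count_list xs u else 1) = exp (h * real (count_list xs v))"
      by (simp add: exp_of_nat2_mult)
    finally show "doc_weight \<eta> xs * exp (h * real (count_list xs v))
       = (\<Prod>u\<in>UNIV. (\<eta> $ u * (if u = v then exp h else 1)) ^ count_list xs u)" by simp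
  qed
  also have "(\<Sum>xs | length xs = n. \<Prod>u\<in>UNIV. (\<eta> $ u * (if u = v then exp h else 1)) ^ count_list xs u)
     = (\<Sum>u\<in>UNIV. \<eta> $ u * (if u = v then exp h else 1)) ^ n"
    by (rule sum_docs_prod_count)
  also have "(\<Sum>u\<in>UNIV. \<eta> $ u * (if u = v then exp h else 1)) = 1 - p + p * exp h"
  proof -
    have "(\<Sum>u\<in>UNIV. \<eta> $ u * (if u = v then exp h else 1))
       = (\<Sum>u\<in>UNIV. \<eta> $ u + (if u = v then \<eta> $ u * (exp h - 1) else 0))"
      by (intro sum.cong) (auto simp: algebra_simps)
    also have "\<dots> = 1 + p * (exp h - 1)"
      using \<eta> by (simp add: sum.distrib p_def prob_simplex_def)
    finally show ?thesis by (simp add: algebra_simps)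
  qed
  also have "exp (- h * real n * p - 4 * s * real n * s) * (1 - p + p * exp h) ^ n
     \<le> exp (- h * real n * p - 4 * s * real n * s) * exp (h * p + h\<^sup>2 / 8) ^ n"
    using p by (intro mult_left_mono power_mono bernoulli_mgf_le add_nonneg_nonneg mult_nonneg_nonneg) auto
  also have "\<dots> = exp (- 2 * real n * s\<^sup>2)"
  proof -
    have "h\<^sup>2 = 16 * s\<^sup>2" using \<sigma> by (auto simp: h_def power2_eq_square)
    then show ?thesis
      by (simp add: exp_of_nat_mult[symmetric] exp_add[symmetric] algebra_simps power2_eq_square)
  qed
  finally show ?thesis .
qed

text \<open>The Euclidean norm is at most the l1 norm. The factor \<open>CARD('v)\<close> paid here
  for arguing coordinatewise reappears in all radii below.\<close>

lemma dist_vec_gt_component: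
  fixes x y :: "real ^ 'v::finite"
  assumes "real CARD('v) * s < dist x y"
  shows "\<exists>v. s < \<bar>x $ v - y $ v\<bar>"
proof (rule ccontr)
  assume "\<not> ?thesis"
  then have "(\<Sum>v\<in>UNIV. \<bar>(x - y) $ v\<bar>) \<le> (\<Sum>v\<in>(UNIV :: 'v set). s)"
    by (intro sum_mono) (auto simp: not_less)
  moreover have "dist x y \<le> (\<Sum>v\<in>UNIV. \<bar>(x - y) $ v\<bar>)"
    unfolding dist_norm by (rule norm_le_l1_cart)
  ultimately show False using assms by simp
qed

lemma doc_freq_concentration:
  fixes \<eta> :: "real ^ 'v::finite"
  assumes \<eta>: "\<eta> \<in> prob_simplex" and s: "0 \<le> s" and n: "0 < n"
  shows "(\<Sum>xs | length xs = n \<and> real CARD('v) * s < dist (doc_freq xs) \<eta>. doc_weight \<eta> xs)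
     \<le> 2 * real CARD('v) * exp (- 2 * real n * s\<^sup>2)"
proof -
  define T where "T \<sigma> v = {xs. length xs = n \<and> real n * s \<le> \<sigma> * (real (count_list xs v) - real n * \<eta> $ v)}" for \<sigma> :: real and v
  have T_fin: "finite (T \<sigma> v)" for \<sigma> v by (simp add: T_def)
  have sub: "{xs. length xs = n \<and> real CARD('v) * s < dist (doc_freq xs) \<eta>} \<subseteq> (\<Union>v\<in>UNIV. T 1 v \<union> T (- 1) v)"
  proof
    fix xs assume "xs \<in> {xs. length xs = n \<and> real CARD('v) * s < dist (doc_freq xs) \<eta>}"
    then have len: "length xs = n" and "real CARD('v) * s < dist (doc_freq xs) \<eta>" by auto
    then obtain v where "s < \<bar>doc_freq xs $ v - \<eta> $ v\<bar>" using dist_vec_gt_component by blast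
    then have "real n * s < real n * \<bar>doc_freq xs $ v - \<eta> $ v\<bar>" using n by simp
    also have "\<dots> = \<bar>real (count_list xs v) - real n * \<eta> $ v\<bar>"
    proof -
      have "real n * (doc_freq xs $ v - \<eta> $ v) = real (count_list xs v) - real n * \<eta> $ v"
        using n len by (simp add: doc_freq_def field_simps)
      then show ?thesis by (metis abs_mult abs_of_nat)
    qed
    finally have "real n * s \<le> real (count_list xs v) - real n * \<eta> $ v \<or>
       real n * s \<le> - (real (count_list xs v) - real n * \<eta> $ v)" by linarith
    then have "xs \<in> T 1 v \<union> T (- 1) v" using len by (auto simp: T_def)
    then show "xs \<in> (\<Union>v\<in>UNIV. T 1 v \<union> T (- 1) v)" by auto
  qed
  have "(\<Sum>xs | length xs = n \<and> real CARD('v) * s < dist (doc_freq xs) \<eta>. doc_weight \<eta> xs)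
     \<le> (\<Sum>xs\<in>(\<Union>v\<in>UNIV. T 1 v \<union> T (- 1) v). doc_weight \<eta> xs)"
    using sub by (intro sum_mono2) (auto intro: doc_weight_nonneg \<eta> T_fin)
  also have "\<dots> \<le> (\<Sum>v\<in>UNIV. \<Sum>xs\<in>T 1 v \<union> T (- 1) v. doc_weight \<eta> xs)"
    by (rule sum_UN_le) (auto intro: doc_weight_nonneg \<eta> T_fin)
  also have "\<dots> \<le> (\<Sum>v\<in>(UNIV :: 'v set). 2 * exp (- 2 * real n * s\<^sup>2))"
  proof (rule sum_mono)
    fix v :: 'v
    have "(\<Sum>xs\<in>T 1 v \<union> T (- 1) v. doc_weight \<eta> xs) \<le> sum (doc_weight \<eta>) (T 1 v) + sum (doc_weight \<eta>) (T (- 1) v)"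
      by (simp add: sum_Un T_fin sum_nonneg doc_weight_nonneg \<eta>)
    also have "\<dots> \<le> exp (- 2 * real n * s\<^sup>2) + exp (- 2 * real n * s\<^sup>2)"
      unfolding T_def by (intro add_mono doc_count_tail \<eta> s) auto
    finally show "(\<Sum>xs\<in>T 1 v \<union> T (- 1) v. doc_weight \<eta> xs) \<le> 2 * exp (- 2 * real n * s\<^sup>2)" by simp
  qed
  also have "\<dots> = 2 * real CARD('v) * exp (- 2 * real n * s\<^sup>2)" by simp
  finally show ?thesis .
qed

section \<open>The document distribution\<close>

text \<open>The weights sum to 1, whereas a sum over an infinite set has the default value 0, as has
  the empty sum.\<close>

lemma finite_maximal_paths:
  assumes "\<omega> \<in> param_space G r"
  shows "finite (maximal_paths G r)" "maximal_paths G r \<noteq> {}"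
proof -
  obtain \<pi> where "(\<Sum>\<phi>\<in>maximal_paths G r. \<pi> \<phi>) = (1 :: real)"
    using assms by (auto simp: param_space_def)
  then show "finite (maximal_paths G r)" "maximal_paths G r \<noteq> {}"
    using sum.infinite[of "maximal_paths G r" \<pi>] by (metis zero_neq_one, fastforce)
qed

text \<open>The word distribution of a document given its path and its topic proportions; a document
  probability is an average of \<open>doc_weight\<close> over such vectors.\<close>

definition mixture :: "nat \<Rightarrow> ('u \<Rightarrow> real ^ 'v::finite) \<Rightarrow> 'u list \<Rightarrow> (nat \<Rightarrow> real) \<Rightarrow> real ^ 'v" where
  "mixture J \<rho> \<phi> \<beta> = (\<Sum>k<J. \<beta> k *\<^sub>R \<rho> (\<phi> ! k))"

lemma mixture_component: "mixture J \<rho> \<phi> \<beta> $ v = (\<Sum>k<J. \<beta> k * (\<rho> (\<phi> ! k) $ v))"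
  by (simp add: mixture_def)

lemma measurable_doc_weight_mixture [measurable]:
  "(\<lambda>\<beta>. doc_weight (mixture J \<rho> \<phi> \<beta>) xs) \<in> borel_measurable (\<Pi>\<^sub>M k\<in>{..<J}. borel)"
  unfolding doc_weight_def mixture_component by measurable

locale admixture_tree =
  fixes G :: "'u pair_pre_digraph" and r :: 'u and J :: nat and \<alpha> :: real
  assumes path_length: "\<phi> \<in> maximal_paths G r \<Longrightarrow> length \<phi> = J"
    and J: "1 \<le> J" and \<alpha>: "0 < \<alpha>"
begin

sublocale D: prob_space "sym_dirichlet J \<alpha>"
  by (rule prob_space_sym_dirichlet[OF J \<alpha>])

lemma path_vertex: "\<phi> \<in> maximal_paths G r \<Longrightarrow> k < J \<Longrightarrow> \<phi> ! k \<in> pverts G"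
  using path_length[of \<phi>] nth_mem[of k \<phi>] by (auto simp: maximal_paths_def vwalk_def)

lemma doc_pmf_altdef:
  "doc_pmf G r J \<alpha> \<omega> xs = (\<Sum>\<phi>\<in>maximal_paths G r. snd \<omega> \<phi> *
     (\<integral>\<beta>. doc_weight (mixture J (fst \<omega>) \<phi> \<beta>) xs \<partial>sym_dirichlet J \<alpha>))"
  by (simp add: doc_pmf_def doc_weight_def mixture_component)

lemma mixture_in_simplex:
  assumes "\<phi> \<in> maximal_paths G r" "\<beta> \<in> simplex_coeffs J" "\<forall>u\<in>pverts G. \<rho> u \<in> prob_simplex"
  shows "mixture J \<rho> \<phi> \<beta> \<in> prob_simplex"
proof -
  have \<rho>: "\<rho> (\<phi> ! k) \<in> prob_simplex" if "k < J" for k using path_vertex[OF assms(1) that] assms(3) by auto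
  have "(\<Sum>v\<in>UNIV. \<Sum>k<J. \<beta> k * (\<rho> (\<phi> ! k) $ v)) = (\<Sum>k<J. \<beta> k * (\<Sum>v\<in>UNIV. \<rho> (\<phi> ! k) $ v))"
    by (subst sum.swap) (simp add: sum_distrib_left)
  also have "\<dots> = 1" using \<rho> assms(2) by (simp add: prob_simplex_def simplex_coeffs_def)
  finally show ?thesis using \<rho> assms(2)
    by (auto simp: prob_simplex_def simplex_coeffs_def mixture_component intro!: sum_nonneg)
qed

text \<open>One inclusion is convexity of the hull; the other is its minimality, as the image is
  convex and unit vectors hit the topics. It turns a point of a polytope into a coefficient vector,
  around which the Dirichlet mass can be estimated.\<close>

lemma mixture_image:
  assumes "\<phi> \<in> maximal_paths G r"
  shows "mixture J \<rho> \<phi> ` simplex_coeffs J = component_polytope \<rho> \<phi>"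
proof
  have set: "set \<phi> = (!) \<phi> ` {..<J}" using path_length[OF assms] by (auto simp: set_conv_nth)
  show "mixture J \<rho> \<phi> ` simplex_coeffs J \<subseteq> component_polytope \<rho> \<phi>"
  proof
    fix x assume "x \<in> mixture J \<rho> \<phi> ` simplex_coeffs J"
    then obtain \<beta> where x: "x = mixture J \<rho> \<phi> \<beta>" and \<beta>: "\<beta> \<in> simplex_coeffs J" by auto
    show "x \<in> component_polytope \<rho> \<phi>"
      unfolding x mixture_def component_polytope_def
    proof (rule convex_sum)
      show "\<rho> (\<phi> ! k) \<in> convex hull \<rho> ` set \<phi>" if "k \<in> {..<J}" for k
        using that by (intro hull_inc) (auto simp: set)
    qed (use \<beta> in \<open>auto simp: simplex_coeffs_def\<close>)
  qed
  show "component_polytope \<rho> \<phi> \<subseteq> mixture J \<rho> \<phi> ` simplex_coeffs J"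
    unfolding component_polytope_def
  proof (rule hull_minimal)
    show "\<rho> ` set \<phi> \<subseteq> mixture J \<rho> \<phi> ` simplex_coeffs J"
    proof
      fix x assume "x \<in> \<rho> ` set \<phi>"
      then obtain k where k: "k < J" "x = \<rho> (\<phi> ! k)" by (auto simp: set)
      define \<beta> where "\<beta> l = (if l = k then 1 else 0 :: real)" for l
      have "mixture J \<rho> \<phi> \<beta> = (\<Sum>l<J. if l = k then \<rho> (\<phi> ! l) else 0)"
        unfolding mixture_def \<beta>_def by (intro sum.cong) auto
      then have "x = mixture J \<rho> \<phi> \<beta>" using k by simp
      moreover have "\<beta> \<in> simplex_coeffs J" using k by (auto simp: \<beta>_def simplex_coeffs_def)
      ultimately show "x \<in> mixture J \<rho> \<phi> ` simplex_coeffs J" by blast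
    qed
    show "convex (mixture J \<rho> \<phi> ` simplex_coeffs J)"
    proof (rule convexI)
      fix x y u v assume "x \<in> mixture J \<rho> \<phi> ` simplex_coeffs J" "y \<in> mixture J \<rho> \<phi> ` simplex_coeffs J"
        and uv: "0 \<le> u" "0 \<le> v" "u + v = (1 :: real)"
      then obtain \<beta> \<gamma> where \<beta>: "x = mixture J \<rho> \<phi> \<beta>" "\<beta> \<in> simplex_coeffs J"
        and \<gamma>: "y = mixture J \<rho> \<phi> \<gamma>" "\<gamma> \<in> simplex_coeffs J" by auto
      have "u *\<^sub>R x + v *\<^sub>R y = mixture J \<rho> \<phi> (\<lambda>k. u * \<beta> k + v * \<gamma> k)"
        by (simp add: \<beta>(1) \<gamma>(1) mixture_def scaleR_sum_right sum.distrib[symmetric] scaleR_add_left)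
      moreover have "(\<lambda>k. u * \<beta> k + v * \<gamma> k) \<in> simplex_coeffs J"
        using \<beta>(2) \<gamma>(2) uv by (auto simp: simplex_coeffs_def sum.distrib sum_distrib_left[symmetric])
      ultimately show "u *\<^sub>R x + v *\<^sub>R y \<in> mixture J \<rho> \<phi> ` simplex_coeffs J" by blast
    qed
  qed
qed

text \<open>Every topic lies in the unit ball. This carries l1 balls of coefficients into Euclidean
  balls of the polytope with the same radius.\<close>

lemma dist_mixture_le:
  assumes "\<phi> \<in> maximal_paths G r" "\<forall>u\<in>pverts G. \<rho> u \<in> prob_simplex"
  shows "dist (mixture J \<rho> \<phi> \<beta>) (mixture J \<rho> \<phi> \<gamma>) \<le> (\<Sum>k<J. \<bar>\<beta> k - \<gamma> k\<bar>)"
proof -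
  have "dist (mixture J \<rho> \<phi> \<beta>) (mixture J \<rho> \<phi> \<gamma>) = norm (\<Sum>k<J. (\<beta> k - \<gamma> k) *\<^sub>R \<rho> (\<phi> ! k))"
    by (simp add: dist_norm mixture_def sum_subtractf scaleR_diff_left)
  also have "\<dots> \<le> (\<Sum>k<J. \<bar>\<beta> k - \<gamma> k\<bar>)"
  proof (rule sum_norm_le)
    fix k assume "k \<in> {..<J}"
    then have "norm (\<rho> (\<phi> ! k)) \<le> 1"
      using path_vertex[OF assms(1)] assms(2) norm_prob_simplex_le_1 by auto
    from mult_left_mono[OF this, of "\<bar>\<beta> k - \<gamma> k\<bar>"]
    show "norm ((\<beta> k - \<gamma> k) *\<^sub>R \<rho> (\<phi> ! k)) \<le> \<bar>\<beta> k - \<gamma> k\<bar>" by simp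
  qed
  finally show ?thesis .
qed

lemma AE_mixture:
  assumes "\<phi> \<in> maximal_paths G r" "\<forall>u\<in>pverts G. \<rho> u \<in> prob_simplex"
  shows "AE \<beta> in sym_dirichlet J \<alpha>. mixture J \<rho> \<phi> \<beta> \<in> prob_simplex \<and> mixture J \<rho> \<phi> \<beta> \<in> component_polytope \<rho> \<phi>"
  using AE_sym_dirichlet[OF J] by eventually_elim (use mixture_in_simplex[OF assms(1) _ assms(2)] mixture_image[OF assms(1)] in blast)

lemma integrable_doc_weight:
  assumes "\<phi> \<in> maximal_paths G r" "\<forall>u\<in>pverts G. \<rho> u \<in> prob_simplex"
  shows "integrable (sym_dirichlet J \<alpha>) (\<lambda>\<beta>. doc_weight (mixture J \<rho> \<phi> \<beta>) xs)"
proof (rule D.integrable_const_bound[where B = 1])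
  show "AE \<beta> in sym_dirichlet J \<alpha>. norm (doc_weight (mixture J \<rho> \<phi> \<beta>) xs) \<le> 1"
    using AE_mixture[OF assms] by eventually_elim (use doc_weight_nonneg doc_weight_le_1 in fastforce)
qed simp

section \<open>Law of a document under a parameter\<close>

lemma param_simplex: "\<omega> \<in> param_space G r \<Longrightarrow> \<forall>u\<in>pverts G. fst \<omega> u \<in> prob_simplex"
  by (auto simp: param_space_def)

lemma param_weight_nonneg: "\<omega> \<in> param_space G r \<Longrightarrow> \<phi> \<in> maximal_paths G r \<Longrightarrow> 0 \<le> snd \<omega> \<phi>"
  by (auto simp: param_space_def PiE_iff)

lemma param_weight_sum: "\<omega> \<in> param_space G r \<Longrightarrow> (\<Sum>\<phi>\<in>maximal_paths G r. snd \<omega> \<phi>) = 1"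
  by (auto simp: param_space_def)

lemma doc_pmf_nonneg:
  fixes \<omega> :: "('u, 'v::finite) param"
  assumes "\<omega> \<in> param_space G r"
  shows "0 \<le> doc_pmf G r J \<alpha> \<omega> xs"
  unfolding doc_pmf_altdef
proof (intro sum_nonneg mult_nonneg_nonneg integral_nonneg_AE)
  fix \<phi> assume \<phi>: "\<phi> \<in> maximal_paths G r"
  show "AE \<beta> in sym_dirichlet J \<alpha>. 0 \<le> doc_weight (mixture J (fst \<omega>) \<phi> \<beta>) xs"
    using AE_mixture[OF \<phi> param_simplex[OF assms]] by eventually_elim (auto intro: doc_weight_nonneg)
qed (rule param_weight_nonneg[OF assms])

text \<open>By this interchange it suffices to bound the probability of an event conditionally on
  the path and the topic proportions.\<close>

lemma sum_doc_pmf: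
  fixes \<omega> :: "('u, 'v::finite) param"
  assumes "\<omega> \<in> param_space G r"
  shows "(\<Sum>xs\<in>A. doc_pmf G r J \<alpha> \<omega> xs) = (\<Sum>\<phi>\<in>maximal_paths G r. snd \<omega> \<phi> *
     (\<integral>\<beta>. (\<Sum>xs\<in>A. doc_weight (mixture J (fst \<omega>) \<phi> \<beta>) xs) \<partial>sym_dirichlet J \<alpha>))"
  unfolding doc_pmf_altdef
  by (subst sum.swap) (auto simp: sum_distrib_left[symmetric]
      Bochner_Integration.integral_sum[OF integrable_doc_weight[OF _ param_simplex[OF assms]]] intro!: sum.cong)

lemma sum_doc_pmf_UNIV:
  fixes \<omega> :: "('u, 'v::finite) param"
  assumes "\<omega> \<in> param_space G r"
  shows "(\<Sum>xs | length xs = n. doc_pmf G r J \<alpha> \<omega> xs) = 1"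
proof -
  have "(\<integral>\<beta>. (\<Sum>xs | length xs = n. doc_weight (mixture J (fst \<omega>) \<phi> \<beta>) xs) \<partial>sym_dirichlet J \<alpha>) = 1"
    if \<phi>: "\<phi> \<in> maximal_paths G r" for \<phi>
  proof -
    have "(\<integral>\<beta>. (\<Sum>xs | length xs = n. doc_weight (mixture J (fst \<omega>) \<phi> \<beta>) xs) \<partial>sym_dirichlet J \<alpha>)
       = (\<integral>\<beta>. 1 \<partial>sym_dirichlet J \<alpha>)"
    proof (rule integral_cong_AE)
      show "AE \<beta> in sym_dirichlet J \<alpha>. (\<Sum>xs | length xs = n. doc_weight (mixture J (fst \<omega>) \<phi> \<beta>) xs) = 1"
        using AE_mixture[OF \<phi> param_simplex[OF assms]] by eventually_elim (auto intro: sum_docs_doc_weight)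
    qed auto
    then show ?thesis by (simp add: D.prob_space del: space_sym_dirichlet)
  qed
  then show ?thesis by (simp add: sum_doc_pmf[OF assms] param_weight_sum[OF assms])
qed

text \<open>Given path and proportions, the words are independent draws from a point of the union,
  and the distance to the union is at most the distance to that point. The concentration bound holds
  for each such point and survives averaging.\<close>

lemma sum_doc_pmf_far_le:
  fixes \<omega> :: "('u, 'v::finite) param"
  assumes \<omega>: "\<omega> \<in> param_space G r" and s: "0 \<le> s" and n: "0 < n"
  shows "(\<Sum>xs | length xs = n \<and>
            real CARD('v) * s < infdist (doc_freq xs) (\<Union>\<phi>\<in>maximal_paths G r. component_polytope (fst \<omega>) \<phi>).
            doc_pmf G r J \<alpha> \<omega> xs)
     \<le> 2 * real CARD('v) * exp (- 2 * real n * s\<^sup>2)" (is "sum _ ?A \<le> ?q")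
proof -
  have "(\<integral>\<beta>. (\<Sum>xs\<in>?A. doc_weight (mixture J (fst \<omega>) \<phi> \<beta>) xs) \<partial>sym_dirichlet J \<alpha>) \<le> ?q"
    if \<phi>: "\<phi> \<in> maximal_paths G r" for \<phi>
  proof (rule D.integral_le_const)
    show "integrable (sym_dirichlet J \<alpha>) (\<lambda>\<beta>. \<Sum>xs\<in>?A. doc_weight (mixture J (fst \<omega>) \<phi> \<beta>) xs)"
      by (intro Bochner_Integration.integrable_sum integrable_doc_weight \<phi> param_simplex \<omega>)
    show "AE \<beta> in sym_dirichlet J \<alpha>. (\<Sum>xs\<in>?A. doc_weight (mixture J (fst \<omega>) \<phi> \<beta>) xs) \<le> ?q"
      using AE_mixture[OF \<phi> param_simplex[OF \<omega>]]
    proof eventually_elim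
      case (elim \<beta>)
      define \<eta> where "\<eta> = mixture J (fst \<omega>) \<phi> \<beta>"
      have \<eta>: "\<eta> \<in> prob_simplex" using elim by (simp add: \<eta>_def)
      have "sum (doc_weight \<eta>) ?A \<le> (\<Sum>xs | length xs = n \<and> real CARD('v) * s < dist (doc_freq xs) \<eta>. doc_weight \<eta> xs)"
      proof (rule sum_mono2)
        show "?A \<subseteq> {xs. length xs = n \<and> real CARD('v) * s < dist (doc_freq xs) \<eta>}"
          using elim \<phi> by (auto simp: \<eta>_def intro: less_le_trans infdist_le)
      qed (auto intro: doc_weight_nonneg \<eta>)
      also have "\<dots> \<le> ?q" by (rule doc_freq_concentration[OF \<eta> s n])
      finally show ?case by (simp add: \<eta>_def)
    qed
  qed
  then have "(\<Sum>xs\<in>?A. doc_pmf G r J \<alpha> \<omega> xs) \<le> (\<Sum>\<phi>\<in>maximal_paths G r. snd \<omega> \<phi> * ?q)"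
    unfolding sum_doc_pmf[OF \<omega>] by (intro sum_mono mult_left_mono param_weight_nonneg[OF \<omega>])
  then show ?thesis by (simp add: sum_distrib_right[symmetric] param_weight_sum[OF \<omega>])
qed

text \<open>The mixture falls within \<epsilon> of \<open>x\<close> with the Dirichlet mass of a
  small ball, and then the empirical distribution is within \<open>CARD('v) * s\<close> of the
  mixture with conditional probability at least 1/2. The constant is obtained before all other data,
  so the bound is uniform in the parameter.\<close>

lemma sum_doc_pmf_near_ge:
  obtains c where "0 < c"
    "\<And>(\<omega> :: ('u, 'v::finite) param) \<phi> x \<epsilon> s n. \<omega> \<in> param_space G r \<Longrightarrow> \<phi> \<in> maximal_paths G r \<Longrightarrow>
       x \<in> component_polytope (fst \<omega>) \<phi> \<Longrightarrow> 0 < \<epsilon> \<Longrightarrow> \<epsilon> \<le> 1 \<Longrightarrow> 0 \<le> s \<Longrightarrow> 0 < n \<Longrightarrow>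
       2 * real CARD('v) * exp (- 2 * real n * s\<^sup>2) \<le> 1 / 2 \<Longrightarrow>
       snd \<omega> \<phi> * (c * \<epsilon> powr (max 1 \<alpha> * real J - 1)) \<le>
       (\<Sum>xs | length xs = n \<and> dist (doc_freq xs) x \<le> \<epsilon> + real CARD('v) * s. doc_pmf G r J \<alpha> \<omega> xs)"
proof -
  obtain c where c: "0 < c" and ball:
    "\<And>\<beta>\<^sub>0 \<epsilon>. \<beta>\<^sub>0 \<in> simplex_coeffs J \<Longrightarrow> 0 < \<epsilon> \<Longrightarrow> \<epsilon> \<le> 1 \<Longrightarrow>
       c * \<epsilon> powr (max 1 \<alpha> * real J - 1) \<le>
       measure (sym_dirichlet J \<alpha>) {\<beta> \<in> space (sym_dirichlet J \<alpha>). (\<Sum>k<J. \<bar>\<beta> k - \<beta>\<^sub>0 k\<bar>) \<le> \<epsilon>}"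
    using sym_dirichlet_small_ball[OF J \<alpha>] by blast
  show thesis
  proof (rule that[of "c / 2"])
    fix \<omega> :: "('u, 'v::finite) param" and \<phi> x and \<epsilon> s :: real and n :: nat
    assume \<omega>: "\<omega> \<in> param_space G r" and \<phi>: "\<phi> \<in> maximal_paths G r"
      and x: "x \<in> component_polytope (fst \<omega>) \<phi>" and \<epsilon>: "0 < \<epsilon>" "\<epsilon> \<le> 1" and s: "0 \<le> s" and n: "0 < n"
      and tail: "2 * real CARD('v) * exp (- 2 * real n * s\<^sup>2) \<le> 1 / 2"
    note simplex = param_simplex[OF \<omega>]
    obtain \<beta>\<^sub>0 where \<beta>\<^sub>0: "\<beta>\<^sub>0 \<in> simplex_coeffs J" and x_eq: "x = mixture J (fst \<omega>) \<phi> \<beta>\<^sub>0"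
      using x mixture_image[OF \<phi>, of "fst \<omega>"] by auto
    let ?N = "{xs :: 'v list. length xs = n \<and> dist (doc_freq xs) x \<le> \<epsilon> + real CARD('v) * s}"
    define B where "B = {\<beta> \<in> space (sym_dirichlet J \<alpha>). (\<Sum>k<J. \<bar>\<beta> k - \<beta>\<^sub>0 k\<bar>) \<le> \<epsilon>}"
    have B: "B \<in> sets (sym_dirichlet J \<alpha>)" unfolding B_def by measurable
    have "(c * \<epsilon> powr (max 1 \<alpha> * real J - 1)) / 2 \<le> measure (sym_dirichlet J \<alpha>) B * (1 / 2)"
      using ball[OF \<beta>\<^sub>0 \<epsilon>] by (simp add: B_def)
    also have "\<dots> = (\<integral>\<beta>. indicator B \<beta> * (1 / 2) \<partial>sym_dirichlet J \<alpha>)"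
      using B by (simp add: Int_absorb2 sets.sets_into_space[OF B, simplified])
    also have "\<dots> \<le> (\<integral>\<beta>. (\<Sum>xs\<in>?N. doc_weight (mixture J (fst \<omega>) \<phi> \<beta>) xs) \<partial>sym_dirichlet J \<alpha>)"
    proof (rule integral_mono_AE)
      show "integrable (sym_dirichlet J \<alpha>) (\<lambda>\<beta>. \<Sum>xs\<in>?N. doc_weight (mixture J (fst \<omega>) \<phi> \<beta>) xs)"
        by (intro Bochner_Integration.integrable_sum integrable_doc_weight \<phi> simplex)
      show "integrable (sym_dirichlet J \<alpha>) (\<lambda>\<beta>. indicator B \<beta> * (1 / 2) :: real)"
        using B by (intro integrable_mult_left) (auto simp: integrable_indicator_iff D.emeasure_eq_measure)
      show "AE \<beta> in sym_dirichlet J \<alpha>. indicator B \<beta> * (1 / 2) \<le> (\<Sum>xs\<in>?N. doc_weight (mixture J (fst \<omega>) \<phi> \<beta>) xs)"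
        using AE_mixture[OF \<phi> simplex]
      proof eventually_elim
        case (elim \<beta>)
        define \<eta> where "\<eta> = mixture J (fst \<omega>) \<phi> \<beta>"
        have \<eta>: "\<eta> \<in> prob_simplex" using elim by (simp add: \<eta>_def)
        let ?F = "{xs :: 'v list. length xs = n \<and> real CARD('v) * s < dist (doc_freq xs) \<eta>}"
        show ?case
        proof (cases "\<beta> \<in> B")
          case True
          have d: "dist \<eta> x \<le> \<epsilon>"
            using dist_mixture_le[OF \<phi> simplex, of \<beta> \<beta>\<^sub>0] True by (simp add: \<eta>_def x_eq B_def)
          \<comment> \<open>A document that is not near \<open>x\<close> must deviate from its own
            mixture, by the triangle inequality.\<close>
          have "{xs. length xs = n} \<subseteq> ?N \<union> ?F"
          proof
            fix xs :: "'v list" assume "xs \<in> {xs. length xs = n}"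
            then show "xs \<in> ?N \<union> ?F"
              using dist_triangle[of "doc_freq xs" x \<eta>] d by auto
          qed
          then have "(\<Sum>xs | length xs = n. doc_weight \<eta> xs) \<le> (\<Sum>xs\<in>?N \<union> ?F. doc_weight \<eta> xs)"
            by (intro sum_mono2) (auto intro: doc_weight_nonneg \<eta>)
          also have "\<dots> \<le> (\<Sum>xs\<in>?N. doc_weight \<eta> xs) + (\<Sum>xs\<in>?F. doc_weight \<eta> xs)"
            by (simp add: sum_Un sum_nonneg doc_weight_nonneg \<eta>)
          also have "(\<Sum>xs\<in>?F. doc_weight \<eta> xs) \<le> 1 / 2"
            using doc_freq_concentration[OF \<eta> s n] tail by linarith
          finally show ?thesis using True using sum_docs_doc_weight[OF \<eta>, of n] by (simp add: \<eta>_def)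
        next
          case False
          then show ?thesis using \<eta> by (auto simp: \<eta>_def intro!: sum_nonneg doc_weight_nonneg)
        qed
      qed
    qed
    finally have "snd \<omega> \<phi> * (c / 2 * \<epsilon> powr (max 1 \<alpha> * real J - 1)) \<le>
       snd \<omega> \<phi> * (\<integral>\<beta>. (\<Sum>xs\<in>?N. doc_weight (mixture J (fst \<omega>) \<phi> \<beta>) xs) \<partial>sym_dirichlet J \<alpha>)"
      by (intro mult_left_mono param_weight_nonneg \<omega> \<phi>) simp
    also have "\<dots> \<le> (\<Sum>xs\<in>?N. doc_pmf G r J \<alpha> \<omega> xs)"
      unfolding sum_doc_pmf[OF \<omega>]
    proof (rule member_le_sum[OF \<phi>])
      show "finite (maximal_paths G r)" by (rule finite_maximal_paths(1)[OF \<omega>])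
      show "0 \<le> snd \<omega> \<psi> * (\<integral>\<beta>. (\<Sum>xs\<in>?N. doc_weight (mixture J (fst \<omega>) \<psi> \<beta>) xs) \<partial>sym_dirichlet J \<alpha>)"
        if "\<psi> \<in> maximal_paths G r - {\<phi>}" for \<psi>
      proof (intro mult_nonneg_nonneg integral_nonneg_AE)
        have \<psi>: "\<psi> \<in> maximal_paths G r" using that by simp
        show "AE \<beta> in sym_dirichlet J \<alpha>. 0 \<le> (\<Sum>xs\<in>?N. doc_weight (mixture J (fst \<omega>) \<psi> \<beta>) xs)"
          using AE_mixture[OF \<psi> simplex] by eventually_elim (auto intro: doc_weight_nonneg sum_nonneg)
      qed (use that in \<open>auto intro: param_weight_nonneg \<omega>\<close>)
    qed
    finally show "snd \<omega> \<phi> * (c / 2 * \<epsilon> powr (max 1 \<alpha> * real J - 1)) \<le> (\<Sum>xs\<in>?N. doc_pmf G r J \<alpha> \<omega> xs)" .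
  qed (use c in simp)
qed

text \<open>The topics enter monotonically, and \<open>doc_weight\<close> is homogeneous of degree
  \<open>length xs\<close> in the mixture; so one-sided relative closeness of the coordinates gives
  the factor \<open>t ^ length xs\<close>, for every document and not only on average.\<close>

lemma doc_pmf_ge_of_close:
  fixes \<omega> \<omega>\<^sub>0 :: "('u, 'v::finite) param"
  assumes \<omega>: "\<omega> \<in> param_space G r" and \<omega>\<^sub>0: "\<omega>\<^sub>0 \<in> param_space G r"
    and t: "0 \<le> t" "t \<le> 1" and t': "0 \<le> t'" 
    and \<rho>: "\<And>u v. u \<in> pverts G \<Longrightarrow> t * fst \<omega>\<^sub>0 u $ v \<le> fst \<omega> u $ v"
    and \<pi>: "\<And>\<phi>. \<phi> \<in> maximal_paths G r \<Longrightarrow> t' * snd \<omega>\<^sub>0 \<phi> \<le> snd \<omega> \<phi>"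
  shows "t' * t ^ length xs * doc_pmf G r J \<alpha> \<omega>\<^sub>0 xs \<le> doc_pmf G r J \<alpha> \<omega> xs"
proof -
  have "t' * t ^ length xs * doc_pmf G r J \<alpha> \<omega>\<^sub>0 xs = (\<Sum>\<phi>\<in>maximal_paths G r. (t' * snd \<omega>\<^sub>0 \<phi>) *
     (\<integral>\<beta>. t ^ length xs * doc_weight (mixture J (fst \<omega>\<^sub>0) \<phi> \<beta>) xs \<partial>sym_dirichlet J \<alpha>))"
    unfolding doc_pmf_altdef by (simp add: sum_distrib_left mult_ac)
  also have "\<dots> \<le> doc_pmf G r J \<alpha> \<omega> xs"
    unfolding doc_pmf_altdef
  proof (rule sum_mono)
    fix \<phi> assume \<phi>: "\<phi> \<in> maximal_paths G r"
    have "(\<integral>\<beta>. t ^ length xs * doc_weight (mixture J (fst \<omega>\<^sub>0) \<phi> \<beta>) xs \<partial>sym_dirichlet J \<alpha>)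
       \<le> (\<integral>\<beta>. doc_weight (mixture J (fst \<omega>) \<phi> \<beta>) xs \<partial>sym_dirichlet J \<alpha>)"
    proof (rule integral_mono_AE)
      show "AE \<beta> in sym_dirichlet J \<alpha>. t ^ length xs * doc_weight (mixture J (fst \<omega>\<^sub>0) \<phi> \<beta>) xs
          \<le> doc_weight (mixture J (fst \<omega>) \<phi> \<beta>) xs"
        using AE_mixture[OF \<phi> param_simplex[OF \<omega>\<^sub>0]] AE_sym_dirichlet[OF J]
      proof eventually_elim
        case (elim \<beta>)
        have "t ^ length xs * doc_weight (mixture J (fst \<omega>\<^sub>0) \<phi> \<beta>) xs
           = (\<Prod>v\<in>UNIV. (t * mixture J (fst \<omega>\<^sub>0) \<phi> \<beta> $ v) ^ count_list xs v)"
          by (simp add: doc_weight_def power_mult_distrib prod.distrib power_sum[symmetric] sum_count_set)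
        also have "\<dots> \<le> doc_weight (mixture J (fst \<omega>) \<phi> \<beta>) xs"
          unfolding doc_weight_def
        proof (intro prod_mono conjI power_mono)
          fix v
          have "0 \<le> mixture J (fst \<omega>\<^sub>0) \<phi> \<beta> $ v" using elim by (simp add: prob_simplex_def)
          then show 1: "0 \<le> t * mixture J (fst \<omega>\<^sub>0) \<phi> \<beta> $ v" using t by simp
          then show "0 \<le> (t * mixture J (fst \<omega>\<^sub>0) \<phi> \<beta> $ v) ^ count_list xs v" by simp
          have "t * mixture J (fst \<omega>\<^sub>0) \<phi> \<beta> $ v = (\<Sum>k<J. \<beta> k * (t * fst \<omega>\<^sub>0 (\<phi> ! k) $ v))"
            by (simp add: mixture_component sum_distrib_left mult_ac)
          also have "\<dots> \<le> mixture J (fst \<omega>) \<phi> \<beta> $ v"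
            unfolding mixture_component using elim(2) path_vertex[OF \<phi>]
            by (intro sum_mono mult_left_mono \<rho>) (auto simp: simplex_coeffs_def)
          finally show "t * mixture J (fst \<omega>\<^sub>0) \<phi> \<beta> $ v \<le> mixture J (fst \<omega>) \<phi> \<beta> $ v" .
        qed
        finally show ?case .
      qed
    qed (intro integrable_mult_right integrable_doc_weight \<phi> param_simplex \<omega> \<omega>\<^sub>0)+
    then show "t' * snd \<omega>\<^sub>0 \<phi> * (\<integral>\<beta>. t ^ length xs * doc_weight (mixture J (fst \<omega>\<^sub>0) \<phi> \<beta>) xs \<partial>sym_dirichlet J \<alpha>)
       \<le> snd \<omega> \<phi> * (\<integral>\<beta>. doc_weight (mixture J (fst \<omega>) \<phi> \<beta>) xs \<partial>sym_dirichlet J \<alpha>)"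
    proof (intro mult_mono \<pi> \<phi>)
      show "0 \<le> (\<integral>\<beta>. t ^ length xs * doc_weight (mixture J (fst \<omega>\<^sub>0) \<phi> \<beta>) xs \<partial>sym_dirichlet J \<alpha>)"
      proof (rule integral_nonneg_AE)
        show "AE \<beta> in sym_dirichlet J \<alpha>. 0 \<le> t ^ length xs * doc_weight (mixture J (fst \<omega>\<^sub>0) \<phi> \<beta>) xs"
          using AE_mixture[OF \<phi> param_simplex[OF \<omega>\<^sub>0]]
          by eventually_elim (use t in \<open>auto intro!: mult_nonneg_nonneg doc_weight_nonneg\<close>)
      qed
    qed (auto intro: param_weight_nonneg \<omega> \<phi>)
  qed
  finally show ?thesis .
qed

end

section \<open>Likelihood and posterior\<close>

lemma sum_PiE_prod_power:
  fixes p :: "'a \<Rightarrow> real"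
  assumes "finite A"
  shows "(\<Sum>x\<in>{..<m::nat} \<rightarrow>\<^sub>E A. \<Prod>j<m. p (x j)) = (\<Sum>a\<in>A. p a) ^ m"
  using prod_sum_PiE[of "{..<m}" "\<lambda>_. A" "\<lambda>_. p"] assms by simp

lemma sum_PiE_none_le:
  fixes p :: "'a \<Rightarrow> real"
  assumes fin: "finite S" and p: "\<And>a. a \<in> S \<Longrightarrow> 0 \<le> p a" "sum p S = 1" and A: "A \<subseteq> S"
    and q: "q \<le> sum p A"
  shows "(\<Sum>x | x \<in> {..<m::nat} \<rightarrow>\<^sub>E S \<and> (\<forall>j<m. x j \<notin> A). \<Prod>j<m. p (x j)) \<le> exp (- (real m * q))"
proof -
  have eq: "{x. x \<in> {..<m} \<rightarrow>\<^sub>E S \<and> (\<forall>j<m. x j \<notin> A)} = {..<m} \<rightarrow>\<^sub>E (S - A)"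
    by (rule set_eqI, unfold mem_Collect_eq Diff_iff PiE_iff lessThan_iff, blast)
  have diff: "sum p (S - A) = 1 - sum p A" using sum_diff[OF fin A, of p] p(2) by simp
  have "(\<Sum>x | x \<in> {..<m} \<rightarrow>\<^sub>E S \<and> (\<forall>j<m. x j \<notin> A). \<Prod>j<m. p (x j)) = (1 - sum p A) ^ m"
    unfolding eq diff[symmetric] using fin by (intro sum_PiE_prod_power) simp
  also have "\<dots> \<le> exp (- q) ^ m"
  proof (rule power_mono)
    show "1 - sum p A \<le> exp (- q)" using q exp_ge_add_one_self[of "- q"] by linarith
    show "0 \<le> 1 - sum p A" unfolding diff[symmetric] by (rule sum_nonneg) (simp add: p(1))
  qed
  also have "\<dots> = exp (- (real m * q))" using exp_of_nat_mult[of m "- q"] by simp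
  finally show ?thesis .
qed

text \<open>The complementary event is again a full product and has probability
  \<open>(1 - sum p A) ^ m\<close>; Bernoulli's inequality then plays the part of a union
  bound.\<close>

lemma sum_PiE_some_le:
  fixes p :: "'a \<Rightarrow> real"
  assumes fin: "finite S" and p: "\<And>a. a \<in> S \<Longrightarrow> 0 \<le> p a" "sum p S = 1" and A: "A \<subseteq> S"
    and q: "sum p A \<le> q"
  shows "(\<Sum>x | x \<in> {..<m::nat} \<rightarrow>\<^sub>E S \<and> (\<exists>j<m. x j \<in> A). \<Prod>j<m. p (x j)) \<le> real m * q"
proof -
  have diff: "sum p (S - A) = 1 - sum p A" using sum_diff[OF fin A, of p] p(2) by simp
  have "0 \<le> sum p (S - A)" by (rule sum_nonneg) (simp add: p(1))
  then have le1: "sum p A \<le> 1" by (simp add: diff)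
  have eq: "{x. x \<in> {..<m} \<rightarrow>\<^sub>E S \<and> (\<exists>j<m. x j \<in> A)} = ({..<m} \<rightarrow>\<^sub>E S) - ({..<m} \<rightarrow>\<^sub>E (S - A))"
    by (rule set_eqI, unfold mem_Collect_eq Diff_iff PiE_iff lessThan_iff, blast)
  have "(\<Sum>x\<in>({..<m} \<rightarrow>\<^sub>E S) - ({..<m} \<rightarrow>\<^sub>E (S - A)). \<Prod>j<m. p (x j))
     = (\<Sum>x\<in>{..<m} \<rightarrow>\<^sub>E S. \<Prod>j<m. p (x j)) - (\<Sum>x\<in>{..<m} \<rightarrow>\<^sub>E (S - A). \<Prod>j<m. p (x j))"
    by (rule sum_diff, rule finite_PiE) (simp_all add: fin PiE_mono)
  also have "\<dots> = 1 - (1 - sum p A) ^ m"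
    using sum_PiE_prod_power[OF fin, where m = m and p = p]
      sum_PiE_prod_power[OF finite_Diff[OF fin, of A], where m = m and p = p]
    by (simp only: p(2) diff power_one)
  also have "\<dots> \<le> real m * sum p A"
    using Bernoulli_inequality[of "- sum p A" m] le1 by simp
  also have "\<dots> \<le> real m * q" using q by (rule mult_left_mono) simp
  finally show ?thesis unfolding eq .
qed

context admixture_tree
begin

abbreviation "docs n \<equiv> {xs. length xs = n}"

lemma prob_space_doc_measure:
  fixes \<omega> :: "('u, 'v::finite) param"
  assumes "\<omega> \<in> param_space G r"
  shows "prob_space (doc_measure G r J \<alpha> n \<omega>)"
proof (rule prob_spaceI)
  show "emeasure (doc_measure G r J \<alpha> n \<omega>) (space (doc_measure G r J \<alpha> n \<omega>)) = 1"
    unfolding doc_measure_def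
    by (simp add: space_point_measure emeasure_point_measure_finite sum_ennreal doc_pmf_nonneg sum_doc_pmf_UNIV assms)
qed

lemma measure_doc_measure_singleton:
  fixes \<omega> :: "('u, 'v::finite) param"
  assumes "\<omega> \<in> param_space G r" "length xs = n"
  shows "measure (doc_measure G r J \<alpha> n \<omega>) {xs} = doc_pmf G r J \<alpha> \<omega> xs"
  using assms unfolding doc_measure_def measure_def
  by (subst emeasure_point_measure_finite) (auto simp: doc_pmf_nonneg)

lemma likelihood_restrict: "likelihood G r J \<alpha> m (restrict X {..<m}) = likelihood G r J \<alpha> m X"
  by (auto simp: likelihood_def fun_eq_iff)

lemma posterior_restrict: "posterior G r J \<alpha> prior m (restrict X {..<m}) = posterior G r J \<alpha> prior m X"
  by (simp add: posterior_def likelihood_restrict)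

lemma likelihood_nonneg:
  fixes \<omega> :: "('u, 'v::finite) param"
  assumes "\<omega> \<in> param_space G r"
  shows "0 \<le> likelihood G r J \<alpha> m X \<omega>"
  by (simp add: likelihood_def prod_nonneg doc_pmf_nonneg assms)

text \<open>Only the first \<open>m\<close> documents matter for the posterior, and they take
  finitely many values. Events in the infinite product space thereby become finite sums of
  likelihoods, and their measurability follows from that of singletons.\<close>

lemma measure_data_PiM:
  fixes \<omega>\<^sub>0 :: "('u, 'v::finite) param"
  assumes \<omega>\<^sub>0: "\<omega>\<^sub>0 \<in> param_space G r" and S: "S \<subseteq> {..<m} \<rightarrow>\<^sub>E docs n"
  defines "P \<equiv> (\<Pi>\<^sub>M j\<in>(UNIV :: nat set). doc_measure G r J \<alpha> n \<omega>\<^sub>0)"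
  shows "{X \<in> space P. restrict X {..<m} \<in> S} \<in> sets P"
    "measure P {X \<in> space P. restrict X {..<m} \<in> S} = (\<Sum>x\<in>S. likelihood G r J \<alpha> m x \<omega>\<^sub>0)"
proof -
  interpret doc: prob_space "doc_measure G r J \<alpha> n \<omega>\<^sub>0" by (rule prob_space_doc_measure[OF \<omega>\<^sub>0])
  interpret P: product_prob_space "\<lambda>_ :: nat. doc_measure G r J \<alpha> n \<omega>\<^sub>0" UNIV ..
  define Q where "Q = (\<Pi>\<^sub>M j\<in>{..<m}. doc_measure G r J \<alpha> n \<omega>\<^sub>0)"
  interpret Q: finite_product_prob_space "\<lambda>_ :: nat. doc_measure G r J \<alpha> n \<omega>\<^sub>0" "{..<m}" by standard simp
  have fin: "finite S" using S by (rule finite_subset) (auto intro: finite_PiE)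
  have sing: "{x} \<in> sets Q" "measure Q {x} = likelihood G r J \<alpha> m x \<omega>\<^sub>0" if "x \<in> S" for x
  proof -
    have x: "length (x j) = n" if "j < m" for j using \<open>x \<in> S\<close> S that by auto
    have eq: "{x} = (\<Pi>\<^sub>E j\<in>{..<m}. {x j})"
      using \<open>x \<in> S\<close> S by (intro PiE_singleton[symmetric]) (auto simp: PiE_iff)
    show "{x} \<in> sets Q" unfolding eq Q_def
      by (rule sets_PiM_I_finite) (auto simp: doc_measure_def sets_point_measure x)
    have "measure Q {x} = (\<Prod>j<m. measure (doc_measure G r J \<alpha> n \<omega>\<^sub>0) {x j})"
      unfolding eq Q_def by (rule Q.finite_measure_PiM_emb) (auto simp: doc_measure_def sets_point_measure x)
    also have "\<dots> = likelihood G r J \<alpha> m x \<omega>\<^sub>0"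
      unfolding likelihood_def using x by (intro prod.cong) (auto simp: measure_doc_measure_singleton \<omega>\<^sub>0)
    finally show "measure Q {x} = likelihood G r J \<alpha> m x \<omega>\<^sub>0" .
  qed
  have SQ: "S \<in> sets Q"
  proof -
    have "S = (\<Union>x\<in>S. {x})" by auto
    then show ?thesis using fin sing(1) by (metis sets.finite_UN)
  qed
  have restr: "(\<lambda>X. restrict X {..<m}) \<in> P \<rightarrow>\<^sub>M Q"
    unfolding P_def Q_def by (rule measurable_restrict_subset) simp
  have eq: "{X \<in> space P. restrict X {..<m} \<in> S} = (\<lambda>X. restrict X {..<m}) -` S \<inter> space P" by auto
  show "{X \<in> space P. restrict X {..<m} \<in> S} \<in> sets P"
    unfolding eq by (rule measurable_sets[OF restr SQ])
  have "measure P {X \<in> space P. restrict X {..<m} \<in> S} = measure (distr P Q (\<lambda>X. restrict X {..<m})) S"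
    unfolding eq by (rule measure_distr[OF restr SQ, symmetric])
  also have "distr P Q (\<lambda>X. restrict X {..<m}) = Q"
    unfolding P_def Q_def by (rule P.distr_PiM_restrict_finite) auto
  also have "measure Q S = (\<Sum>x\<in>S. measure Q {x})"
    using Q.finite_measure_eq_sum_singleton[OF fin] sing(1) by (simp add: Q_def)
  also have "\<dots> = (\<Sum>x\<in>S. likelihood G r J \<alpha> m x \<omega>\<^sub>0)" using sing(2) by simp
  finally show "measure P {X \<in> space P. restrict X {..<m} \<in> S} = (\<Sum>x\<in>S. likelihood G r J \<alpha> m x \<omega>\<^sub>0)" .
qed

section \<open>Measurability in the parameter and normalised densities\<close>

lemma measurable_doc_pmf:
  "(\<lambda>\<omega> :: ('u, 'v::finite) param. doc_pmf G r J \<alpha> \<omega> xs) \<in> borel_measurable (param_measurable_space G r)"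
  unfolding param_measurable_space_def
proof (rule measurable_restrict_space1)
  let ?N = "(\<Pi>\<^sub>M u\<in>pverts G. (borel :: (real ^ 'v) measure)) \<Otimes>\<^sub>M (\<Pi>\<^sub>M \<phi>\<in>maximal_paths G r. (borel :: real measure))"
  have fst_nth: "(\<lambda>\<omega>. fst \<omega> u $ v) \<in> borel_measurable ?N" if "u \<in> pverts G" for u v
  proof -
    have "(\<lambda>\<omega>. fst \<omega> u) \<in> ?N \<rightarrow>\<^sub>M borel"
      using measurable_component_singleton[OF that, of "\<lambda>_. borel"] by measurable
    moreover have "(\<lambda>x :: real ^ 'v. x $ v) \<in> borel \<rightarrow>\<^sub>M borel"
      by (intro borel_measurable_continuous_onI continuous_on_component continuous_on_id)
    ultimately show ?thesis by (rule measurable_compose)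
  qed
  show "(\<lambda>\<omega> :: ('u, 'v) param. doc_pmf G r J \<alpha> \<omega> xs) \<in> borel_measurable ?N"
    unfolding doc_pmf_def
  proof (intro borel_measurable_sum borel_measurable_times)
    fix \<phi> assume \<phi>: "\<phi> \<in> maximal_paths G r"
    show "(\<lambda>\<omega> :: ('u, 'v) param. snd \<omega> \<phi>) \<in> borel_measurable ?N"
      using measurable_component_singleton[OF \<phi>, of "\<lambda>_. borel"] by measurable
    show "(\<lambda>\<omega> :: ('u, 'v) param. \<integral>\<beta>. (\<Prod>v\<in>UNIV. (\<Sum>k<J. \<beta> k * fst \<omega> (\<phi> ! k) $ v) ^ count_list xs v) \<partial>sym_dirichlet J \<alpha>)
        \<in> borel_measurable ?N"
    proof (rule D.borel_measurable_lebesgue_integral, unfold split_beta', intro borel_measurable_prod borel_measurable_power borel_measurable_sum borel_measurable_times)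
      fix v :: 'v and k assume k: "k \<in> {..<J}"
      show "(\<lambda>x. snd x k) \<in> borel_measurable (?N \<Otimes>\<^sub>M sym_dirichlet J \<alpha>)"
        using measurable_component_singleton[OF k, of "\<lambda>_. borel"] by measurable
      show "(\<lambda>x. fst (fst x) (\<phi> ! k) $ v) \<in> borel_measurable (?N \<Otimes>\<^sub>M sym_dirichlet J \<alpha>)"
        by (rule measurable_compose[OF measurable_fst fst_nth]) (use path_vertex[OF \<phi>] k in auto)
    qed
  qed
qed

end

text \<open>The normalised mass of \<open>F\<close> is \<open>Y / Z\<close>, and
  \<open>l \<le> Z / \<kappa>\<close> cancels the normalising constant \<open>Z\<close>. Only for
  \<open>l = 0\<close> could \<open>Z\<close> vanish, and then the left-hand side is 0.\<close>

lemma measure_density_normalized_le: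
  assumes "finite_measure M" and f [measurable]: "f \<in> borel_measurable M"
    and f01: "\<And>x. x \<in> space M \<Longrightarrow> 0 \<le> f x" "\<And>x. x \<in> space M \<Longrightarrow> f x \<le> 1"
    and \<kappa>: "0 < \<kappa>" and l: "0 \<le> l" "\<kappa> * l \<le> (\<integral>x. f x \<partial>M)" and F [measurable]: "F \<in> sets M"
  shows "measure (density M (\<lambda>x. ennreal (f x) / (\<integral>\<^sup>+x. ennreal (f x) \<partial>M))) F * l \<le> (\<integral>x. f x * indicator F x \<partial>M) / \<kappa>"
proof -
  interpret finite_measure M by fact
  define Z where "Z = (\<integral>x. f x \<partial>M)"
  define Y where "Y = (\<integral>x. f x * indicator F x \<partial>M)"
  have int: "integrable M f"
    by (rule integrable_const_bound[where B = 1]) (use f01 in auto)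
  have intF: "integrable M (\<lambda>x. f x * indicator F x)"
    using integrable_mult_indicator[OF F int] by (simp add: mult.commute)
  have Y: "0 \<le> Y" unfolding Y_def using f01 by (intro integral_nonneg_AE AE_I2) auto
  show ?thesis
  proof (cases "l = 0")
    case False
    then have "0 < \<kappa> * l" using l \<kappa> by simp
    then have Z: "0 < Z" using l by (simp add: Z_def)
    have nnZ: "(\<integral>\<^sup>+x. ennreal (f x) \<partial>M) = ennreal Z"
      unfolding Z_def by (rule nn_integral_eq_integral[OF int]) (use f01 in auto)
    have "emeasure (density M (\<lambda>x. ennreal (f x) / (\<integral>\<^sup>+x. ennreal (f x) \<partial>M))) F
       = (\<integral>\<^sup>+x. ennreal (f x) / ennreal Z * indicator F x \<partial>M)"
      unfolding nnZ by (rule emeasure_density) auto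
    also have "\<dots> = (\<integral>\<^sup>+x. ennreal (f x * indicator F x / Z) \<partial>M)"
      using Z f01 by (intro nn_integral_cong) (auto simp: divide_ennreal indicator_def)
    also have "\<dots> = ennreal (\<integral>x. f x * indicator F x / Z \<partial>M)"
      using Z f01 intF by (intro nn_integral_eq_integral) auto
    also have "(\<integral>x. f x * indicator F x / Z \<partial>M) = Y / Z" by (simp add: Y_def)
    finally have "measure (density M (\<lambda>x. ennreal (f x) / (\<integral>\<^sup>+x. ennreal (f x) \<partial>M))) F = Y / Z"
      using Y Z by (simp add: measure_def)
    moreover have "Y / Z * l \<le> Y / \<kappa>"
    proof -
      have "Y * (\<kappa> * l) \<le> Y * Z" using l(2) Y by (intro mult_left_mono) (auto simp: Z_def)
      then show ?thesis using Z \<kappa> by (simp add: field_simps)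
    qed
    ultimately show ?thesis by (simp add: Y_def)
  qed (use Y \<kappa> in \<open>simp add: Y_def\<close>)
qed

section \<open>The support of the prior and the union Hausdorff metric\<close>

definition param_box ::
  "'u pair_pre_digraph \<Rightarrow> 'u \<Rightarrow> ('u \<Rightarrow> (real ^ 'v::finite) set) \<Rightarrow> ('u list \<Rightarrow> real set) \<Rightarrow> ('u, 'v) param set" where
  "param_box G r f g = (\<Pi>\<^sub>E u\<in>pverts G. f u) \<times> (\<Pi>\<^sub>E \<phi>\<in>maximal_paths G r. g \<phi>) \<inter> param_space G r"

section \<open>Boxes in the parameter space\<close>

lemma param_space_subset:
  "param_space G r \<subseteq> (pverts G \<rightarrow>\<^sub>E UNIV) \<times> (maximal_paths G r \<rightarrow>\<^sub>E UNIV)"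
proof
  fix \<omega> assume "\<omega> \<in> param_space G r"
  then have "fst \<omega> \<in> pverts G \<rightarrow>\<^sub>E prob_simplex" "snd \<omega> \<in> maximal_paths G r \<rightarrow>\<^sub>E {0..1}"
    by (simp_all add: param_space_def split_beta)
  then have "fst \<omega> \<in> pverts G \<rightarrow>\<^sub>E UNIV" "snd \<omega> \<in> maximal_paths G r \<rightarrow>\<^sub>E UNIV"
    by (blast intro: subsetD[OF PiE_mono[OF subset_UNIV]])+
  then show "\<omega> \<in> (pverts G \<rightarrow>\<^sub>E UNIV) \<times> (maximal_paths G r \<rightarrow>\<^sub>E UNIV)"
    by (simp add: mem_Times_iff)
qed

lemma topspace_param_topology: "topspace (param_topology G r) = param_space G r"
  by (simp add: param_topology_def Int_absorb1[OF param_space_subset])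

lemma space_param_measurable_space: "space (param_measurable_space G r) = param_space G r"
  by (simp add: param_measurable_space_def space_restrict_space space_pair_measure space_PiM
      Int_absorb1[OF param_space_subset] Int_absorb2[OF param_space_subset])

lemma param_box_measurable:
  assumes "finite (pverts G)" "finite (maximal_paths G r)" "\<And>u. u \<in> pverts G \<Longrightarrow> open (f u)" "\<And>\<phi>. \<phi> \<in> maximal_paths G r \<Longrightarrow> open (g \<phi>)"
  shows "param_box G r f g \<in> sets (param_measurable_space G r :: ('u, 'v::finite) param measure)"
proof -
  have 1: "(\<Pi>\<^sub>E u\<in>pverts G. f u) \<times> (\<Pi>\<^sub>E \<phi>\<in>maximal_paths G r. g \<phi>)
     \<in> sets ((\<Pi>\<^sub>M u\<in>pverts G. borel) \<Otimes>\<^sub>M (\<Pi>\<^sub>M \<phi>\<in>maximal_paths G r. borel))"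
    using assms by (intro pair_measureI sets_PiM_I_finite) auto
  have 2: "param_box G r f g = (\<lambda>A. param_space G r \<inter> A) ((\<Pi>\<^sub>E u\<in>pverts G. f u) \<times> (\<Pi>\<^sub>E \<phi>\<in>maximal_paths G r. g \<phi>))"
    unfolding param_box_def by (rule Int_commute)
  show ?thesis
    unfolding 2 param_measurable_space_def sets_restrict_space using 1 by (rule imageI)
qed

text \<open>The sides come from prescribed bases and form extensional families, so that countable
  bases leave only countably many boxes.\<close>

lemma openin_param_topology_box:
  assumes U: "openin (param_topology G r) U" and \<omega>: "\<omega> \<in> U"
    and B: "topological_basis (B :: (real ^ 'v::finite) set set)" and B': "topological_basis B'"
  obtains f g where "f \<in> pverts G \<rightarrow>\<^sub>E B" "g \<in> maximal_paths G r \<rightarrow>\<^sub>E B'" "\<omega> \<in> param_box G r f g" "param_box G r f g \<subseteq> U"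
proof -
  obtain W where W: "openin (prod_topology (product_topology (\<lambda>_. euclidean :: (real ^ 'v) topology) (pverts G))
       (product_topology (\<lambda>_. euclidean :: real topology) (maximal_paths G r))) W" and UW: "U = W \<inter> param_space G r"
    using U[unfolded param_topology_def openin_subtopology] by (elim exE conjE) (rule that)
  obtain \<rho> \<pi> where \<omega>_eq: "\<omega> = (\<rho>, \<pi>)" by (cases \<omega>)
  obtain U1 U2 where U1: "openin (product_topology (\<lambda>_. euclidean) (pverts G)) U1" "\<rho> \<in> U1"
    and U2: "openin (product_topology (\<lambda>_. euclidean) (maximal_paths G r)) U2" "\<pi> \<in> U2" and U12: "U1 \<times> U2 \<subseteq> W"
  proof -
    have "(\<rho>, \<pi>) \<in> W" using \<omega> unfolding UW \<omega>_eq by (rule IntD1)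
    from W[unfolded openin_prod_topology_alt, rule_format, OF this] show ?thesis
      by (elim exE conjE) (rule that)
  qed
  obtain V1 where V1: "\<forall>u\<in>pverts G. openin euclidean (V1 u)" "\<rho> \<in> Pi\<^sub>E (pverts G) V1" "Pi\<^sub>E (pverts G) V1 \<subseteq> U1"
    using U1(1)[unfolded openin_product_topology_alt, rule_format, OF U1(2)]
    by (elim exE conjE) (rule that)
  obtain V2 where V2: "\<forall>\<phi>\<in>maximal_paths G r. openin euclidean (V2 \<phi>)" "\<pi> \<in> Pi\<^sub>E (maximal_paths G r) V2" "Pi\<^sub>E (maximal_paths G r) V2 \<subseteq> U2"
    using U2(1)[unfolded openin_product_topology_alt, rule_format, OF U2(2)]
    by (elim exE conjE) (rule that)
  have "\<exists>S. S \<in> B \<and> \<rho> u \<in> S \<and> S \<subseteq> V1 u" if "u \<in> pverts G" for u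
  proof -
    have "open (V1 u)" "\<rho> u \<in> V1 u" using V1(1,2) that by (simp_all add: PiE_mem open_openin[symmetric])
    then show ?thesis by (rule topological_basisE[OF B]) blast
  qed
  then obtain f where f: "\<And>u. u \<in> pverts G \<Longrightarrow> f u \<in> B \<and> \<rho> u \<in> f u \<and> f u \<subseteq> V1 u" by metis
  have "\<exists>S. S \<in> B' \<and> \<pi> \<phi> \<in> S \<and> S \<subseteq> V2 \<phi>" if "\<phi> \<in> maximal_paths G r" for \<phi>
  proof -
    have "open (V2 \<phi>)" "\<pi> \<phi> \<in> V2 \<phi>" using V2(1,2) that by (simp_all add: PiE_mem open_openin[symmetric])
    then show ?thesis by (rule topological_basisE[OF B']) blast
  qed
  then obtain g where g: "\<And>\<phi>. \<phi> \<in> maximal_paths G r \<Longrightarrow> g \<phi> \<in> B' \<and> \<pi> \<phi> \<in> g \<phi> \<and> g \<phi> \<subseteq> V2 \<phi>" by metis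
  have sub1: "(\<Pi>\<^sub>E u\<in>pverts G. restrict f (pverts G) u) \<subseteq> U1"
    by (rule order_trans[OF PiE_mono V1(3)]) (simp add: f)
  have sub2: "(\<Pi>\<^sub>E \<phi>\<in>maximal_paths G r. restrict g (maximal_paths G r) \<phi>) \<subseteq> U2"
    by (rule order_trans[OF PiE_mono V2(3)]) (simp add: g)
  show ?thesis
  proof (rule that[of "restrict f (pverts G)" "restrict g (maximal_paths G r)"])
    show "\<omega> \<in> param_box G r (restrict f (pverts G)) (restrict g (maximal_paths G r))"
    proof -
      have "\<rho> \<in> (\<Pi>\<^sub>E u\<in>pverts G. restrict f (pverts G) u)"
        by (rule PiE_I) (simp_all add: f PiE_arb[OF V1(2)])
      moreover have "\<pi> \<in> (\<Pi>\<^sub>E \<phi>\<in>maximal_paths G r. restrict g (maximal_paths G r) \<phi>)"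
        by (rule PiE_I) (simp_all add: g PiE_arb[OF V2(2)])
      ultimately show ?thesis using \<omega> unfolding UW \<omega>_eq param_box_def
        by (simp only: Int_iff mem_Times_iff fst_conv snd_conv simp_thms)
    qed
    show "param_box G r (restrict f (pverts G)) (restrict g (maximal_paths G r)) \<subseteq> U"
      unfolding UW param_box_def
      by (intro Int_mono order_trans[OF Sigma_mono U12] sub1 sub2 subset_refl)
  qed (simp_all add: f g)
qed

text \<open>By second countability the complement of the support is covered by countably many null
  boxes. This is how bounds known only on the support are used under the prior integral.\<close>

lemma AE_measure_support:
  fixes M :: "('u, 'v::finite) param measure"
  assumes fin: "finite (pverts G)" "finite (maximal_paths G r)"
    and M: "sets M = sets (param_measurable_space G r)"
  shows "AE \<omega> in M. \<omega> \<in> measure_support (param_topology G r) M"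
proof -
  obtain B :: "(real ^ 'v) set set" where B: "countable B" "topological_basis B"
    using ex_countable_basis by auto
  obtain B' :: "real set set" where B': "countable B'" "topological_basis B'"
    using ex_countable_basis by auto
  define I where "I = (pverts G \<rightarrow>\<^sub>E B) \<times> (maximal_paths G r \<rightarrow>\<^sub>E B')"
  define box where "box i = (param_box G r (fst i) (snd i) :: ('u, 'v) param set)" for i
  have I: "countable I" 
    unfolding I_def by (intro countable_SIGMA countable_PiE fin B(1) B'(1))
  have box: "box i \<in> sets M" if "i \<in> I" for i
  proof -
    have "fst i \<in> pverts G \<rightarrow>\<^sub>E B" "snd i \<in> maximal_paths G r \<rightarrow>\<^sub>E B'"
      using that by (simp_all add: I_def mem_Times_iff)
    then show ?thesis
      unfolding box_def M using topological_basis_open[OF B(2)] topological_basis_open[OF B'(2)]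
      by (intro param_box_measurable fin) (blast dest: PiE_mem)+
  qed
  have inner: "\<exists>i\<in>I. \<omega> \<in> box i \<and> box i \<subseteq> U" if U: "openin (param_topology G r) U" "\<omega> \<in> U" for U \<omega>
  proof -
    obtain f g where "f \<in> pverts G \<rightarrow>\<^sub>E B" "g \<in> maximal_paths G r \<rightarrow>\<^sub>E B'"
      "\<omega> \<in> param_box G r f g" "param_box G r f g \<subseteq> U"
      by (rule openin_param_topology_box[OF U B(2) B'(2)])
    then have "(f, g) \<in> I \<and> \<omega> \<in> box (f, g) \<and> box (f, g) \<subseteq> U" by (simp add: I_def box_def)
    then show ?thesis by blast
  qed
  \<comment> \<open>Open sets are countable unions of boxes and thus measurable, which monotonicity
    of the measure requires when a null open set is shrunk to a box.\<close>
  have meas: "U \<in> sets M" if U: "openin (param_topology G r) U" for U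
  proof -
    have eq: "U = (\<Union>i\<in>{i\<in>I. box i \<subseteq> U}. box i)"
    proof
      show "U \<subseteq> (\<Union>i\<in>{i\<in>I. box i \<subseteq> U}. box i)"
      proof
        fix \<omega> assume "\<omega> \<in> U"
        from inner[OF U this] obtain i where "i \<in> I" "\<omega> \<in> box i" "box i \<subseteq> U" by (elim bexE conjE)
        then show "\<omega> \<in> (\<Union>i\<in>{i\<in>I. box i \<subseteq> U}. box i)" by (intro UN_I CollectI conjI)
      qed
    qed (rule UN_least, simp)
    have "countable {i\<in>I. box i \<subseteq> U}" by (rule countable_subset[OF _ I]) auto
    then have "(\<Union>i\<in>{i\<in>I. box i \<subseteq> U}. box i) \<in> sets M"
      by (rule sets.countable_UN') (simp add: box image_subset_iff)
    then show ?thesis unfolding eq[symmetric] .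
  qed
  define N where "N = (\<Union>i\<in>{i\<in>I. emeasure M (box i) = 0}. box i)"
  have "countable {i\<in>I. emeasure M (box i) = 0}" by (rule countable_subset[OF _ I]) auto
  then have N: "N \<in> null_sets M"
    unfolding N_def by (rule null_sets_UN') (simp add: box null_sets_def)
  show ?thesis
  proof (rule AE_I'[OF N], rule subsetI)
    fix \<omega> assume "\<omega> \<in> {x \<in> space M. x \<notin> measure_support (param_topology G r) M}"
    then have "\<omega> \<in> param_space G r" "\<omega> \<notin> measure_support (param_topology G r) M"
      by (simp_all add: sets_eq_imp_space_eq[OF M] space_param_measurable_space)
    then have "\<not> (\<forall>U. openin (param_topology G r) U \<and> \<omega> \<in> U \<longrightarrow> 0 < emeasure M U)"
      by (simp only: measure_support_def topspace_param_topology mem_Collect_eq simp_thms)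
    then obtain U where U: "openin (param_topology G r) U" "\<omega> \<in> U" and "\<not> 0 < emeasure M U" by blast
    then have U0: "emeasure M U = 0" by simp
    then obtain i where i: "i \<in> I" "\<omega> \<in> box i" "box i \<subseteq> U" using inner[OF U] by blast
    have "emeasure M (box i) \<le> emeasure M U" by (rule emeasure_mono[OF i(3) meas[OF U(1)]])
    then have "emeasure M (box i) = 0" using U0 by simp
    then show "\<omega> \<in> N" unfolding N_def using i by blast
  qed
qed

text \<open>By contraposition, where the two suprema are merely bounded above by \<open>d\<close>;
  for real suprema this needs nonempty index sets.\<close>

lemma hausdorff_dist_gtE:
  assumes "d < hausdorff_dist A B" "A \<noteq> {}" "B \<noteq> {}"
  obtains a where "a \<in> A" "d < infdist a B" | b where "b \<in> B" "d < infdist b A"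
proof -
  have "(\<exists>a\<in>A. d < infdist a B) \<or> (\<exists>b\<in>B. d < infdist b A)"
  proof (rule ccontr)
    assume "\<not> ?thesis"
    then have "(SUP a\<in>A. infdist a B) \<le> d" "(SUP b\<in>B. infdist b A) \<le> d"
      using assms(2,3) by (auto intro!: cSUP_least simp: not_less)
    then show False using assms(1) by (simp add: hausdorff_dist_def)
  qed
  then show thesis using that by blast
qed

text \<open>The cube is cut into cells of side \<open>1 / (CARD('v) * n)\<close>, and one point of
  \<open>U\<close> is picked from each cell that meets \<open>U\<close>. The net has to lie in
  \<open>U\<close> itself, because documents are guaranteed to come close only to points of the true
  polytopes.\<close>

lemma simplex_net:
  fixes U :: "(real ^ 'v::finite) set"
  assumes U: "U \<subseteq> prob_simplex" and n: "0 < n"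
  obtains N where "N \<subseteq> U" "finite N" "card N \<le> (CARD('v) * n + 1) ^ CARD('v)"
    "\<And>x. x \<in> U \<Longrightarrow> \<exists>y\<in>N. dist x y \<le> 1 / real n"
proof -
  define V where "V = CARD('v)"
  have V: "0 < V" by (simp add: V_def)
  define g where "g x = (\<lambda>v\<in>UNIV. nat \<lfloor>real (V * n) * (x $ v)\<rfloor>)" for x :: "real ^ 'v"
  define N where "N = inv_into U g ` (g ` U)"
  have gU: "g ` U \<subseteq> UNIV \<rightarrow>\<^sub>E {..V * n}"
  proof (rule image_subsetI)
    fix x assume "x \<in> U"
    then have x: "0 \<le> x $ v" "x $ v \<le> 1" for v
      using U prob_simplex_le_1[of x v] by (auto simp: prob_simplex_def)
    have "real (V * n) * (x $ v) \<le> real (V * n)" for v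
      using mult_left_mono[OF x(2), of "real (V * n)" v] by simp
    then have "nat \<lfloor>real (V * n) * (x $ v)\<rfloor> \<le> V * n" for v
      by (metis floor_mono floor_of_nat nat_int nat_mono)
    then show "g x \<in> UNIV \<rightarrow>\<^sub>E {..V * n}" by (auto simp: g_def)
  qed
  have fin: "finite (g ` U)" by (rule finite_subset[OF gU]) (auto intro: finite_PiE)
  have "card N \<le> card (g ` U)" unfolding N_def by (rule card_image_le[OF fin])
  also have "\<dots> \<le> card ((UNIV :: 'v set) \<rightarrow>\<^sub>E {..V * n})" by (rule card_mono[OF _ gU]) (auto intro: finite_PiE)
  also have "\<dots> = (V * n + 1) ^ V" by (simp add: card_PiE V_def)
  finally have card: "card N \<le> (V * n + 1) ^ V" .
  have net: "\<exists>y\<in>N. dist x y \<le> 1 / real n" if x: "x \<in> U" for x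
  proof -
    define y where "y = inv_into U g (g x)"
    have y: "y \<in> U" "g y = g x" unfolding y_def using x by (auto intro: inv_into_into f_inv_into_f)
    have "\<bar>x $ v - y $ v\<bar> \<le> 1 / real (V * n)" for v
    proof -
      have nonneg: "0 \<le> real (V * n) * (x $ v)" "0 \<le> real (V * n) * (y $ v)"
        using x y U by (auto simp: prob_simplex_def)
      have "nat \<lfloor>real (V * n) * (y $ v)\<rfloor> = nat \<lfloor>real (V * n) * (x $ v)\<rfloor>"
        using fun_cong[OF y(2), of v] by (simp add: g_def)
      then have "\<lfloor>real (V * n) * (y $ v)\<rfloor> = \<lfloor>real (V * n) * (x $ v)\<rfloor>"
        using nonneg by (simp add: eq_nat_nat_iff)
      then have "\<bar>real (V * n) * (x $ v) - real (V * n) * (y $ v)\<bar> \<le> 1" by linarith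
      then have "real (V * n) * \<bar>x $ v - y $ v\<bar> \<le> 1"
        by (simp only: right_diff_distrib[symmetric] abs_mult abs_of_nat)
      then show ?thesis using V n by (simp add: field_simps)
    qed
    then have "dist x y \<le> real CARD('v) * (1 / real (V * n))"
      using dist_vec_gt_component[of "1 / real (V * n)" x y] by (meson not_le)
    also have "\<dots> = 1 / real n" using V by (simp add: V_def)
    finally show ?thesis using x unfolding N_def y_def by blast
  qed
  show thesis
  proof (rule that[of N])
    show "N \<subseteq> U" unfolding N_def by (auto intro: inv_into_into)
    show "finite N" unfolding N_def using fin by simp
  qed (use card net in \<open>auto simp: V_def\<close>)
qed

section \<open>Contraction\<close>

lemma component_polytope_subset_simplex:
  assumes "\<phi> \<in> maximal_paths G r" "\<forall>u\<in>pverts G. \<rho> u \<in> prob_simplex"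
  shows "component_polytope \<rho> \<phi> \<subseteq> (prob_simplex :: (real ^ 'v::finite) set)"
proof -
  have "convex (prob_simplex :: (real ^ 'v) set)"
    by (rule convexI) (auto simp: prob_simplex_def sum.distrib sum_distrib_left[symmetric])
  moreover have "set \<phi> \<subseteq> pverts G" using assms(1) by (simp add: maximal_paths_def vwalk_def)
  ultimately show ?thesis unfolding component_polytope_def using assms(2) by (intro hull_minimal) auto
qed

locale contraction_setting = admixture_tree G r J \<alpha>
  for G :: "'u pair_pre_digraph" and r :: 'u and J :: nat and \<alpha> :: real +
  fixes prior :: "('u, 'v::finite) param measure" and \<omega>\<^sub>0 :: "('u, 'v) param" and c\<^sub>0 c\<^sub>1 :: real
  assumes finite_verts: "finite (pverts G)"
    and prior: "prob_space prior" and sets_prior: "sets prior = sets (param_measurable_space G r)"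
    and truth: "\<omega>\<^sub>0 \<in> measure_support (param_topology G r) prior"
    and c\<^sub>0: "0 < c\<^sub>0" and c\<^sub>1: "0 < c\<^sub>1"
    and topic_ge: "\<omega> \<in> measure_support (param_topology G r) prior \<Longrightarrow> u \<in> pverts G \<Longrightarrow> c\<^sub>0 \<le> fst \<omega> u $ v"
    and weight_ge: "\<omega> \<in> measure_support (param_topology G r) prior \<Longrightarrow> \<phi> \<in> maximal_paths G r \<Longrightarrow> c\<^sub>1 \<le> snd \<omega> \<phi>"
begin

section \<open>Likelihood under the prior\<close>

sublocale prior: prob_space prior by (rule prior)

lemma support_subset: "\<omega> \<in> measure_support (param_topology G r) prior \<Longrightarrow> \<omega> \<in> param_space G r"
  by (simp add: measure_support_def topspace_param_topology)

lemma true_param: "\<omega>\<^sub>0 \<in> param_space G r"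
  by (rule support_subset[OF truth])

lemmas paths = finite_maximal_paths[OF true_param]

lemma space_prior: "space prior = param_space G r"
  using sets_eq_imp_space_eq[OF sets_prior] by (simp add: space_param_measurable_space)

lemma measurable_likelihood [measurable]: "likelihood G r J \<alpha> m X \<in> borel_measurable prior"
proof -
  have "(\<lambda>\<omega> :: ('u, 'v) param. doc_pmf G r J \<alpha> \<omega> xs) \<in> borel_measurable prior" for xs
    using measurable_doc_pmf[of xs] by (simp only: measurable_cong_sets[OF sets_prior refl])
  then show ?thesis unfolding likelihood_def[abs_def] by (rule borel_measurable_prod)
qed

lemma doc_pmf_le_1:
  assumes "\<omega> \<in> param_space G r"
  shows "doc_pmf G r J \<alpha> (\<omega> :: ('u, 'v) param) xs \<le> 1"
proof -
  have "doc_pmf G r J \<alpha> \<omega> xs \<le> (\<Sum>ys | length ys = length xs. doc_pmf G r J \<alpha> \<omega> ys)"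
    by (rule member_le_sum) (auto simp: doc_pmf_nonneg assms)
  then show ?thesis by (simp add: sum_doc_pmf_UNIV assms)
qed

lemma likelihood_le_1:
  assumes "\<omega> \<in> param_space G r"
  shows "likelihood G r J \<alpha> m X (\<omega> :: ('u, 'v) param) \<le> 1"
  unfolding likelihood_def by (intro prod_le_1 conjI doc_pmf_nonneg doc_pmf_le_1 assms)

lemma integrable_likelihood: "integrable prior (likelihood G r J \<alpha> m X)"
  by (rule prior.integrable_const_bound[where B = 1])
    (auto simp: space_prior likelihood_nonneg likelihood_le_1)

lemma posterior_mult_le:
  assumes "0 < \<kappa>" "\<kappa> * likelihood G r J \<alpha> m X \<omega>\<^sub>0 \<le> (\<integral>\<omega>. likelihood G r J \<alpha> m X \<omega> \<partial>prior)" "F \<in> sets prior"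
  shows "measure (posterior G r J \<alpha> prior m X) F * likelihood G r J \<alpha> m X \<omega>\<^sub>0
    \<le> (\<integral>\<omega>. likelihood G r J \<alpha> m X \<omega> * indicator F \<omega> \<partial>prior) / \<kappa>"
  unfolding posterior_def
  by (rule measure_density_normalized_le)
    (use assms in \<open>auto simp: space_prior likelihood_nonneg likelihood_le_1 true_param intro: prior.finite_measure_axioms\<close>)

text \<open>The integral is restricted to the neighbourhood of radius \<epsilon> =
  \<open>s / (m * n)\<close>, where the likelihood is at least a quarter of the true one.
  Independence multiplies the two prior masses, which adds the exponents \<open>k\<close> and
  \<open>l\<close>.\<close>

lemma marginal_likelihood_ge:
  assumes c: "0 < c\<^sub>2" "0 < c\<^sub>3"
    and prior_mass: "\<forall>\<^sub>F \<epsilon> in at_right 0.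
         let A = {\<omega> \<in> space prior. \<forall>u\<in>pverts G. norm (fst \<omega> u - fst \<omega>\<^sub>0 u) \<le> \<epsilon>};
             B = {\<omega> \<in> space prior. \<forall>\<phi>\<in>maximal_paths G r. \<bar>snd \<omega> \<phi> - snd \<omega>\<^sub>0 \<phi>\<bar> \<le> \<epsilon>}
         in c\<^sub>2 * \<epsilon> ^ k \<le> measure prior A \<and> c\<^sub>3 * \<epsilon> ^ l \<le> measure prior B \<and> prior.indep_event A B"
  obtains \<kappa> N where "0 < \<kappa>"
    "\<And>m n X. 0 < m \<Longrightarrow> 0 < n \<Longrightarrow> N \<le> m * n \<Longrightarrow> (\<And>j. j < m \<Longrightarrow> length (X j) = n) \<Longrightarrow>
      \<kappa> / real (m * n) ^ (k + l) * likelihood G r J \<alpha> m X \<omega>\<^sub>0 \<le> (\<integral>\<omega>. likelihood G r J \<alpha> m X \<omega> \<partial>prior)"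
proof -
  define A where "A \<epsilon> = {\<omega> \<in> space prior. \<forall>u\<in>pverts G. norm (fst \<omega> u - fst \<omega>\<^sub>0 u) \<le> \<epsilon>}" for \<epsilon>
  define B where "B \<epsilon> = {\<omega> \<in> space prior. \<forall>\<phi>\<in>maximal_paths G r. \<bar>snd \<omega> \<phi> - snd \<omega>\<^sub>0 \<phi>\<bar> \<le> \<epsilon>}" for \<epsilon>
  obtain b where b: "0 < b" and mass: "\<And>\<epsilon>. 0 < \<epsilon> \<Longrightarrow> \<epsilon> < b \<Longrightarrow>
      c\<^sub>2 * \<epsilon> ^ k \<le> measure prior (A \<epsilon>) \<and> c\<^sub>3 * \<epsilon> ^ l \<le> measure prior (B \<epsilon>) \<and> prior.indep_event (A \<epsilon>) (B \<epsilon>)"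
    using prior_mass unfolding Let_def eventually_at_right_field A_def[symmetric] B_def[symmetric] by auto
  \<comment> \<open>The total relative error is then at most 1/2 for the topics over all
    \<open>m * n\<close> words and at most 1/2 for the path weights over all \<open>m\<close>
    documents; Bernoulli's inequality gives a factor 1/2 for each.\<close>
  define s where "s = min c\<^sub>0 c\<^sub>1 / 2"
  have s: "0 < s" "s \<le> c\<^sub>0 / 2" "s \<le> c\<^sub>1 / 2" using c\<^sub>0 c\<^sub>1 by (auto simp: s_def)
  define \<kappa> where "\<kappa> = c\<^sub>2 * c\<^sub>3 * s ^ (k + l) / 4"
  have \<kappa>: "0 < \<kappa>" using c s by (simp add: \<kappa>_def)
  \<comment> \<open>Makes \<epsilon> smaller than \<open>b\<close>, so that the assumed prior mass
    bound applies.\<close>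
  obtain N :: nat where N: "s / b < real N" using reals_Archimedean2 by blast
  show thesis
  proof (rule that[OF \<kappa>, of "max 1 N"])
    fix m n :: nat and X :: "nat \<Rightarrow> 'v list"
    assume m: "0 < m" and n: "0 < n" and mn: "max 1 N \<le> m * n" and len: "\<And>j. j < m \<Longrightarrow> length (X j) = n"
    define \<epsilon> where "\<epsilon> = s / real (m * n)"
    have \<epsilon>: "0 < \<epsilon>" "\<epsilon> * real (m * n) = s" using s m n by (auto simp: \<epsilon>_def)
    have sN: "s < b * real N" using N b by (simp add: field_simps)
    have "real N \<le> real (m * n)" using mn by (simp only: of_nat_le_iff max.bounded_iff)
    then have "b * real N \<le> b * real (m * n)" using b by simp
    with sN have "s < b * real (m * n)" by linarith
    then have "\<epsilon> < b" using m n by (simp add: \<epsilon>_def field_simps)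
    note mass = mass[OF \<epsilon>(1) this]
    have AB: "A \<epsilon> \<in> sets prior" "B \<epsilon> \<in> sets prior"
      "measure prior (A \<epsilon> \<inter> B \<epsilon>) = measure prior (A \<epsilon>) * measure prior (B \<epsilon>)"
    proof -
      \<comment> \<open>Independence is unfolded because it also supplies the measurability of both
        events.\<close>
      have "prior.indep_events (case_bool (A \<epsilon>) (B \<epsilon>)) UNIV" using mass by (simp add: prior.indep_event_def)
      note ind = this[unfolded prior.indep_events_def]
      show "A \<epsilon> \<in> sets prior" "B \<epsilon> \<in> sets prior" using ind by (auto simp: UNIV_bool)
      show "measure prior (A \<epsilon> \<inter> B \<epsilon>) = measure prior (A \<epsilon>) * measure prior (B \<epsilon>)"
        using ind[THEN conjunct2, rule_format, of UNIV] by (simp add: UNIV_bool Int_commute mult.commute)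
    qed
    have small: "real (m * n) * (\<epsilon> / c\<^sub>0) \<le> 1 / 2" "real m * (\<epsilon> / c\<^sub>1) \<le> 1 / 2"
    proof -
      show "real (m * n) * (\<epsilon> / c\<^sub>0) \<le> 1 / 2" using \<epsilon>(2) s(2) c\<^sub>0 by (simp add: mult.commute field_simps)
      have "\<epsilon> * real m * 1 \<le> \<epsilon> * real m * real n" using \<epsilon>(1) n by (intro mult_left_mono) auto
      then have "real m * \<epsilon> \<le> \<epsilon> * real (m * n)" by (simp add: mult_ac)
      then show "real m * (\<epsilon> / c\<^sub>1) \<le> 1 / 2" using \<epsilon>(2) s(3) c\<^sub>1 by (simp add: field_simps)
    qed
    define t where "t = 1 - \<epsilon> / c\<^sub>0"
    define t' where "t' = 1 - \<epsilon> / c\<^sub>1"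
    have t: "0 \<le> t" "t \<le> 1" "1 / 2 \<le> t ^ (m * n)"
    proof -
      have "real 1 \<le> real (m * n)" using mn by (simp only: of_nat_le_iff max.bounded_iff)
      then have "1 * (\<epsilon> / c\<^sub>0) \<le> real (m * n) * (\<epsilon> / c\<^sub>0)" using \<epsilon> c\<^sub>0 by (intro mult_right_mono) simp_all
      then have e: "\<epsilon> / c\<^sub>0 \<le> 1 / 2" using small(1) by linarith
      then show "0 \<le> t" unfolding t_def by linarith
      show "t \<le> 1" using \<epsilon>(1) c\<^sub>0 by (simp add: t_def)
      show "1 / 2 \<le> t ^ (m * n)"
        using Bernoulli_inequality[of "- (\<epsilon> / c\<^sub>0)" "m * n"] e small(1) by (simp add: t_def)
    qed
    have t': "0 \<le> t'" "1 / 2 \<le> t' ^ m"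
    proof -
      have "1 * (\<epsilon> / c\<^sub>1) \<le> real m * (\<epsilon> / c\<^sub>1)" using m \<epsilon> c\<^sub>1 by (intro mult_right_mono) (auto simp: Suc_le_eq)
      then have e: "\<epsilon> / c\<^sub>1 \<le> 1 / 2" using small(2) by linarith
      then show "0 \<le> t'" unfolding t'_def by linarith
      show "1 / 2 \<le> t' ^ m"
        using Bernoulli_inequality[of "- (\<epsilon> / c\<^sub>1)" m] e small(2) by (simp add: t'_def)
    qed
    define l0 where "l0 = likelihood G r J \<alpha> m X \<omega>\<^sub>0"
    have l0: "0 \<le> l0" unfolding l0_def by (rule likelihood_nonneg[OF true_param])
    have lik: "l0 / 4 \<le> likelihood G r J \<alpha> m X \<omega>" if \<omega>: "\<omega> \<in> A \<epsilon> \<inter> B \<epsilon>" for \<omega>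
    proof -
      have \<omega>p: "\<omega> \<in> param_space G r" using \<omega> by (auto simp: A_def space_prior)
      have doc: "t' * t ^ n * doc_pmf G r J \<alpha> \<omega>\<^sub>0 (X j) \<le> doc_pmf G r J \<alpha> \<omega> (X j)" if "j < m" for j
        unfolding len[OF that, symmetric]
      proof (rule doc_pmf_ge_of_close[OF \<omega>p true_param t(1,2) t'(1)])
        fix u v assume u: "u \<in> pverts G"
        have "\<bar>(fst \<omega> u - fst \<omega>\<^sub>0 u) $ v\<bar> \<le> \<epsilon>"
          using \<omega> u component_le_norm_cart[of "fst \<omega> u - fst \<omega>\<^sub>0 u" v] by (auto simp: A_def intro: order_trans)
        \<comment> \<open>The lower bound \<open>c\<^sub>0\<close> on the true topics turns absolute
          into relative closeness.\<close>
        moreover have "\<epsilon> \<le> \<epsilon> / c\<^sub>0 * fst \<omega>\<^sub>0 u $ v"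
          using mult_left_mono[OF topic_ge[OF truth u, of v], of "\<epsilon> / c\<^sub>0"] \<epsilon> c\<^sub>0 by simp
        ultimately show "t * fst \<omega>\<^sub>0 u $ v \<le> fst \<omega> u $ v" unfolding t_def left_diff_distrib by simp
      next
        fix \<phi> assume \<phi>: "\<phi> \<in> maximal_paths G r"
        have "\<bar>snd \<omega> \<phi> - snd \<omega>\<^sub>0 \<phi>\<bar> \<le> \<epsilon>" using \<omega> \<phi> by (auto simp: B_def)
        moreover have "\<epsilon> \<le> \<epsilon> / c\<^sub>1 * snd \<omega>\<^sub>0 \<phi>"
          using mult_left_mono[OF weight_ge[OF truth \<phi>], of "\<epsilon> / c\<^sub>1"] \<epsilon> c\<^sub>1 by simp
        ultimately show "t' * snd \<omega>\<^sub>0 \<phi> \<le> snd \<omega> \<phi>" unfolding t'_def left_diff_distrib by simp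
      qed
      have "1 / 2 * (1 / 2) * l0 \<le> t' ^ m * t ^ (m * n) * l0"
        using t(3) t'(2) l0 by (intro mult_right_mono mult_mono) auto
      also have "\<dots> = (\<Prod>j<m. t' * t ^ n * doc_pmf G r J \<alpha> \<omega>\<^sub>0 (X j))"
        by (simp add: l0_def likelihood_def prod.distrib power_mult_distrib power_mult[symmetric] mult.commute[of m n])
      also have "\<dots> \<le> likelihood G r J \<alpha> m X \<omega>"
        unfolding likelihood_def using doc t(1) t'(1)
        by (intro prod_mono conjI mult_nonneg_nonneg doc_pmf_nonneg[OF true_param]) auto
      finally show ?thesis by simp
    qed
    have "\<kappa> / real (m * n) ^ (k + l) * l0 = (c\<^sub>2 * \<epsilon> ^ k) * (c\<^sub>3 * \<epsilon> ^ l) * (l0 / 4)"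
      by (simp add: \<kappa>_def \<epsilon>_def power_divide power_add mult_ac)
    also have "\<dots> \<le> measure prior (A \<epsilon> \<inter> B \<epsilon>) * (l0 / 4)"
      unfolding AB(3) using mass l0 c \<epsilon>(1) by (intro mult_right_mono mult_mono) auto
    also have "\<dots> = (\<integral>\<omega>. indicator (A \<epsilon> \<inter> B \<epsilon>) \<omega> * (l0 / 4) \<partial>prior)"
      using AB(1,2) by (simp add: Int_absorb2 sets.sets_into_space)
    also have "\<dots> \<le> (\<integral>\<omega>. likelihood G r J \<alpha> m X \<omega> \<partial>prior)"
    proof (rule integral_mono[OF _ integrable_likelihood])
      show "integrable prior (\<lambda>\<omega>. indicator (A \<epsilon> \<inter> B \<epsilon>) \<omega> * (l0 / 4))"
        using AB(1,2) by (intro integrable_mult_left integrable_real_indicator) (auto simp: prior.emeasure_eq_measure)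
      show "indicator (A \<epsilon> \<inter> B \<epsilon>) \<omega> * (l0 / 4) \<le> likelihood G r J \<alpha> m X \<omega>" if "\<omega> \<in> space prior" for \<omega>
        using lik[of \<omega>] likelihood_nonneg[of \<omega>] that by (auto simp: indicator_def space_prior)
    qed
    finally show "\<kappa> / real (m * n) ^ (k + l) * likelihood G r J \<alpha> m X \<omega>\<^sub>0 \<le> (\<integral>\<omega>. likelihood G r J \<alpha> m X \<omega> \<partial>prior)"
      by (simp add: l0_def)
  qed
qed

text \<open>Despite the name a union of hulls, in general not convex; \<open>union_hausdorff\<close>
  compares two such sets.\<close>

definition topic_hull :: "('u, 'v) param \<Rightarrow> (real ^ 'v) set" where
  "topic_hull \<omega> = (\<Union>\<phi>\<in>maximal_paths G r. component_polytope (fst \<omega>) \<phi>)"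

lemma topic_hull_subset: "\<omega> \<in> param_space G r \<Longrightarrow> topic_hull \<omega> \<subseteq> prob_simplex"
  unfolding topic_hull_def by (intro UN_least component_polytope_subset_simplex[where G = G and r = r]) (assumption | rule param_simplex)+

lemma topic_hull_nonempty: "topic_hull \<omega> \<noteq> {}"
proof -
  obtain \<phi> where \<phi>: "\<phi> \<in> maximal_paths G r" using paths(2) by auto
  then have "\<phi> \<noteq> []" using path_length[OF \<phi>] J by auto
  then show ?thesis using \<phi> by (auto simp: topic_hull_def component_polytope_def)
qed

text \<open>
  A data set is called good if every empirical distribution lies within \<open>\<tau>\<close> of the true union of
  polytopes and every net point of that union is approached by some document. If \<open>\<omega>\<close> is far from the
  truth, then either some net point is far from the polytopes of \<open>\<omega>\<close>, and a good data set contains a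
  document that is atypical under \<open>\<omega>\<close> (probability at most \<open>q\<close>); or some point of the polytopes of \<open>\<omega>\<close>
  is far from the true ones, and no document of a good data set comes near it (probability at most \<open>e\<close>).
\<close>

lemma posterior_far_prob_le:
  fixes m n :: nat and \<kappa> s \<epsilon> d w \<eta> :: real
  defines "P \<equiv> (\<Pi>\<^sub>M j\<in>(UNIV :: nat set). doc_measure G r J \<alpha> n \<omega>\<^sub>0)"
    and "q \<equiv> real m * (2 * real CARD('v) * exp (- 2 * real n * s\<^sup>2))"
    and "e \<equiv> exp (- (real m * (c\<^sub>1 * w)))"
  assumes n: "0 < n" and \<kappa>: "0 < \<kappa>"
    and denom: "\<And>X. (\<And>j. j < m \<Longrightarrow> length (X j) = n) \<Longrightarrow>
      \<kappa> * likelihood G r J \<alpha> m X \<omega>\<^sub>0 \<le> (\<integral>\<omega>. likelihood G r J \<alpha> m X \<omega> \<partial>prior)"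
    and near: "\<And>(\<omega> :: ('u, 'v) param) \<phi> x. \<omega> \<in> param_space G r \<Longrightarrow> \<phi> \<in> maximal_paths G r \<Longrightarrow>
       x \<in> component_polytope (fst \<omega>) \<phi> \<Longrightarrow>
       snd \<omega> \<phi> * w \<le> (\<Sum>xs | length xs = n \<and> dist (doc_freq xs) x \<le> \<epsilon> + real CARD('v) * s. doc_pmf G r J \<alpha> \<omega> xs)"
    and w: "0 \<le> w" and s: "0 \<le> s" and \<epsilon>: "1 / real n \<le> \<epsilon>" and d: "2 * \<epsilon> + 2 * real CARD('v) * s \<le> d" and \<eta>: "0 < \<eta>"
  shows "measure P {X \<in> space P. \<eta> < measure (posterior G r J \<alpha> prior m X)
            {\<omega> \<in> space prior. d < union_hausdorff G r (fst \<omega>) (fst \<omega>\<^sub>0)}}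
     \<le> q + real ((CARD('v) * n + 1) ^ CARD('v)) * e + (q + e) / (\<kappa> * \<eta>)"
proof -
  define \<tau> where "\<tau> = real CARD('v) * s"
  define F where "F = {\<omega> \<in> space prior. d < union_hausdorff G r (fst \<omega>) (fst \<omega>\<^sub>0)}"
  define post where "post X = measure (posterior G r J \<alpha> prior m X) F" for X
  define lik where "lik X \<omega> = likelihood G r J \<alpha> m X \<omega>" for X and \<omega> :: "('u, 'v) param"
  have \<epsilon>0: "0 \<le> \<epsilon>" by (rule order_trans[OF _ \<epsilon>]) simp
  have q: "0 \<le> q" and e: "0 \<le> e" by (auto simp: q_def e_def)
  interpret doc: prob_space "doc_measure G r J \<alpha> n \<omega>\<^sub>0" by (rule prob_space_doc_measure[OF true_param])
  interpret P: product_prob_space "\<lambda>_ :: nat. doc_measure G r J \<alpha> n \<omega>\<^sub>0" UNIV ..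
  interpret Pp: prob_space P unfolding P_def by (rule P.prob_space_axioms)
  define D :: "(nat \<Rightarrow> 'v list) set" where "D = {..<m} \<rightarrow>\<^sub>E docs n"
  have D_fin: "finite D" unfolding D_def by (intro finite_PiE) auto
  have lik_prod: "lik x \<omega> = (\<Prod>j<m. doc_pmf G r J \<alpha> \<omega> (x j))" for x \<omega>
    by (simp add: lik_def likelihood_def)
  obtain N where N: "N \<subseteq> topic_hull \<omega>\<^sub>0" "finite N" "card N \<le> (CARD('v) * n + 1) ^ CARD('v)"
    "\<And>x. x \<in> topic_hull \<omega>\<^sub>0 \<Longrightarrow> \<exists>y\<in>N. dist x y \<le> 1 / real n"
    using simplex_net[OF topic_hull_subset[OF true_param] n] by blast
  define Far where "Far \<omega> = {xs :: 'v list. length xs = n \<and> \<tau> < infdist (doc_freq xs) (topic_hull \<omega>)}" for \<omega>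
  define Near where "Near x = {xs :: 'v list. length xs = n \<and> dist (doc_freq xs) x \<le> \<epsilon> + \<tau>}" for x
  define SF where "SF \<omega> = {x. x \<in> D \<and> (\<exists>j<m. x j \<in> Far \<omega>)}" for \<omega>
  define SN where "SN y = {x. x \<in> D \<and> (\<forall>j<m. x j \<notin> Near y)}" for y
  define Bad where "Bad = SF \<omega>\<^sub>0 \<union> (\<Union>y\<in>N. SN y)"
  define Good where "Good = D - Bad"
  have lik_nn: "0 \<le> lik x \<omega>" if "\<omega> \<in> param_space G r" for x \<omega>
    unfolding lik_def by (rule likelihood_nonneg[OF that])
  have finS: "finite (SF \<omega>)" "finite (SN y)" for \<omega> y
    using D_fin by (simp_all add: SF_def SN_def)
  have SF: "(\<Sum>x\<in>SF \<omega>. lik x \<omega>) \<le> q" if \<omega>: "\<omega> \<in> param_space G r" for \<omega>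
    unfolding SF_def D_def q_def lik_prod
  proof (rule sum_PiE_some_le)
    show "sum (doc_pmf G r J \<alpha> \<omega>) (Far \<omega>) \<le> 2 * real CARD('v) * exp (- 2 * real n * s\<^sup>2)"
      using sum_doc_pmf_far_le[OF \<omega> s n] by (simp add: Far_def \<tau>_def topic_hull_def)
  qed (auto simp: doc_pmf_nonneg sum_doc_pmf_UNIV \<omega> Far_def)
  have SN: "(\<Sum>x\<in>SN y. lik x \<omega>) \<le> e"
    if \<omega>: "\<omega> \<in> measure_support (param_topology G r) prior" and y: "y \<in> topic_hull \<omega>" for \<omega> y
    unfolding SN_def D_def e_def lik_prod
  proof (rule sum_PiE_none_le)
    note \<omega>p = support_subset[OF \<omega>]
    obtain \<phi> where \<phi>: "\<phi> \<in> maximal_paths G r" "y \<in> component_polytope (fst \<omega>) \<phi>"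
      using y by (auto simp: topic_hull_def)
    have "c\<^sub>1 * w \<le> snd \<omega> \<phi> * w" using weight_ge[OF \<omega> \<phi>(1)] w by (rule mult_right_mono)
    also have "\<dots> \<le> sum (doc_pmf G r J \<alpha> \<omega>) (Near y)"
      using near[OF \<omega>p \<phi>] by (simp add: Near_def \<tau>_def)
    finally show "c\<^sub>1 * w \<le> sum (doc_pmf G r J \<alpha> \<omega>) (Near y)" .
  qed (auto simp: doc_pmf_nonneg sum_doc_pmf_UNIV support_subset[OF \<omega>] Near_def)
  have Bad: "(\<Sum>x\<in>Bad. lik x \<omega>\<^sub>0) \<le> q + real ((CARD('v) * n + 1) ^ CARD('v)) * e"
  proof -
    have "(\<Sum>x\<in>Bad. lik x \<omega>\<^sub>0) \<le> (\<Sum>x\<in>SF \<omega>\<^sub>0. lik x \<omega>\<^sub>0) + (\<Sum>x\<in>(\<Union>y\<in>N. SN y). lik x \<omega>\<^sub>0)"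
      unfolding Bad_def using finS N(2) by (simp add: sum_Un sum_nonneg lik_nn true_param)
    also have "(\<Sum>x\<in>(\<Union>y\<in>N. SN y). lik x \<omega>\<^sub>0) \<le> (\<Sum>y\<in>N. \<Sum>x\<in>SN y. lik x \<omega>\<^sub>0)"
      by (rule sum_UN_le) (auto simp: finS N(2) lik_nn true_param)
    also have "\<dots> \<le> (\<Sum>y\<in>N. e)"
      by (rule sum_mono) (use SN[OF truth] N(1) in blast)
    also have "\<dots> = real (card N) * e" by simp
    also have "\<dots> \<le> real ((CARD('v) * n + 1) ^ CARD('v)) * e"
      using N(3) e by (intro mult_right_mono) (simp_all only: of_nat_le_iff)
    finally show ?thesis using SF[OF true_param] by linarith
  qed
  have Good: "(\<Sum>x\<in>Good. lik x \<omega>) \<le> q + e"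
    if \<omega>: "\<omega> \<in> measure_support (param_topology G r) prior" and F: "\<omega> \<in> F" for \<omega>
  proof -
    note \<omega>p = support_subset[OF \<omega>]
    have "d < hausdorff_dist (topic_hull \<omega>) (topic_hull \<omega>\<^sub>0)"
      using F by (simp add: F_def union_hausdorff_def topic_hull_def)
    then show ?thesis
    proof (rule hausdorff_dist_gtE[OF _ topic_hull_nonempty topic_hull_nonempty])
      fix a assume a: "a \<in> topic_hull \<omega>" "d < infdist a (topic_hull \<omega>\<^sub>0)"
      have "Good \<subseteq> SN a"
      proof
        fix x assume x: "x \<in> Good"
        \<comment> \<open>A document near \<open>a\<close> and typical for the truth would place
          \<open>a\<close> within \<epsilon> + 2 * \<tau>, hence within \<open>d\<close>, of the
          true union.\<close>
        have "x j \<notin> Near a" if j: "j < m" for j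
        proof
          assume "x j \<in> Near a"
          then have le: "dist (doc_freq (x j)) a \<le> \<epsilon> + \<tau>" and len: "length (x j) = n" by (auto simp: Near_def)
          have "x j \<notin> Far \<omega>\<^sub>0" using x j by (auto simp: Good_def Bad_def SF_def)
          then have "infdist (doc_freq (x j)) (topic_hull \<omega>\<^sub>0) \<le> \<tau>" using len by (auto simp: Far_def)
          moreover have "infdist a (topic_hull \<omega>\<^sub>0) \<le> infdist (doc_freq (x j)) (topic_hull \<omega>\<^sub>0) + dist a (doc_freq (x j))"
            by (rule infdist_triangle)
          ultimately show False using a(2) le d \<epsilon>0 by (simp add: \<tau>_def dist_commute)
        qed
        then show "x \<in> SN a" using x by (simp add: SN_def Good_def)
      qed
      then have "(\<Sum>x\<in>Good. lik x \<omega>) \<le> (\<Sum>x\<in>SN a. lik x \<omega>)"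
        by (intro sum_mono2) (auto simp: finS lik_nn \<omega>p)
      also have "\<dots> \<le> e" by (rule SN[OF \<omega> a(1)])
      finally show ?thesis using q by simp
    next
      fix b assume b: "b \<in> topic_hull \<omega>\<^sub>0" "d < infdist b (topic_hull \<omega>)"
      obtain y where y: "y \<in> N" "dist b y \<le> 1 / real n" using N(4)[OF b(1)] by blast
      have "Good \<subseteq> SF \<omega>"
      proof
        fix x assume x: "x \<in> Good"
        then have "x \<in> D" "x \<notin> SN y" using y(1) by (auto simp: Good_def Bad_def)
        then obtain j where j: "j < m" "x j \<in> Near y" by (auto simp: SN_def)
        have len: "length (x j) = n" and le: "dist (doc_freq (x j)) y \<le> \<epsilon> + \<tau>"
          using j(2) by (auto simp: Near_def)
        \<comment> \<open>From \<open>b\<close> to the net point is at most \<epsilon>, from there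
          to the document at most \<epsilon> + \<tau>; of the distance \<open>d\<close> more than
          \<tau> must remain between the document and the union of \<omega>.\<close>
        have "infdist b (topic_hull \<omega>) \<le> infdist (doc_freq (x j)) (topic_hull \<omega>) + dist b (doc_freq (x j))"
          by (rule infdist_triangle)
        moreover have "dist b (doc_freq (x j)) \<le> dist b y + dist y (doc_freq (x j))" by (rule dist_triangle)
        ultimately have "\<tau> < infdist (doc_freq (x j)) (topic_hull \<omega>)"
          using b(2) y(2) le d \<epsilon> by (simp add: \<tau>_def dist_commute)
        then show "x \<in> SF \<omega>" using j(1) len \<open>x \<in> D\<close> by (auto simp: SF_def Far_def)
      qed
      then have "(\<Sum>x\<in>Good. lik x \<omega>) \<le> (\<Sum>x\<in>SF \<omega>. lik x \<omega>)"
        by (intro sum_mono2) (auto simp: finS lik_nn \<omega>p)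
      also have "\<dots> \<le> q" by (rule SF[OF \<omega>p])
      finally show ?thesis using e by simp
    qed
  qed
  show ?thesis
  \<comment> \<open>A non-measurable far set has the default posterior measure 0, below \<eta>, so
    this case is immediate.\<close>
  proof (cases "F \<in> sets prior")
    case False
    then have "post X = 0" for X
      unfolding post_def by (intro measure_notin_sets) (simp add: posterior_def)
    then have "{X \<in> space P. \<eta> < post X} = {}" using \<eta> by simp
    then have "measure P {X \<in> space P. \<eta> < post X} = 0" by (simp only: measure_empty)
    moreover have "0 \<le> q + real ((CARD('v) * n + 1) ^ CARD('v)) * e + (q + e) / (\<kappa> * \<eta>)"
      using q e \<kappa> \<eta> by (intro add_nonneg_nonneg divide_nonneg_nonneg mult_nonneg_nonneg) simp_all
    ultimately show ?thesis unfolding post_def F_def by linarith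
  next
    case F: True
    define S where "S = Bad \<union> {x \<in> Good. \<eta> < post x}"
    have SD: "S \<subseteq> D" by (auto simp: S_def Bad_def Good_def SF_def SN_def)
    have GoodD: "Good \<subseteq> D" by (auto simp: Good_def)
    have fin: "finite Bad" "finite Good" using finS N(2) D_fin by (auto simp: Bad_def Good_def)
    \<comment> \<open>After Bayes' formula and the exchange of sum and integral, the integrand is at
      most \<open>q + e\<close> for almost every parameter: inside \<open>F\<close> by
      \<open>Good\<close>, which needs membership in the support, and outside \<open>F\<close>
      because it vanishes.\<close>
    have markov: "(\<Sum>x\<in>Good. post x * lik x \<omega>\<^sub>0) \<le> (q + e) / \<kappa>"
    proof -
      have int: "integrable prior (\<lambda>\<omega>. lik x \<omega> * indicator F \<omega>)" for x
        using integrable_mult_indicator[OF F integrable_likelihood[of m x]] by (simp add: lik_def mult.commute)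
      have "(\<Sum>x\<in>Good. post x * lik x \<omega>\<^sub>0) \<le> (\<Sum>x\<in>Good. (\<integral>\<omega>. lik x \<omega> * indicator F \<omega> \<partial>prior) / \<kappa>)"
      proof (rule sum_mono)
        fix x assume "x \<in> Good"
        then have "length (x j) = n" if "j < m" for j
          using GoodD that by (auto simp: D_def)
        then show "post x * lik x \<omega>\<^sub>0 \<le> (\<integral>\<omega>. lik x \<omega> * indicator F \<omega> \<partial>prior) / \<kappa>"
          unfolding post_def lik_def by (intro posterior_mult_le[OF \<kappa> denom F])
      qed
      also have "\<dots> = (\<integral>\<omega>. (\<Sum>x\<in>Good. lik x \<omega> * indicator F \<omega>) \<partial>prior) / \<kappa>"
        using int by (simp add: sum_divide_distrib[symmetric])
      also have "(\<integral>\<omega>. (\<Sum>x\<in>Good. lik x \<omega> * indicator F \<omega>) \<partial>prior) \<le> q + e"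
      proof (rule prior.integral_le_const)
        show "integrable prior (\<lambda>\<omega>. \<Sum>x\<in>Good. lik x \<omega> * indicator F \<omega>)"
          using int by (rule Bochner_Integration.integrable_sum)
        show "AE \<omega> in prior. (\<Sum>x\<in>Good. lik x \<omega> * indicator F \<omega>) \<le> q + e"
          using AE_measure_support[OF finite_verts paths(1) sets_prior]
          by eventually_elim (use Good q e in \<open>auto simp: indicator_def\<close>)
      qed
      finally show ?thesis using \<kappa> by (simp add: divide_right_mono)
    qed
    have "{X \<in> space P. \<eta> < post X} \<subseteq> {X \<in> space P. restrict X {..<m} \<in> S}"
    proof
      fix X assume "X \<in> {X \<in> space P. \<eta> < post X}"
      then have X: "X \<in> space P" "\<eta> < post X" by auto
      have "restrict X {..<m} \<in> D"
        using X(1) by (auto simp: D_def P_def space_PiM doc_measure_def space_point_measure)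
      moreover have "post (restrict X {..<m}) = post X" by (simp only: post_def posterior_restrict)
      ultimately show "X \<in> {X \<in> space P. restrict X {..<m} \<in> S}" using X by (auto simp: S_def Good_def)
    qed
    then have "measure P {X \<in> space P. \<eta> < post X} \<le> measure P {X \<in> space P. restrict X {..<m} \<in> S}"
      using measure_data_PiM(1)[OF true_param SD[unfolded D_def]]
      by (intro Pp.finite_measure_mono) (simp_all add: P_def)
    also have "\<dots> = (\<Sum>x\<in>S. lik x \<omega>\<^sub>0)"
      unfolding lik_def P_def by (rule measure_data_PiM(2)[OF true_param SD[unfolded D_def]])
    also have "\<dots> \<le> (\<Sum>x\<in>Bad. lik x \<omega>\<^sub>0) + (\<Sum>x\<in>{x \<in> Good. \<eta> < post x}. lik x \<omega>\<^sub>0)"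
      unfolding S_def using fin by (simp add: sum_Un sum_nonneg lik_nn true_param)
    also have "(\<Sum>x\<in>{x \<in> Good. \<eta> < post x}. lik x \<omega>\<^sub>0) \<le> (\<Sum>x\<in>{x \<in> Good. \<eta> < post x}. post x * lik x \<omega>\<^sub>0 / \<eta>)"
    proof (rule sum_mono)
      fix x assume "x \<in> {x \<in> Good. \<eta> < post x}"
      then have "\<eta> * lik x \<omega>\<^sub>0 \<le> post x * lik x \<omega>\<^sub>0" by (intro mult_right_mono lik_nn true_param) auto
      then show "lik x \<omega>\<^sub>0 \<le> post x * lik x \<omega>\<^sub>0 / \<eta>" using \<eta> by (simp add: field_simps)
    qed
    also have "\<dots> \<le> (\<Sum>x\<in>Good. post x * lik x \<omega>\<^sub>0 / \<eta>)"
      using \<eta> fin by (intro sum_mono2) (auto simp: post_def lik_nn true_param)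
    also have "\<dots> \<le> (q + e) / \<kappa> / \<eta>"
      using divide_right_mono[OF markov, of \<eta>] \<eta> by (simp only: sum_divide_distrib less_imp_le)
    finally show ?thesis using Bad by (simp add: post_def F_def)
  qed
qed

section \<open>Choice of radii and explicit rate\<close>

lemma union_hausdorff_le_2:
  assumes \<omega>: "\<omega> \<in> param_space G r"
  shows "union_hausdorff G r (fst \<omega>) (fst \<omega>\<^sub>0) \<le> 2"
proof (rule ccontr)
  have small: "infdist a (topic_hull \<omega>2) \<le> 2"
    if "\<omega>1 \<in> param_space G r" "\<omega>2 \<in> param_space G r" "a \<in> topic_hull \<omega>1" for a \<omega>1 \<omega>2
  proof -
    obtain b where b: "b \<in> topic_hull \<omega>2" using topic_hull_nonempty by blast
    have "infdist a (topic_hull \<omega>2) \<le> dist a b" by (rule infdist_le[OF b])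
    also have "\<dots> \<le> norm a + norm b" by (simp add: dist_norm norm_triangle_ineq4)
    also have "\<dots> \<le> 1 + 1"
      using topic_hull_subset[OF that(1)] topic_hull_subset[OF that(2)] that(3) b
      by (intro add_mono norm_prob_simplex_le_1) auto
    finally show ?thesis by simp
  qed
  assume "\<not> ?thesis"
  then have "2 < hausdorff_dist (topic_hull \<omega>) (topic_hull \<omega>\<^sub>0)"
    by (simp add: union_hausdorff_def topic_hull_def)
  then show False
    by (rule hausdorff_dist_gtE[OF _ topic_hull_nonempty topic_hull_nonempty])
      (use small \<omega> true_param in \<open>fastforce simp: not_less[symmetric]\<close>)+
qed

text \<open>With \<open>l = max m n\<close>, the value of \<open>M\<close> is a budget of powers of
  \<open>l\<close>: the prior mass costs at most \<open>l ^ (2 * D)\<close> since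
  \<open>m * n \<le> l\<^sup>2\<close>, the net about \<open>l ^ CARD('v)\<close>, the union over
  the documents one factor \<open>l\<close>, and one more factor remains for the
  convergence.\<close>

lemma posterior_far_prob_le_inverse:
  fixes m n D N M :: nat and \<kappa> c \<eta> :: real
  assumes J2: "2 \<le> J" and c: "0 < c" and \<kappa>: "0 < \<kappa>" and \<eta>: "0 < \<eta>"
    and near: "\<And>(\<omega> :: ('u, 'v) param) \<phi> x \<epsilon> s n. \<omega> \<in> param_space G r \<Longrightarrow> \<phi> \<in> maximal_paths G r \<Longrightarrow>
       x \<in> component_polytope (fst \<omega>) \<phi> \<Longrightarrow> 0 < \<epsilon> \<Longrightarrow> \<epsilon> \<le> 1 \<Longrightarrow> 0 \<le> s \<Longrightarrow> 0 < n \<Longrightarrow>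
       2 * real CARD('v) * exp (- 2 * real n * s\<^sup>2) \<le> 1 / 2 \<Longrightarrow>
       snd \<omega> \<phi> * (c * \<epsilon> powr (max 1 \<alpha> * real J - 1)) \<le>
       (\<Sum>xs | length xs = n \<and> dist (doc_freq xs) x \<le> \<epsilon> + real CARD('v) * s. doc_pmf G r J \<alpha> \<omega> xs)"
    and denom: "\<And>X. (\<And>j. j < m \<Longrightarrow> length (X j) = n) \<Longrightarrow>
      \<kappa> / real (m * n) ^ D * likelihood G r J \<alpha> m X \<omega>\<^sub>0 \<le> (\<integral>\<omega>. likelihood G r J \<alpha> m X \<omega> \<partial>prior)"
    and M: "M = 2 * D + CARD('v) + 2"
    and m: "0 < m" and n: "0 < n"
    and L: "1 \<le> ln (real (max m n))" "4 * CARD('v) \<le> max m n"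
    and growth: "(real M / (c\<^sub>1 * c))\<^sup>2 * ln (real (max m n)) \<le> real m"
  shows "measure (\<Pi>\<^sub>M j\<in>(UNIV :: nat set). doc_measure G r J \<alpha> n \<omega>\<^sub>0)
      {X \<in> space (\<Pi>\<^sub>M j\<in>(UNIV :: nat set). doc_measure G r J \<alpha> n \<omega>\<^sub>0).
        \<eta> < measure (posterior G r J \<alpha> prior m X)
          {\<omega> \<in> space prior. (2 + 2 * real CARD('v) * sqrt (real M / 2)) * contraction_rate J \<alpha> m n
             < union_hausdorff G r (fst \<omega>) (fst \<omega>\<^sub>0)}}
    \<le> (2 * real CARD('v) + (real CARD('v) + 1) ^ CARD('v) + (2 * real CARD('v) + 1) / (\<kappa> * \<eta>)) / real (max m n)"
    (is "measure ?P _ \<le> ?K / _")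
proof -
  define V where "V = real CARD('v)"
  define l where "l = real (max m n)"
  define b where "b = max 1 \<alpha> * real J - 1"
  define y where "y = ln l * (1 / real m + 1 / real n)"
  define \<epsilon> where "\<epsilon> = contraction_rate J \<alpha> m n"
  \<comment> \<open>From the requirement
    \<open>2 * \<epsilon> + 2 * V * s \<le> C * \<epsilon>\<close> together with
    \<open>s \<le> sqrt (real M / 2) * \<epsilon>\<close>.\<close>
  define C where "C = 2 + 2 * V * sqrt (real M / 2)"
  have V: "1 \<le> V" by (simp add: V_def Suc_le_eq)
  have l: "1 \<le> ln l" "4 * V \<le> l" "1 \<le> l" "real m \<le> l" "real n \<le> l"
  proof -
    show "1 \<le> ln l" using L(1) by (simp add: l_def)
    have "real (4 * CARD('v)) \<le> real (max m n)" using L(2) by (simp only: of_nat_le_iff)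
    then show "4 * V \<le> l" by (simp add: l_def V_def)
    then show "1 \<le> l" using V by linarith
    show "real m \<le> l" "real n \<le> l" by (simp_all add: l_def)
  qed
  have b: "1 \<le> b"
  proof -
    have "1 * 2 \<le> max 1 \<alpha> * real J" using J2 by (intro mult_mono) auto
    then show ?thesis by (simp add: b_def)
  qed
  have y: "ln l / real n \<le> y" "ln l / real m \<le> y" "1 / real n \<le> y" "0 < y"
  proof -
    have "0 \<le> ln l / real n" "0 \<le> ln l / real m" using l by simp_all
    then show 1: "ln l / real n \<le> y" "ln l / real m \<le> y" by (simp_all add: y_def distrib_left)
    have "1 / real n \<le> ln l / real n" using l(1) n by (simp add: divide_right_mono)
    then show "1 / real n \<le> y" using 1 by linarith
    then show "0 < y" using n by (auto intro: less_le_trans[of _ "1 / real n"])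
  qed
  have \<epsilon>_eq: "\<epsilon> = y powr (1 / (2 * b))"
    by (simp add: \<epsilon>_def contraction_rate_def y_def b_def l_def)
  have C: "2 \<le> C" using V by (simp add: C_def)
  have K: "0 \<le> ?K" using \<kappa> \<eta> by (intro add_nonneg_nonneg divide_nonneg_nonneg) auto
  show ?thesis
  proof (cases "y \<le> 1")
    case False
    \<comment> \<open>The radius \<open>C * \<epsilon>\<close> then is at least 2, the largest
      possible distance, and no parameter is far.\<close>
    then have "1 \<le> \<epsilon>" unfolding \<epsilon>_eq using b by (intro ge_one_powr_ge_zero) auto
    then have "2 * 1 \<le> C * \<epsilon>" using C by (intro mult_mono) auto
    then have empty: "{\<omega> \<in> space prior. C * \<epsilon> < union_hausdorff G r (fst \<omega>) (fst \<omega>\<^sub>0)} = {}"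
      using union_hausdorff_le_2 by (fastforce simp: space_prior)
    have "measure ?P {X \<in> space ?P. \<eta> < measure (posterior G r J \<alpha> prior m X)
          {\<omega> \<in> space prior. C * \<epsilon> < union_hausdorff G r (fst \<omega>) (fst \<omega>\<^sub>0)}} = 0"
      unfolding empty using \<eta> by simp
    then show ?thesis using K unfolding C_def V_def \<epsilon>_def by simp
  next
    case True
    have \<epsilon>: "0 < \<epsilon>" "\<epsilon> \<le> 1" "sqrt y \<le> \<epsilon>" "\<epsilon> powr b = sqrt y"
    proof -
      show "0 < \<epsilon>" using y(4) by (simp add: \<epsilon>_eq)
      show "\<epsilon> \<le> 1" unfolding \<epsilon>_eq using True y(4) b by (intro powr_le1) auto
      have "sqrt y = y powr (1 / 2)" using y(4) by (simp add: powr_half_sqrt)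
      \<comment> \<open>For \<open>y \<le> 1\<close> a smaller exponent gives a larger power, and
        \<open>1 / (2 * b) \<le> 1 / 2\<close>.\<close>
      also have "\<dots> \<le> \<epsilon>" unfolding \<epsilon>_eq using True y(4) b by (intro powr_mono') (auto simp: field_simps)
      finally show "sqrt y \<le> \<epsilon>" .
      show "\<epsilon> powr b = sqrt y"
        using y(4) b by (simp add: \<epsilon>_eq powr_powr powr_half_sqrt)
    qed
    \<comment> \<open>Chosen so that the Hoeffding bound
      \<open>exp (- 2 * real n * s\<^sup>2)\<close> equals \<open>1 / l ^ M\<close>.\<close>
    define s where "s = sqrt (real M / 2 * (ln l / real n))"
    have lnn: "0 \<le> ln l / real n" using l by simp
    have s: "0 \<le> s" "s\<^sup>2 = real M / 2 * (ln l / real n)" "s \<le> sqrt (real M / 2) * \<epsilon>"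
    proof -
      have nn: "0 \<le> real M / 2 * (ln l / real n)" using lnn by (intro mult_nonneg_nonneg) auto
      show "0 \<le> s" unfolding s_def by (rule real_sqrt_ge_zero[OF nn])
      show "s\<^sup>2 = real M / 2 * (ln l / real n)" unfolding s_def by (rule real_sqrt_pow2[OF nn])
      have "s \<le> sqrt (real M / 2) * sqrt y"
        unfolding s_def real_sqrt_mult[symmetric] using y(1) by (intro real_sqrt_le_mono mult_left_mono) auto
      also have "\<dots> \<le> sqrt (real M / 2) * \<epsilon>" using \<epsilon>(3) by (intro mult_left_mono) auto
      finally show "s \<le> sqrt (real M / 2) * \<epsilon>" .
    qed
    have pow: "exp (- (real M * ln l)) = 1 / l ^ M"
      using l(3) by (simp add: exp_minus exp_of_nat_mult inverse_eq_divide)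
    have exp_s: "exp (- 2 * real n * s\<^sup>2) = 1 / l ^ M"
      unfolding pow[symmetric] s(2) using n by simp
    have l_pow: "l \<le> l ^ M" using l(3) power_increasing[of 1 M l] by (simp add: M)
    have tail: "2 * V * exp (- 2 * real n * s\<^sup>2) \<le> 1 / 2"
      unfolding exp_s using l l_pow V by (simp add: field_simps)
    define w where "w = c * \<epsilon> powr b"
    have w0: "0 \<le> w" using c by (simp add: w_def)
    define e where "e = exp (- (real m * (c\<^sub>1 * w)))"
    define q where "q = real m * (2 * V * exp (- 2 * real n * s\<^sup>2))"
    \<comment> \<open>The probability of hitting a ball is at least
      \<open>c\<^sub>1 * c * sqrt y\<close>. By \<open>growth\<close>,
      \<open>m * sqrt y \<ge> sqrt (m * ln l)\<close> is at least
      \<open>M / (c\<^sub>1 * c) * ln l\<close>, which is verified after squaring; missing the ball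
      \<open>m\<close> times then costs \<open>exp (- (M * ln l))\<close>.\<close>
    have e: "e \<le> 1 / l ^ M"
    proof -
      have "real M / (c\<^sub>1 * c) * ln l \<le> real m * sqrt y"
      proof (rule power2_le_imp_le)
        have "(real M / (c\<^sub>1 * c) * ln l)\<^sup>2 = ((real M / (c\<^sub>1 * c))\<^sup>2 * ln l) * ln l"
          by (simp only: power_mult_distrib power2_eq_square mult_ac)
        also have "\<dots> \<le> real m * ln l"
          using growth l(1) by (intro mult_right_mono) (simp_all add: l_def)
        also have "\<dots> = (real m)\<^sup>2 * (ln l / real m)" using m by (simp add: power2_eq_square)
        also have "\<dots> \<le> (real m)\<^sup>2 * y" using y(2) by (intro mult_left_mono) auto
        also have "\<dots> = (real m * sqrt y)\<^sup>2" using y(4) by (simp add: power_mult_distrib)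
        finally show "(real M / (c\<^sub>1 * c) * ln l)\<^sup>2 \<le> (real m * sqrt y)\<^sup>2" .
      qed (use y(4) in simp)
      then have "(c\<^sub>1 * c) * (real M / (c\<^sub>1 * c) * ln l) \<le> (c\<^sub>1 * c) * (real m * sqrt y)"
        using c c\<^sub>1 by (intro mult_left_mono) auto
      then have "real M * ln l \<le> real m * (c\<^sub>1 * w)"
        using c c\<^sub>1 by (simp add: w_def \<epsilon>(4) mult_ac)
      then show ?thesis unfolding e_def pow[symmetric] by simp
    qed
    have q: "q \<le> 2 * V / l ^ (2 * D + CARD('v) + 1)"
    proof -
      have "q \<le> l * (2 * V * (1 / l ^ M))"
        unfolding q_def exp_s using l V by (intro mult_right_mono) auto
      also have "l ^ M = l * l ^ (2 * D + CARD('v) + 1)" by (simp add: M)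
      also have "l * (2 * V * (1 / (l * l ^ (2 * D + CARD('v) + 1)))) = 2 * V / l ^ (2 * D + CARD('v) + 1)"
        using l(3) by simp
      finally show ?thesis .
    qed
    have mn: "0 < real (m * n)" using m n by simp
    have main: "measure ?P {X \<in> space ?P. \<eta> < measure (posterior G r J \<alpha> prior m X)
          {\<omega> \<in> space prior. C * \<epsilon> < union_hausdorff G r (fst \<omega>) (fst \<omega>\<^sub>0)}}
       \<le> q + real ((CARD('v) * n + 1) ^ CARD('v)) * e + (q + e) / (\<kappa> / real (m * n) ^ D * \<eta>)"
      unfolding q_def e_def V_def
    proof (rule posterior_far_prob_le[OF n _ denom _ w0 s(1) _ _ \<eta>])
      show "0 < \<kappa> / real (m * n) ^ D" using \<kappa> mn by simp
      show "snd \<omega> \<phi> * w \<le> (\<Sum>xs | length xs = n \<and> dist (doc_freq xs) x \<le> \<epsilon> + real CARD('v) * s. doc_pmf G r J \<alpha> \<omega> xs)"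
        if "\<omega> \<in> param_space G r" "\<phi> \<in> maximal_paths G r" "x \<in> component_polytope (fst \<omega>) \<phi>"
        for \<omega> :: "('u, 'v) param" and \<phi> x
        unfolding w_def b_def by (rule near[OF that \<epsilon>(1,2) s(1) n tail[unfolded V_def]])
      \<comment> \<open>The mesh \<open>1 / n\<close> of the net is finer than the rate.\<close>
      have "1 / real n \<le> sqrt (1 / real n)"
        using n by (intro real_le_rsqrt) (simp add: power2_eq_square field_simps)
      also have "\<dots> \<le> sqrt y" using y(3) by simp
      finally show "1 / real n \<le> \<epsilon>" using \<epsilon>(3) by simp
      have "2 * V * s \<le> 2 * V * (sqrt (real M / 2) * \<epsilon>)" using s(3) V by (intro mult_left_mono) auto
      then show "2 * \<epsilon> + 2 * real CARD('v) * s \<le> C * \<epsilon>" by (simp add: C_def V_def algebra_simps)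
    qed
    have t1: "q \<le> 2 * V / l"
    proof -
      have "l \<le> l ^ (2 * D + CARD('v) + 1)" using l(3) power_increasing[of 1 "2 * D + CARD('v) + 1" l] by simp
      then have "2 * V / l ^ (2 * D + CARD('v) + 1) \<le> 2 * V / l" using l(3) V by (intro divide_left_mono) auto
      then show ?thesis using q by simp
    qed
    have t2: "real ((CARD('v) * n + 1) ^ CARD('v)) * e \<le> (V + 1) ^ CARD('v) / l"
    proof -
      have "real ((CARD('v) * n + 1) ^ CARD('v)) = (V * real n + 1) ^ CARD('v)" by (simp add: V_def add.commute)
      also have "\<dots> \<le> ((V + 1) * l) ^ CARD('v)"
      proof (rule power_mono)
        have "V * real n \<le> V * l" using l V by (intro mult_left_mono) auto
        then show "V * real n + 1 \<le> (V + 1) * l" using l(3) by (simp add: distrib_right)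
      qed (use V in simp)
      finally have "real ((CARD('v) * n + 1) ^ CARD('v)) * e \<le> ((V + 1) * l) ^ CARD('v) * (1 / l ^ M)"
        using e V l(3) by (intro mult_mono) (auto simp: e_def)
      also have "\<dots> = (V + 1) ^ CARD('v) / l ^ (2 * D + 2)"
        using l(3) by (simp add: M power_mult_distrib power_add)
      also have "\<dots> \<le> (V + 1) ^ CARD('v) / l"
        using l(3) V power_increasing[of 1 "2 * D + 2" l] by (intro divide_left_mono) auto
      finally show ?thesis .
    qed
    \<comment> \<open>The small normalising factor \<open>\<kappa> / real (m * n) ^ D\<close>
      absorbs up to \<open>l ^ (2 * D)\<close>; the bound on \<open>q + e\<close> still has one
      power of \<open>l\<close> to spare.\<close>
    have t3: "(q + e) / (\<kappa> / real (m * n) ^ D * \<eta>) \<le> (2 * V + 1) / (\<kappa> * \<eta>) / l"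
    proof -
      have "e \<le> 1 / l ^ (2 * D + CARD('v) + 1)"
        using e l(3) power_increasing[of "2 * D + CARD('v) + 1" M l]
        by (intro order_trans[OF e] divide_left_mono) (auto simp: M)
      with q have "q + e \<le> (2 * V + 1) / l ^ (2 * D + CARD('v) + 1)" by (simp add: add_divide_distrib)
      also have "\<dots> \<le> (2 * V + 1) / l ^ (2 * D + 1)"
        using l(3) V power_increasing[of "2 * D + 1" "2 * D + CARD('v) + 1" l] by (intro divide_left_mono) auto
      finally have 1: "q + e \<le> (2 * V + 1) / l ^ (2 * D + 1)" .
      have 2: "real (m * n) ^ D \<le> l ^ (2 * D)"
      proof -
        have "real (m * n) \<le> l * l" using l m n by (simp add: mult_mono)
        then have "real (m * n) ^ D \<le> (l * l) ^ D" using mn by (intro power_mono) auto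
        then show ?thesis by (simp add: power_mult power2_eq_square)
      qed
      have "(q + e) / (\<kappa> / real (m * n) ^ D * \<eta>) = (q + e) * real (m * n) ^ D / (\<kappa> * \<eta>)"
        using mn by (simp add: field_simps)
      also have "\<dots> \<le> ((2 * V + 1) / l ^ (2 * D + 1)) * l ^ (2 * D) / (\<kappa> * \<eta>)"
        using 1 2 \<kappa> \<eta> V l(3) by (intro divide_right_mono mult_mono) auto
      also have "(2 * V + 1) / l ^ (2 * D + 1) * l ^ (2 * D) = (2 * V + 1) / l"
        using l(3) by simp
      also have "(2 * V + 1) / l / (\<kappa> * \<eta>) = (2 * V + 1) / (\<kappa> * \<eta>) / l"
        by (simp only: divide_divide_eq_left mult.commute)
      finally show ?thesis .
    qed
    have "?K / real (max m n) = 2 * V / l + (V + 1) ^ CARD('v) / l + (2 * V + 1) / (\<kappa> * \<eta>) / l"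
      by (simp add: V_def l_def add_divide_distrib)
    then show ?thesis using main t1 t2 t3 unfolding C_def V_def \<epsilon>_def by linarith
  qed
qed

text \<open>\<open>C\<close> depends only on \<open>k + l\<close> and the vocabulary size through
  \<open>M\<close>, so it is fixed before the sequences and before \<eta>. The numerical side
  conditions of the explicit bound hold eventually along any admissible sequences.\<close>

lemma posterior_contraction:
  assumes J2: "2 \<le> J" and c: "0 < c\<^sub>2" "0 < c\<^sub>3"
    and prior_mass: "\<forall>\<^sub>F \<epsilon> in at_right 0.
         let A = {\<omega> \<in> space prior. \<forall>u\<in>pverts G. norm (fst \<omega> u - fst \<omega>\<^sub>0 u) \<le> \<epsilon>};
             B = {\<omega> \<in> space prior. \<forall>\<phi>\<in>maximal_paths G r. \<bar>snd \<omega> \<phi> - snd \<omega>\<^sub>0 \<phi>\<bar> \<le> \<epsilon>}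
         in c\<^sub>2 * \<epsilon> ^ k \<le> measure prior A \<and> c\<^sub>3 * \<epsilon> ^ l \<le> measure prior B \<and> prior.indep_event A B"
  shows "\<exists>C>0. \<forall>m n :: nat \<Rightarrow> nat.
    filterlim m at_top sequentially \<longrightarrow> filterlim n at_top sequentially \<longrightarrow>
    (\<lambda>i. ln (real (n i))) \<in> o(\<lambda>i. real (m i)) \<longrightarrow>
    (\<forall>\<eta>>0. (\<lambda>i.
       let P = (\<Pi>\<^sub>M j\<in>(UNIV :: nat set). doc_measure G r J \<alpha> (n i) \<omega>\<^sub>0)
       in measure P {X \<in> space P.
            \<eta> < measure (posterior G r J \<alpha> prior (m i) X)
                  {\<omega> \<in> space prior.
                     C * contraction_rate J \<alpha> (m i) (n i) < union_hausdorff G r (fst \<omega>) (fst \<omega>\<^sub>0)}})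
       \<longlonglongrightarrow> 0)"
proof -
  obtain c where c0: "0 < c" and near: "\<And>(\<omega> :: ('u, 'v) param) \<phi> x \<epsilon> s n. \<omega> \<in> param_space G r \<Longrightarrow> \<phi> \<in> maximal_paths G r \<Longrightarrow>
       x \<in> component_polytope (fst \<omega>) \<phi> \<Longrightarrow> 0 < \<epsilon> \<Longrightarrow> \<epsilon> \<le> 1 \<Longrightarrow> 0 \<le> s \<Longrightarrow> 0 < n \<Longrightarrow>
       2 * real CARD('v) * exp (- 2 * real n * s\<^sup>2) \<le> 1 / 2 \<Longrightarrow>
       snd \<omega> \<phi> * (c * \<epsilon> powr (max 1 \<alpha> * real J - 1)) \<le>
       (\<Sum>xs | length xs = n \<and> dist (doc_freq xs) x \<le> \<epsilon> + real CARD('v) * s. doc_pmf G r J \<alpha> \<omega> xs)"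
    using sum_doc_pmf_near_ge[where 'v = 'v] by blast
  obtain \<kappa> N where \<kappa>: "0 < \<kappa>" and denom: "\<And>m n X. 0 < m \<Longrightarrow> 0 < n \<Longrightarrow> N \<le> m * n \<Longrightarrow> (\<And>j. j < m \<Longrightarrow> length (X j) = n) \<Longrightarrow>
      \<kappa> / real (m * n) ^ (k + l) * likelihood G r J \<alpha> m X \<omega>\<^sub>0 \<le> (\<integral>\<omega>. likelihood G r J \<alpha> m X \<omega> \<partial>prior)"
    using marginal_likelihood_ge[OF c prior_mass] by blast
  define M where "M = 2 * (k + l) + CARD('v) + 2"
  define C where "C = 2 + 2 * real CARD('v) * sqrt (real M / 2)"
  have C: "0 < C" by (auto simp: C_def intro: add_pos_nonneg)
  show ?thesis
  proof (intro exI[of _ C] conjI C allI impI)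
    fix m n :: "nat \<Rightarrow> nat" and \<eta> :: real
    assume m: "filterlim m at_top sequentially" and n: "filterlim n at_top sequentially"
      and small: "(\<lambda>i. ln (real (n i))) \<in> o(\<lambda>i. real (m i))" and \<eta>: "0 < \<eta>"
    define K where "K = 2 * real CARD('v) + (real CARD('v) + 1) ^ CARD('v) + (2 * real CARD('v) + 1) / (\<kappa> * \<eta>)"
    define R where "R = (real M / (c\<^sub>1 * c))\<^sup>2"
    have R: "0 < R" using c0 c\<^sub>1 by (simp add: R_def M_def)
    have ev_m: "\<forall>\<^sub>F i in sequentially. a \<le> m i" for a using m by (simp add: filterlim_at_top)
    have ev_n: "\<forall>\<^sub>F i in sequentially. a \<le> n i" for a using n by (simp add: filterlim_at_top)
    have mr: "filterlim (\<lambda>i. real (m i)) at_top sequentially"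
      by (rule filterlim_compose[OF filterlim_real_sequentially m])
    have nr: "filterlim (\<lambda>i. real (n i)) at_top sequentially"
      by (rule filterlim_compose[OF filterlim_real_sequentially n])
    \<comment> \<open>The growth condition concerns \<open>ln (max m n)\<close>, the larger of two
      logarithms: \<open>ln n\<close> is controlled by the assumption \<open>ln n = o(m)\<close>,
      and \<open>ln m\<close> is always \<open>o(m)\<close>.\<close>
    have ev_ln_n: "\<forall>\<^sub>F i in sequentially. norm (ln (real (n i))) \<le> 1 / R * norm (real (m i))"
      using landau_o.smallD[OF small, of "1 / R"] R by simp
    have "((\<lambda>i. ln (real (m i)) / real (m i)) \<longlongrightarrow> 0) sequentially"
      by (rule filterlim_compose[OF ln_x_over_x_tendsto_0 mr])
    then have ev_ln_m: "\<forall>\<^sub>F i in sequentially. ln (real (m i)) / real (m i) < 1 / R"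
      by (rule order_tendstoD(2)) (use R in simp)
    have ev: "\<forall>\<^sub>F i in sequentially.
       measure (\<Pi>\<^sub>M j\<in>(UNIV :: nat set). doc_measure G r J \<alpha> (n i) \<omega>\<^sub>0)
         {X \<in> space (\<Pi>\<^sub>M j\<in>(UNIV :: nat set). doc_measure G r J \<alpha> (n i) \<omega>\<^sub>0).
            \<eta> < measure (posterior G r J \<alpha> prior (m i) X)
                  {\<omega> \<in> space prior. C * contraction_rate J \<alpha> (m i) (n i) < union_hausdorff G r (fst \<omega>) (fst \<omega>\<^sub>0)}}
         \<le> K / real (max (m i) (n i))"
      using ev_m[of "max 1 N"] ev_m[of "4 * CARD('v)"] ev_m[of 3] ev_n[of 1] ev_ln_n ev_ln_m
    proof eventually_elim
      case (elim i)
      have pos: "0 < m i" "0 < n i" using elim by auto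
      have "N * 1 \<le> m i * n i" using elim(1) pos(2) by (intro mult_mono) auto
      then have Nle: "N \<le> m i * n i" by simp
      have "exp 1 \<le> real (max (m i) (n i))" using exp_le elim(3) by (simp add: max_def)
      then have ln1: "1 \<le> ln (real (max (m i) (n i)))" using pos by (subst ln_ge_iff) auto
      have "R * ln (real (m i)) \<le> real (m i)" using elim(6) R pos by (simp add: field_simps)
      moreover have "R * ln (real (n i)) \<le> real (m i)"
      proof -
        have "R * ln (real (n i)) \<le> R * \<bar>ln (real (n i))\<bar>" using R by (intro mult_left_mono) auto
        also have "\<dots> \<le> real (m i)" using elim(5) R by (simp add: field_simps)
        finally show ?thesis .
      qed
      ultimately have growth: "R * ln (real (max (m i) (n i))) \<le> real (m i)" by (simp add: max_def)
      show ?case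
        unfolding C_def K_def
      proof (rule posterior_far_prob_le_inverse[OF J2 c0 \<kappa> \<eta> near _ M_def pos ln1 _ growth[unfolded R_def]])
        show "\<kappa> / real (m i * n i) ^ (k + l) * likelihood G r J \<alpha> (m i) X \<omega>\<^sub>0 \<le> (\<integral>\<omega>. likelihood G r J \<alpha> (m i) X \<omega> \<partial>prior)"
          if "\<And>j. j < m i \<Longrightarrow> length (X j) = n i" for X
          by (rule denom[OF pos Nle that])
      qed (use elim in auto)
    qed
    \<comment> \<open>Divergence of \<open>m\<close> alone already makes the maximum diverge, while
      \<open>K\<close> depends on \<eta> but not on \<open>i\<close>.\<close>
    have lim: "((\<lambda>i. K / real (max (m i) (n i))) \<longlongrightarrow> 0) sequentially"
    proof (rule tendsto_divide_0[OF tendsto_const])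
      have "filterlim (\<lambda>i. real (max (m i) (n i))) at_top sequentially"
        by (rule filterlim_at_top_mono[OF mr]) simp
      then show "filterlim (\<lambda>i. real (max (m i) (n i))) at_infinity sequentially"
        by (rule filterlim_at_top_imp_at_infinity)
    qed
    show "(\<lambda>i. let P = (\<Pi>\<^sub>M j\<in>(UNIV :: nat set). doc_measure G r J \<alpha> (n i) \<omega>\<^sub>0)
       in measure P {X \<in> space P. \<eta> < measure (posterior G r J \<alpha> prior (m i) X)
            {\<omega> \<in> space prior. C * contraction_rate J \<alpha> (m i) (n i) < union_hausdorff G r (fst \<omega>) (fst \<omega>\<^sub>0)}})
       \<longlonglongrightarrow> 0"
      unfolding Let_def by (rule tendsto_sandwich[OF _ ev tendsto_const lim]) (simp add: always_eventually)
  qed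
qed

end

theorem theorem5:
  fixes G :: "'u pair_pre_digraph" and r :: 'u and J :: nat and \<alpha>\<^sub>0 :: real
    and prior :: "('u, 'v::finite) param measure"
    and \<omega>\<^sub>0 :: "('u, 'v) param"
    and c\<^sub>0 c\<^sub>1 c\<^sub>2 c\<^sub>3 \<delta> :: real
  assumes tree: "directed_rooted_tree G r"
    and depth: "\<And>\<phi>. \<phi> \<in> maximal_paths G r \<Longrightarrow> length \<phi> = J"
    and J: "2 \<le> J"
    and \<alpha>: "0 < \<alpha>\<^sub>0"
    and prior: "prob_space prior" "sets prior = sets (param_measurable_space G r)"
    and truth: "\<omega>\<^sub>0 \<in> measure_support (param_topology G r) prior"
    and pos: "0 < c\<^sub>0" "0 < c\<^sub>1" "0 < c\<^sub>2" "0 < c\<^sub>3" "0 < \<delta>"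
    and bounded_below:
      "\<And>\<omega> u v. \<omega> \<in> measure_support (param_topology G r) prior \<Longrightarrow> u \<in> pverts G \<Longrightarrow>
         c\<^sub>0 \<le> fst \<omega> u $ v"
      "\<And>\<omega> \<phi>. \<omega> \<in> measure_support (param_topology G r) prior \<Longrightarrow> \<phi> \<in> maximal_paths G r \<Longrightarrow>
         c\<^sub>1 \<le> snd \<omega> \<phi>"
    and corners:
      "\<And>\<omega> \<phi>. \<omega> \<in> measure_support (param_topology G r) prior \<Longrightarrow> \<phi> \<in> maximal_paths G r \<Longrightarrow>
         non_obtuse_corner \<delta> (component_polytope (fst \<omega>) \<phi>)"
    and prior_mass:
      "\<forall>\<^sub>F \<epsilon> in at_right 0.
         let A = {\<omega> \<in> space prior. \<forall>u\<in>pverts G. norm (fst \<omega> u - fst \<omega>\<^sub>0 u) \<le> \<epsilon>};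
             B = {\<omega> \<in> space prior. \<forall>\<phi>\<in>maximal_paths G r. \<bar>snd \<omega> \<phi> - snd \<omega>\<^sub>0 \<phi>\<bar> \<le> \<epsilon>}
         in c\<^sub>2 * \<epsilon> ^ (card (pverts G) * (CARD('v) - 1)) \<le> measure prior A \<and>
            c\<^sub>3 * \<epsilon> ^ (card (maximal_paths G r) - 1) \<le> measure prior B \<and>
            prob_space.indep_event prior A B"
  shows "\<exists>C>0. \<forall>m n :: nat \<Rightarrow> nat.
    filterlim m at_top sequentially \<longrightarrow> filterlim n at_top sequentially \<longrightarrow>
    (\<lambda>i. ln (real (n i))) \<in> o(\<lambda>i. real (m i)) \<longrightarrow>
    (\<forall>\<eta>>0. (\<lambda>i.
       let P = (\<Pi>\<^sub>M j\<in>(UNIV :: nat set). doc_measure G r J \<alpha>\<^sub>0 (n i) \<omega>\<^sub>0)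
       in measure P {X \<in> space P.
            \<eta> < measure (posterior G r J \<alpha>\<^sub>0 prior (m i) X)
                  {\<omega> \<in> space prior.
                     C * contraction_rate J \<alpha>\<^sub>0 (m i) (n i) < union_hausdorff G r (fst \<omega>) (fst \<omega>\<^sub>0)}})
       \<longlonglongrightarrow> 0)"
proof -
  note depth_ge_2 = J
  have "finite (pverts G)"
    using tree by (simp add: directed_rooted_tree_def pair_digraph_def pair_fin_digraph.pair_finite_verts)
  moreover have "admixture_tree G r J \<alpha>\<^sub>0"
    using depth J \<alpha> by unfold_locales auto
  ultimately interpret contraction_setting G r J \<alpha>\<^sub>0 prior \<omega>\<^sub>0 c\<^sub>0 c\<^sub>1
    using prior truth pos bounded_below
    by (auto simp: contraction_setting_def contraction_setting_axioms_def)
  show ?thesis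
    by (rule posterior_contraction[OF depth_ge_2 pos(3,4) prior_mass])
qed

end
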